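(* Let $A$ be a Boolean constraint language and let $\mathrm{T}=\{\pm1\}^2$ be the full binary Boolean relation. The following statements are equivalent: (1) $A$ does not have a satisfiability gap of the first kind; (2) $A$ does not have a satisfiability gap of the second kind; (3) $A\cup\{\mathrm{T}\}$ does not have a satisfiability gap of the third kind; (4) $A$ is $0$-valid, or $A$ is $1$-valid, or $A$ is bijunctive, or $A$ is Horn, or $A$ is dual Horn.
   Context: Boolean values are represented by $\{\pm1\}$, with $+1$ meaning "false" and $-1$ meaning "true". A Boolean constraint language is a set of relations $R\subseteq\{\pm1\}^r$ (of various arities $r$). For a Boolean relation $R$ of arity $r$, its characteristic polynomial $P_R\in\mathbb{C}[X_1,\dots,X_r]$ is the unique multilinear polynomial with $P_R(a)=-1$ for $a\in R$ and $P_R(a)=+1$ for $a\in\{\pm1\}^r\setminus R$. An instance over $A$ on variables $X_1,\dots,X_n$ is a finite list of constraints $(Z_i,R_i)$, $i=1,\dots,m$, where $R_i\in A$ has arity $r_i$ and $Z_i$ is an $r_i$-tuple whose entries are variables or constants from $\{\pm1\}$. The instance is satisfiable in the Boolean domain if there is an assignment $f$ of values in $\{\pm1\}$ to the variables (with constants mapped to themselves) such that $f(Z_i)\in R_i$ for all $i$. For a Hilbert space $\mathcal{H}$, an operator assignment for the instance over $\mathcal{H}$ maps each variable to a bounded self-adjoint linear operator $B$ on $\mathcal{H}$ with $B^2=I$, maps the constants $+1,-1$ to $I,-I$, and is such that the operators assigned to the entries of each single scope $Z_i$ pairwise commute; it is satisfying if $P_{R_i}(f(Z_i))=-I$ for every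 $i$. The instance is satisfiable via fd-operators if it has a satisfying operator assignment over some finite-dimensional Hilbert space, and satisfiable via operators if it has one over some (arbitrary) Hilbert space. The language $A$ has a satisfiability gap of the first kind if some instance over $A$ is not satisfiable in the Boolean domain but is satisfiable via fd-operators; of the second kind if some instance over $A$ is not satisfiable in the Boolean domain but is satisfiable via operators; of the third kind if some instance over $A$ is satisfiable via operators but not via fd-operators. $A$ is $0$-valid if every relation in $A$ contains the all-$(+1)$ tuple; $1$-valid if every relation in $A$ contains the all-$(-1)$ tuple; bijunctive if every relation in $A$ is the set of satisfying assignments of a CNF formula whose clauses have at most two literals; Horn (resp. dual Horn) if every relation in $A$ is the set of satisfying assignments of a CNF formula each of whose clauses has at most one positive (resp. at most one negative) literal.
   Formalization: Gaps are witnessed only by instances without constants in their scopes, and all relations in A are non-empty; with constants the claim fails, e.g. for A={x1x2x3x4=1}, which is 0-valid but has gaps of the first and second kind by the Mermin-Peres square. *)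

theory Defs
  imports
    "HOL-Algebra.Algebraic_Closure_Type"
    "HOL-Analysis.Analysis"
begin

section \<open>Boolean relations and their characteristic polynomials\<close>

text \<open>Truth values are the integers \<open>1\<close> (false) and \<open>-1\<close> (true). A relation carries its arity
  explicitly, so that empty relations of different arities are distinct.\<close>

type_synonym brel = "nat \<times> int list set"

definition tuples :: "nat \<Rightarrow> int list set" where
  "tuples r = {a. length a = r \<and> set a \<subseteq> {1, -1}}"

definition bool_relation :: "brel \<Rightarrow> bool" where
  "bool_relation R \<longleftrightarrow> snd R \<subseteq> tuples (fst R)"

definition full2 :: brel where
  "full2 = (2, tuples 2)"

text \<open>A multilinear polynomial in \<open>X\<^sub>0, \<dots>, X\<^sub>r\<^sub>-\<^sub>1\<close> is given by its coefficients: \<open>c S\<close> is the coefficient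
  of the monomial \<open>\<Prod>i\<in>S. X\<^sub>i\<close>.\<close>

type_synonym mlpoly = "nat set \<Rightarrow> complex"

definition multilinear_poly :: "nat \<Rightarrow> mlpoly \<Rightarrow> bool" where
  "multilinear_poly r c \<longleftrightarrow> (\<forall>S. \<not> S \<subseteq> {..<r} \<longrightarrow> c S = 0)"

definition eval_bool :: "nat \<Rightarrow> mlpoly \<Rightarrow> int list \<Rightarrow> complex" where
  "eval_bool r c a = (\<Sum>S\<in>Pow {..<r}. c S * (\<Prod>i\<in>S. of_int (a ! i)))"

definition is_char_poly :: "brel \<Rightarrow> mlpoly \<Rightarrow> bool" where
  "is_char_poly R c \<longleftrightarrow> multilinear_poly (fst R) c \<and>
     (\<forall>a\<in>tuples (fst R). eval_bool (fst R) c a = (if a \<in> snd R then -1 else 1))"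

definition char_poly :: "brel \<Rightarrow> mlpoly" where
  "char_poly R = (THE c. is_char_poly R c)"

subsection \<open>The characteristic polynomial is well defined\<close>

lemma finite_tuples: "finite (tuples r)"
proof -
  have "finite {xs. set xs \<subseteq> {1, -1::int} \<and> length xs = r}"
    by (rule finite_lists_length_eq) simp
  then show ?thesis by (simp add: tuples_def conj_commute)
qed

lemma tuples_nth: "a \<in> tuples r \<Longrightarrow> i < r \<Longrightarrow> a ! i = 1 \<or> a ! i = -1"
  by (auto simp: tuples_def dest!: nth_mem)

lemma replicate_tuples: "replicate r 1 \<in> tuples r"
  by (auto simp: tuples_def)

lemma update_tuples:
  assumes a: "a \<in> tuples r" and i: "i < r"
  shows "a[i := - (a ! i)] \<in> tuples r"
proof -
  have "set (a[i := - (a ! i)]) \<subseteq> insert (- (a ! i)) (set a)"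
    by (rule set_update_subset_insert)
  with tuples_nth[OF a i] a show ?thesis
    by (auto simp: tuples_def)
qed

lemma sum_pow_prod:
  fixes f :: "'a \<Rightarrow> complex"
  assumes "finite A"
  shows "(\<Sum>S\<in>Pow A. \<Prod>i\<in>S. f i) = (\<Prod>i\<in>A. 1 + f i)"
  using assms
proof induction
  case (insert x A)
  have inj: "inj_on (insert x) (Pow A)"
    using insert by (auto simp: inj_on_def)
  have disj: "Pow A \<inter> insert x ` Pow A = {}"
    using insert by auto
  have "(\<Sum>S\<in>insert x ` Pow A. \<Prod>i\<in>S. f i) = (\<Sum>S\<in>Pow A. \<Prod>i\<in>insert x S. f i)"
    by (simp add: sum.reindex[OF inj])
  also have "\<dots> = (\<Sum>S\<in>Pow A. f x * (\<Prod>i\<in>S. f i))"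
    using insert by (intro sum.cong refl prod.insert) (auto dest: finite_subset)
  finally show ?case
    using insert disj
    by (simp add: Pow_insert sum.union_disjoint sum_distrib_left[symmetric] distrib_right)
qed simp

lemma orthogonality_tuples:
  assumes a: "a \<in> tuples r" and b: "b \<in> tuples r"
  shows "(\<Sum>S\<in>Pow {..<r}. (\<Prod>i\<in>S. of_int (a ! i)) * (\<Prod>i\<in>S. of_int (b ! i)))
           = (if a = b then 2 ^ r else (0::complex))"
proof -
  have eq: "(\<Sum>S\<in>Pow {..<r}. (\<Prod>i\<in>S. of_int (a ! i)) * (\<Prod>i\<in>S. of_int (b ! i)))
        = (\<Prod>i<r. 1 + of_int (a ! i) * (of_int (b ! i) :: complex))"
    by (simp add: prod.distrib[symmetric] sum_pow_prod)
  show ?thesis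
  proof (cases "a = b")
    case True
    have "1 + of_int (a ! i) * (of_int (b ! i) :: complex) = 2" if "i < r" for i
      using tuples_nth[OF a that] True by auto
    then show ?thesis using eq True by simp
  next
    case False
    then obtain i where i: "i < r" "a ! i \<noteq> b ! i"
      using a b by (auto simp: tuples_def list_eq_iff_nth_eq)
    have "1 + of_int (a ! i) * (of_int (b ! i) :: complex) = 0"
      using tuples_nth[OF a i(1)] tuples_nth[OF b i(1)] i(2) by auto
    then have "(\<Prod>i<r. 1 + of_int (a ! i) * (of_int (b ! i) :: complex)) = 0"
      using i(1) by (intro prod_zero) auto
    then show ?thesis using eq False by simp
  qed
qed

lemma orthogonality_subsets:
  assumes S: "S \<subseteq> {..<r}" and T: "T \<subseteq> {..<r}" and "S \<noteq> T"
  shows "(\<Sum>a\<in>tuples r. (\<Prod>i\<in>S. of_int (a ! i)) * (\<Prod>i\<in>T. of_int (a ! i))) = (0::complex)"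
proof -
  define g where "g U a = (\<Prod>i\<in>U. of_int (a ! i) :: complex)" for U :: "nat set" and a :: "int list"
  obtain k where k: "k < r" "(k \<in> S) \<noteq> (k \<in> T)"
    using assms by blast
  define h where "h a = a[k := - (a ! k)]" for a :: "int list"
  have fin: "finite S" "finite T" using S T finite_subset by auto
  have flip: "g U (h a) = (if k \<in> U then - g U a else g U a)"
    if "finite U" "a \<in> tuples r" for U a
  proof -
    have len: "k < length a" using that k by (simp add: tuples_def)
    have rest: "(\<Prod>i\<in>U - {k}. of_int (h a ! i)) = (\<Prod>i\<in>U - {k}. of_int (a ! i) :: complex)"
      by (intro prod.cong) (auto simp: h_def)
    show ?thesis
    proof (cases "k \<in> U")
      case True
      then show ?thesis
        using prod.remove[OF that(1) True, of "\<lambda>i. of_int (h a ! i) :: complex"]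
          prod.remove[OF that(1) True, of "\<lambda>i. of_int (a ! i) :: complex"] rest len
        by (simp add: g_def h_def)
    next
      case False
      then show ?thesis using rest by (simp add: g_def)
    qed
  qed
  have hh: "h (h a) = a" if "a \<in> tuples r" for a
    using that k by (simp add: h_def tuples_def)
  have ht: "h a \<in> tuples r" if "a \<in> tuples r" for a
    using update_tuples[OF that k(1)] by (simp add: h_def)
  have "(\<Sum>a\<in>tuples r. g S a * g T a) = (\<Sum>a\<in>tuples r. g S (h a) * g T (h a))"
    by (rule sum.reindex_bij_witness[of _ h h]) (auto simp: hh ht)
  also have "\<dots> = (\<Sum>a\<in>tuples r. - (g S a * g T a))"
    using k(2) by (intro sum.cong refl) (auto simp: flip fin)
  also have "\<dots> = - (\<Sum>a\<in>tuples r. g S a * g T a)"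
    by (rule sum_negf)
  finally have "(\<Sum>a\<in>tuples r. g S a * g T a) = 0" by simp
  then show ?thesis by (simp add: g_def)
qed

lemma multilinear_poly_determined:
  assumes c: "multilinear_poly r c" and d: "multilinear_poly r d"
    and eq: "\<And>a. a \<in> tuples r \<Longrightarrow> eval_bool r c a = eval_bool r d a"
  shows "c = d"
proof
  fix T
  show "c T = d T"
  proof (cases "T \<subseteq> {..<r}")
    case False
    then show ?thesis using c d by (simp add: multilinear_poly_def)
  next
    case T: True
    define g where "g U a = (\<Prod>i\<in>U. of_int (a ! i) :: complex)" for U :: "nat set" and a :: "int list"
    define N where "N = (\<Sum>a\<in>tuples r. g T a * g T a)"
    have "g T a * g T a = 1" if a: "a \<in> tuples r" for a
    proof -
      have "of_int (a ! i) * of_int (a ! i) = (1::complex)" if "i \<in> T" for i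
        using tuples_nth[OF a, of i] that T by fastforce
      then show ?thesis by (simp add: g_def prod.distrib[symmetric])
    qed
    then have "N = of_nat (card (tuples r))"
      by (simp add: N_def)
    then have N: "N \<noteq> 0"
      using finite_tuples replicate_tuples by (auto simp: card_eq_0_iff)
    have coeff: "(\<Sum>a\<in>tuples r. eval_bool r e a * g T a) = e T * N" for e
    proof -
      have "(\<Sum>a\<in>tuples r. eval_bool r e a * g T a)
          = (\<Sum>S\<in>Pow {..<r}. e S * (\<Sum>a\<in>tuples r. g S a * g T a))"
        unfolding eval_bool_def g_def sum_distrib_right sum_distrib_left
        by (subst sum.swap) (simp add: mult.assoc)
      also have "\<dots> = (\<Sum>S\<in>Pow {..<r}. if S = T then e T * N else 0)"
        using T by (intro sum.cong refl) (auto simp: N_def g_def orthogonality_subsets)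
      also have "\<dots> = e T * N"
        using T by (simp add: sum.delta')
      finally show ?thesis .
    qed
    have "c T * N = d T * N"
      unfolding coeff[symmetric] by (intro sum.cong refl) (simp add: eq)
    with N show ?thesis by simp
  qed
qed

lemma ex1_char_poly: "\<exists>!c. is_char_poly R c"
proof (rule ex_ex1I)
  define r where "r = fst R"
  define v where "v a = (if a \<in> snd R then -1 else 1 :: complex)" for a
  define g where "g U a = (\<Prod>i\<in>U. of_int (a ! i) :: complex)" for U :: "nat set" and a :: "int list"
  define c where "c S = (if S \<subseteq> {..<r} then (\<Sum>b\<in>tuples r. v b * g S b) / 2 ^ r else 0)" for S
  have "eval_bool r c a = v a" if a: "a \<in> tuples r" for a
  proof -
    have "eval_bool r c a = (\<Sum>S\<in>Pow {..<r}. \<Sum>b\<in>tuples r. v b / 2 ^ r * (g S b * g S a))"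
      by (simp add: eval_bool_def c_def g_def sum_distrib_right sum_divide_distrib mult.assoc)
    also have "\<dots> = (\<Sum>b\<in>tuples r. v b / 2 ^ r * (\<Sum>S\<in>Pow {..<r}. g S b * g S a))"
      by (subst sum.swap) (simp add: sum_distrib_left)
    also have "\<dots> = (\<Sum>b\<in>tuples r. if b = a then v a else 0)"
      using a by (intro sum.cong refl) (simp add: g_def orthogonality_tuples)
    also have "\<dots> = v a"
      using a by (simp add: finite_tuples)
    finally show ?thesis .
  qed
  then have "is_char_poly R c"
    by (simp add: is_char_poly_def multilinear_poly_def c_def r_def v_def)
  then show "\<exists>c. is_char_poly R c" by blast
next
  show "c = d" if "is_char_poly R c" "is_char_poly R d" for c d
    using that by (intro multilinear_poly_determined[of "fst R"]) (auto simp: is_char_poly_def)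
qed

lemma is_char_poly_char_poly: "is_char_poly R (char_poly R)"
  unfolding char_poly_def by (rule theI'[OF ex1_char_poly])


section \<open>Schaefer's classes\<close>

datatype lit = is_Pos: Pos nat | Neg nat

fun lit_index :: "lit \<Rightarrow> nat" where
  "lit_index (Pos i) = i"
| "lit_index (Neg i) = i"

fun lit_true :: "int list \<Rightarrow> lit \<Rightarrow> bool" where
  "lit_true a (Pos i) \<longleftrightarrow> a ! i = -1"
| "lit_true a (Neg i) \<longleftrightarrow> a ! i = 1"

type_synonym clause = "lit list"

definition cnf_models :: "nat \<Rightarrow> clause list \<Rightarrow> int list set" where
  "cnf_models r F = {a \<in> tuples r. \<forall>C\<in>set F. \<exists>l\<in>set C. lit_true a l}"

definition cnf_definable :: "(clause \<Rightarrow> bool) \<Rightarrow> brel \<Rightarrow> bool" where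
  "cnf_definable P R \<longleftrightarrow> (\<exists>F. (\<forall>C\<in>set F. P C \<and> (\<forall>l\<in>set C. lit_index l < fst R)) \<and>
     snd R = cnf_models (fst R) F)"

definition zero_valid :: "brel set \<Rightarrow> bool" where
  "zero_valid A \<longleftrightarrow> (\<forall>R\<in>A. replicate (fst R) 1 \<in> snd R)"

definition one_valid :: "brel set \<Rightarrow> bool" where
  "one_valid A \<longleftrightarrow> (\<forall>R\<in>A. replicate (fst R) (-1) \<in> snd R)"

definition bijunctive :: "brel set \<Rightarrow> bool" where
  "bijunctive A \<longleftrightarrow> (\<forall>R\<in>A. cnf_definable (\<lambda>C. length C \<le> 2) R)"

definition horn :: "brel set \<Rightarrow> bool" where
  "horn A \<longleftrightarrow> (\<forall>R\<in>A. cnf_definable (\<lambda>C. length (filter is_Pos C) \<le> 1) R)"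

definition dual_horn :: "brel set \<Rightarrow> bool" where
  "dual_horn A \<longleftrightarrow> (\<forall>R\<in>A. cnf_definable (\<lambda>C. length (filter (\<lambda>l. \<not> is_Pos l) C) \<le> 1) R)"


section \<open>Instances and Boolean satisfiability\<close>

datatype arg = Var nat | Const int

text \<open>An instance \<open>(n, cs)\<close> has the variables \<open>Var 0, \<dots>, Var (n - 1)\<close>.\<close>

type_synonym csp_instance = "nat \<times> (arg list \<times> brel) list"

fun valid_arg :: "nat \<Rightarrow> arg \<Rightarrow> bool" where
  "valid_arg n (Var i) \<longleftrightarrow> i < n"
| "valid_arg n (Const c) \<longleftrightarrow> c \<in> {1, -1}"

definition instance_over :: "brel set \<Rightarrow> csp_instance \<Rightarrow> bool" where
  "instance_over A I \<longleftrightarrow> (\<forall>(Z, R)\<in>set (snd I).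
     R \<in> A \<and> length Z = fst R \<and> (\<forall>t\<in>set Z. valid_arg (fst I) t))"

definition constant_free :: "csp_instance \<Rightarrow> bool" where
  "constant_free I \<longleftrightarrow> (\<forall>(Z, R)\<in>set (snd I). \<forall>t\<in>set Z. \<exists>i. t = Var i)"

fun bool_val :: "(nat \<Rightarrow> int) \<Rightarrow> arg \<Rightarrow> int" where
  "bool_val f (Var i) = f i"
| "bool_val f (Const c) = c"

definition bool_satisfiable :: "csp_instance \<Rightarrow> bool" where
  "bool_satisfiable I \<longleftrightarrow> (\<exists>f. (\<forall>i<fst I. f i \<in> {1, -1}) \<and>
     (\<forall>(Z, R)\<in>set (snd I). map (bool_val f) Z \<in> snd R))"


section \<open>Complex Hilbert spaces\<close>

text \<open>The notions below quantify existentially over Hilbert spaces, so these are records with a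
  carrier set. As usual for modules in HOL-Algebra, the fields \<open>mult\<close> and \<open>one\<close> are
  unused.\<close>

record 'h hilbert = "(complex, 'h) module" +
  cinner :: "'h \<Rightarrow> 'h \<Rightarrow> complex"

definition hnorm :: "('h, 'm) hilbert_scheme \<Rightarrow> 'h \<Rightarrow> real" where
  "hnorm H x = sqrt (Re (cinner H x x))"

text \<open>The value outside the carrier makes \<open>hdist\<close> satisfy the assumptions of
  \<^locale>\<open>Metric_space\<close>, some of which are not relativised to the carrier.\<close>

definition hdist :: "('h, 'm) hilbert_scheme \<Rightarrow> 'h \<Rightarrow> 'h \<Rightarrow> real" where
  "hdist H x y = (if x \<in> carrier H \<and> y \<in> carrier H then hnorm H (x \<ominus>\<^bsub>H\<^esub> y) else 0)"

locale hilbert_space = Module.module "ring_of_type_algebra :: complex ring" H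
  for H :: "('h, 'm) hilbert_scheme" (structure) +
  assumes cinner_add_left:
      "\<lbrakk>x \<in> carrier H; y \<in> carrier H; z \<in> carrier H\<rbrakk> \<Longrightarrow>
        cinner H (x \<oplus> y) z = cinner H x z + cinner H y z"
    and cinner_smult_left:
      "\<lbrakk>x \<in> carrier H; y \<in> carrier H\<rbrakk> \<Longrightarrow> cinner H (a \<odot> x) y = a * cinner H x y"
    and cinner_commute:
      "\<lbrakk>x \<in> carrier H; y \<in> carrier H\<rbrakk> \<Longrightarrow> cinner H y x = cnj (cinner H x y)"
    and cinner_pos:
      "\<lbrakk>x \<in> carrier H; x \<noteq> \<zero>\<rbrakk> \<Longrightarrow> Re (cinner H x x) > 0"
    and complete:
      "Metric_space.mcomplete (carrier H) (hdist H)"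

definition finite_dimensional :: "('h, 'm) hilbert_scheme \<Rightarrow> bool" where
  "finite_dimensional H \<longleftrightarrow> (\<exists>B. finite B \<and> B \<subseteq> carrier H \<and>
     (\<forall>x\<in>carrier H. \<exists>c. x = (\<Oplus>\<^bsub>H\<^esub>b\<in>B. c b \<odot>\<^bsub>H\<^esub> b)))"

text \<open>Operators are functions on the whole type of which only the restriction to the carrier
  matters.\<close>

definition bounded_operator :: "('h, 'm) hilbert_scheme \<Rightarrow> ('h \<Rightarrow> 'h) \<Rightarrow> bool" where
  "bounded_operator H B \<longleftrightarrow>
     (\<forall>x\<in>carrier H. B x \<in> carrier H) \<and>
     (\<forall>x\<in>carrier H. \<forall>y\<in>carrier H. B (x \<oplus>\<^bsub>H\<^esub> y) = B x \<oplus>\<^bsub>H\<^esub> B y) \<and>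
     (\<forall>a. \<forall>x\<in>carrier H. B (a \<odot>\<^bsub>H\<^esub> x) = a \<odot>\<^bsub>H\<^esub> B x) \<and>
     (\<exists>K. \<forall>x\<in>carrier H. hnorm H (B x) \<le> K * hnorm H x)"

definition selfadjoint :: "('h, 'm) hilbert_scheme \<Rightarrow> ('h \<Rightarrow> 'h) \<Rightarrow> bool" where
  "selfadjoint H B \<longleftrightarrow> (\<forall>x\<in>carrier H. \<forall>y\<in>carrier H. cinner H (B x) y = cinner H x (B y))"

text \<open>The value of a multilinear polynomial at the operators \<open>Bs\<close>, applied to the vector \<open>x\<close>.
  It is only used for pairwise commuting operators, for which the order of the factors in a
  monomial is irrelevant; here the indices increase from left to right.\<close>

definition eval_op ::
    "('h, 'm) hilbert_scheme \<Rightarrow> mlpoly \<Rightarrow> ('h \<Rightarrow> 'h) list \<Rightarrow> 'h \<Rightarrow> 'h" where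
  "eval_op H c Bs x =
     (\<Oplus>\<^bsub>H\<^esub>S\<in>Pow {..<length Bs}. c S \<odot>\<^bsub>H\<^esub> foldr (\<lambda>i. Bs ! i) (sorted_list_of_set S) x)"


section \<open>Operator assignments and satisfiability gaps\<close>

fun op_val :: "('h, 'm) hilbert_scheme \<Rightarrow> (nat \<Rightarrow> 'h \<Rightarrow> 'h) \<Rightarrow> arg \<Rightarrow> 'h \<Rightarrow> 'h" where
  "op_val H f (Var i) = f i"
| "op_val H f (Const c) = (\<lambda>x. of_int c \<odot>\<^bsub>H\<^esub> x)"

definition operator_assignment ::
    "('h, 'm) hilbert_scheme \<Rightarrow> csp_instance \<Rightarrow> (nat \<Rightarrow> 'h \<Rightarrow> 'h) \<Rightarrow> bool" where
  "operator_assignment H I f \<longleftrightarrow>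
     (\<forall>i<fst I. bounded_operator H (f i) \<and> selfadjoint H (f i) \<and>
        (\<forall>x\<in>carrier H. f i (f i x) = x)) \<and>
     (\<forall>(Z, R)\<in>set (snd I). \<forall>s\<in>set Z. \<forall>t\<in>set Z. \<forall>x\<in>carrier H.
        op_val H f s (op_val H f t x) = op_val H f t (op_val H f s x))"

definition satisfying_operator_assignment ::
    "('h, 'm) hilbert_scheme \<Rightarrow> csp_instance \<Rightarrow> (nat \<Rightarrow> 'h \<Rightarrow> 'h) \<Rightarrow> bool" where
  "satisfying_operator_assignment H I f \<longleftrightarrow> operator_assignment H I f \<and>
     (\<forall>(Z, R)\<in>set (snd I). \<forall>x\<in>carrier H.
        eval_op H (char_poly R) (map (op_val H f) Z) x = \<ominus>\<^bsub>H\<^esub> x)"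

text \<open>The argument of type \<^typ>\<open>'h itself\<close> fixes the universe in which the carriers of the Hilbert
  spaces live. The zero space is excluded: there \<open>I = -I\<close>, and every instance would be
  satisfied.\<close>

definition op_satisfiable :: "'h itself \<Rightarrow> csp_instance \<Rightarrow> bool" where
  "op_satisfiable _ I \<longleftrightarrow> (\<exists>(H :: 'h hilbert) f. hilbert_space H \<and> carrier H \<noteq> {\<zero>\<^bsub>H\<^esub>} \<and>
     satisfying_operator_assignment H I f)"

definition fd_satisfiable :: "'h itself \<Rightarrow> csp_instance \<Rightarrow> bool" where
  "fd_satisfiable _ I \<longleftrightarrow> (\<exists>(H :: 'h hilbert) f. hilbert_space H \<and> carrier H \<noteq> {\<zero>\<^bsub>H\<^esub>} \<and>
     finite_dimensional H \<and> satisfying_operator_assignment H I f)"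

text \<open>Gaps are witnessed by instances without constants in the scopes. With constants,
  \<open>0\<close>-validity and \<open>1\<close>-validity do not preclude gaps: the relation \<open>x\<^sub>1x\<^sub>2x\<^sub>3x\<^sub>4 = 1\<close> has both
  properties, and the Mermin-Peres magic square is an instance over it when the right-hand
  sides are written as constants in the fourth position. Without constants, languages with an
  empty relation have to be excluded as well: adding one to a \<open>0\<close>-valid language creates no
  gap, since no instance using it is satisfiable via operators, but destroys
  \<open>0\<close>-validity.\<close>

definition gap_first :: "'h itself \<Rightarrow> brel set \<Rightarrow> bool" where
  "gap_first U A \<longleftrightarrow> (\<exists>I. instance_over A I \<and> constant_free I \<and>
     \<not> bool_satisfiable I \<and> fd_satisfiable U I)"

definition gap_second :: "'h itself \<Rightarrow> brel set \<Rightarrow> bool" where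
  "gap_second U A \<longleftrightarrow> (\<exists>I. instance_over A I \<and> constant_free I \<and>
     \<not> bool_satisfiable I \<and> op_satisfiable U I)"

definition gap_third :: "'h itself \<Rightarrow> brel set \<Rightarrow> bool" where
  "gap_third U A \<longleftrightarrow> (\<exists>I. instance_over A I \<and> constant_free I \<and>
     op_satisfiable U I \<and> \<not> fd_satisfiable U I)"

end

(* If A belongs to one of the classes in (4), then a model by operators yields a Boolean model by
   unit propagation (Horn) or by the implications between literals (bijunctive), where "literal l
   is true" is read as "the vector v is an eigenvector of the operator of the variable of l".

   Otherwise every polymorphism of A is an affine function of odd arity, hence A pp-defines
   the relations x1 x2 x3 x4 = 1 and x1 x2 x3 x4 = -1, and constraints over these can be replaced by
   constraints over A: existentially quantified variables are interpreted by the functional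
   calculus of commuting involutions, and the full binary relation forces them to commute.
   Parity constraints express (ab)^2 = q by a magic square. A single relation (ab)^2 = -1
   gives the gap of the first kind. For the third kind, such relations describe a group with an
   element Y that is conjugate to both -Y and Y^2. It acts on functions on the rationals, Y being
   the translation by 1, but in finite dimension the minimal polynomial of Y would be even, and
   half of its degree would suffice. *)

theory Submission
  imports Defs
begin

section \<open>Commuting involutions and their joint eigenvectors\<close>

text \<open>Finitely many commuting self-adjoint involutions are jointly diagonalisable on every
  Hilbert space. So a constraint only restricts the labels of nonzero joint eigenvectors, and
  implications valid on a relation transfer to vectors. Two obstacles shape the hard case. Scopes
  contain no constants, so the identity is represented by a variable that commutes with all others
  and is divided out afterwards. And to fill a magic square where \<open>a\<close> and
  \<open>b\<close> anticommute, a second anticommuting pair is required; a tensor factor C^2 is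
  reserved for it (\<open>ancilla\<close>). The full relation matters where a parity is read back
  from operators, since that argument diagonalises scope and auxiliary variables together. For the
  first kind it is dropped again: Boolean models satisfy it anyway, and operator models survive the
  loss of constraints. The group of the third gap is presented by products of commuting involutions
  and by conjugations of involutions, as parities and squares express these; hence Y is a product of
  two reflections. In the model t0 is the identity on one of two copies, so b can negate it on the
  other copy only, and the sign operator J records this.\<close>

definition linear_op :: "('h, 'm) hilbert_scheme \<Rightarrow> ('h \<Rightarrow> 'h) \<Rightarrow> bool" where
  "linear_op H B \<longleftrightarrow>
     (\<forall>x\<in>carrier H. B x \<in> carrier H) \<and>
     (\<forall>x\<in>carrier H. \<forall>y\<in>carrier H. B (x \<oplus>\<^bsub>H\<^esub> y) = B x \<oplus>\<^bsub>H\<^esub> B y) \<and>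
     (\<forall>a. \<forall>x\<in>carrier H. B (a \<odot>\<^bsub>H\<^esub> x) = a \<odot>\<^bsub>H\<^esub> B x)"

text \<open>Boundedness is not demanded: a self-adjoint involution preserves
  \<open>cinner H x x\<close>, so it is isometric (\<open>invol_bounded\<close>).\<close>

definition invol :: "('h, 'm) hilbert_scheme \<Rightarrow> ('h \<Rightarrow> 'h) \<Rightarrow> bool" where
  "invol H B \<longleftrightarrow> linear_op H B \<and> selfadjoint H B \<and> (\<forall>x\<in>carrier H. B (B x) = x)"

definition commute_on :: "('h, 'm) hilbert_scheme \<Rightarrow> ('h \<Rightarrow> 'h) \<Rightarrow> ('h \<Rightarrow> 'h) \<Rightarrow> bool" where
  "commute_on H B C \<longleftrightarrow> (\<forall>x\<in>carrier H. B (C x) = C (B x))"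

definition comm_invols :: "('h, 'm) hilbert_scheme \<Rightarrow> ('h \<Rightarrow> 'h) list \<Rightarrow> bool" where
  "comm_invols H Bs \<longleftrightarrow> (\<forall>B\<in>set Bs. invol H B) \<and> (\<forall>B\<in>set Bs. \<forall>C\<in>set Bs. commute_on H B C)"

text \<open>The zero vector counts, with every label, so that the vectors of a fixed label form a
  subspace. Statements about labels therefore add that the vector is nonzero.\<close>

definition joint_eigen ::
    "('h, 'm) hilbert_scheme \<Rightarrow> ('h \<Rightarrow> 'h) list \<Rightarrow> int list \<Rightarrow> 'h \<Rightarrow> bool" where
  "joint_eigen H Bs a x \<longleftrightarrow> x \<in> carrier H \<and> a \<in> tuples (length Bs) \<and>
     (\<forall>i<length Bs. (Bs ! i) x = of_int (a ! i) \<odot>\<^bsub>H\<^esub> x)"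

lemma linear_opD:
  assumes "linear_op H B"
  shows "x \<in> carrier H \<Longrightarrow> B x \<in> carrier H"
    and "x \<in> carrier H \<Longrightarrow> y \<in> carrier H \<Longrightarrow> B (x \<oplus>\<^bsub>H\<^esub> y) = B x \<oplus>\<^bsub>H\<^esub> B y"
    and "x \<in> carrier H \<Longrightarrow> B (a \<odot>\<^bsub>H\<^esub> x) = a \<odot>\<^bsub>H\<^esub> B x"
  using assms by (auto simp: linear_op_def)

lemma involD:
  assumes "invol H B"
  shows "linear_op H B" "selfadjoint H B" "x \<in> carrier H \<Longrightarrow> B (B x) = x"
    "x \<in> carrier H \<Longrightarrow> B x \<in> carrier H"
  using assms by (auto simp: invol_def linear_op_def)

lemma commute_onD: "commute_on H B C \<Longrightarrow> x \<in> carrier H \<Longrightarrow> B (C x) = C (B x)"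
  by (simp add: commute_on_def)

lemma commute_on_sym: "commute_on H B C \<Longrightarrow> commute_on H C B"
  by (simp add: commute_on_def)

lemma commute_on_refl [simp]: "commute_on H B B"
  by (simp add: commute_on_def)

context hilbert_space
begin

lemma sm_closed [simp]: "x \<in> carrier H \<Longrightarrow> a \<odot> x \<in> carrier H"
  by (rule smult_closed) (simp_all add: ring_of_type_algebra_def)

lemma sm_add: "x \<in> carrier H \<Longrightarrow> (a + b) \<odot> x = a \<odot> x \<oplus> b \<odot> x"
  using smult_l_distr[of a b x] by (simp add: ring_of_type_algebra_def)

lemma sm_distr: "x \<in> carrier H \<Longrightarrow> y \<in> carrier H \<Longrightarrow> a \<odot> (x \<oplus> y) = a \<odot> x \<oplus> a \<odot> y"
  using smult_r_distr[of a x y] by (simp add: ring_of_type_algebra_def)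

lemma sm_assoc [simp]: "x \<in> carrier H \<Longrightarrow> a \<odot> (b \<odot> x) = (a * b) \<odot> x"
  using smult_assoc1[of a b x] by (simp add: ring_of_type_algebra_def)

lemma sm_one [simp]: "x \<in> carrier H \<Longrightarrow> 1 \<odot> x = x"
  using smult_one[of x] by (simp add: ring_of_type_algebra_def)

lemma sm_zero_left [simp]: "x \<in> carrier H \<Longrightarrow> 0 \<odot> x = \<zero>"
  using smult_l_null[of x] by (simp add: ring_of_type_algebra_def)

lemma sm_zero_right [simp]: "a \<odot> \<zero> = \<zero>"
  using smult_r_null[of a] by (simp add: ring_of_type_algebra_def)

lemma sm_cancel: "x \<in> carrier H \<Longrightarrow> a \<noteq> 0 \<Longrightarrow> a \<odot> x = \<zero> \<Longrightarrow> x = \<zero>"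
  using sm_assoc[of x "inverse a" a] by simp

lemma minus_sm: "x \<in> carrier H \<Longrightarrow> \<ominus> x = (-1) \<odot> x"
proof -
  assume x: "x \<in> carrier H"
  have "x \<oplus> (-1) \<odot> x = \<zero>"
    using x sm_add[of x 1 "-1"] by simp
  then show ?thesis
    using x by (simp add: M.minus_equality M.a_comm)
qed

lemma sm_left_cancel: "x \<in> carrier H \<Longrightarrow> a \<odot> x = b \<odot> x \<Longrightarrow> a \<noteq> b \<Longrightarrow> x = \<zero>"
proof -
  assume x: "x \<in> carrier H" and eq: "a \<odot> x = b \<odot> x" and "a \<noteq> b"
  have "(a - b) \<odot> x = b \<odot> x \<oplus> (- b) \<odot> x"
    using sm_add[OF x, of a "- b"] eq by simp
  also have "\<dots> = \<zero>"
    using sm_add[OF x, of b "- b"] x by simp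
  finally show ?thesis using sm_cancel[OF x, of "a - b"] \<open>a \<noteq> b\<close> by simp
qed

lemma linear_op_zero: "linear_op H B \<Longrightarrow> B \<zero> = \<zero>"
  using linear_opD(3)[of H B \<zero> 0] linear_opD(1)[of H B \<zero>] by simp

lemma cinner_add_right:
  "x \<in> carrier H \<Longrightarrow> y \<in> carrier H \<Longrightarrow> z \<in> carrier H \<Longrightarrow>
    cinner H x (y \<oplus> z) = cinner H x y + cinner H x z"
  by (metis M.a_closed cinner_add_left cinner_commute complex_cnj_add)

lemma cinner_smult_right:
  "x \<in> carrier H \<Longrightarrow> y \<in> carrier H \<Longrightarrow> cinner H x (a \<odot> y) = cnj a * cinner H x y"
  by (metis cinner_smult_left cinner_commute complex_cnj_mult sm_closed)

lemma invol_bounded: "invol H B \<Longrightarrow> bounded_operator H B"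
proof -
  assume B: "invol H B"
  have "hnorm H (B x) = hnorm H x" if x: "x \<in> carrier H" for x
    using B x by (simp add: hnorm_def invol_def selfadjoint_def linear_op_def)
  then have "\<exists>K. \<forall>x\<in>carrier H. hnorm H (B x) \<le> K * hnorm H x"
    by (intro exI[of _ 1]) simp
  with B show ?thesis by (simp add: bounded_operator_def invol_def linear_op_def)
qed

lemma invol_iff:
  "invol H B \<longleftrightarrow> bounded_operator H B \<and> selfadjoint H B \<and> (\<forall>x\<in>carrier H. B (B x) = x)"
  using invol_bounded by (auto simp: invol_def bounded_operator_def linear_op_def)

text \<open>The explicit formulas for the two components are exported because they keep both inside
  every subspace invariant under \<open>B\<close>.\<close>

lemma eigen_split:
  assumes B: "invol H B" and x: "x \<in> carrier H"
  obtains y z where "y \<in> carrier H" "z \<in> carrier H" "x = y \<oplus> z" "B y = y" "B z = (-1) \<odot> z"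
    "y = (1/2) \<odot> (x \<oplus> B x)" "z = (1/2) \<odot> (x \<oplus> (-1) \<odot> B x)"
proof -
  have Bx: "B x \<in> carrier H" using involD(4)[OF B x] .
  note lin = linear_opD[OF involD(1)[OF B]]
  define y where "y = (1/2) \<odot> (x \<oplus> B x)"
  define z where "z = (1/2) \<odot> (x \<oplus> (-1) \<odot> B x)"
  have y: "y \<in> carrier H" and z: "z \<in> carrier H"
    using x Bx by (simp_all add: y_def z_def)
  have "y \<oplus> z = ((1/2) \<odot> x \<oplus> (1/2) \<odot> x) \<oplus> ((1/2) \<odot> B x \<oplus> (-1/2) \<odot> B x)"
    using x Bx by (simp add: y_def z_def sm_distr M.a_ac)
  also have "\<dots> = x"
    using x Bx by (simp add: sm_add[symmetric])
  finally have xyz: "x = y \<oplus> z" by simp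
  have By: "B y = y"
    using x Bx by (simp add: y_def lin involD(3)[OF B] M.a_comm)
  have Bz: "B z = (-1) \<odot> z"
    using x Bx by (simp add: z_def lin involD(3)[OF B] sm_distr M.a_comm)
  show thesis by (rule that[OF y z xyz By Bz y_def z_def])
qed

text \<open>This replaces simultaneous diagonalisation: every vector of an invariant subspace
  \<open>S\<close> is a finite sum of joint eigenvectors in \<open>S\<close>, whatever the
  dimension, because only finitely many involutions are split off one by one.\<close>

lemma joint_eigen_induct:
  assumes "comm_invols H Bs"
    and "S \<subseteq> carrier H"
    and "\<And>x y. x \<in> S \<Longrightarrow> y \<in> S \<Longrightarrow> x \<oplus> y \<in> S"
    and "\<And>a x. x \<in> S \<Longrightarrow> a \<odot> x \<in> S"
    and "\<And>B x. B \<in> set Bs \<Longrightarrow> x \<in> S \<Longrightarrow> B x \<in> S"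
    and "\<And>x y. x \<in> S \<Longrightarrow> y \<in> S \<Longrightarrow> Q x \<Longrightarrow> Q y \<Longrightarrow> Q (x \<oplus> y)"
    and "\<And>x a. x \<in> S \<Longrightarrow> joint_eigen H Bs a x \<Longrightarrow> Q x"
    and "x \<in> S"
  shows "Q x"
  using assms
proof (induction Bs arbitrary: S x)
  case Nil
  then show ?case by (auto simp: joint_eigen_def tuples_def)
next
  case (Cons B Bs)
  note S = Cons.prems(2-5)
  have B: "invol H B" and comm: "\<And>C. C \<in> set Bs \<Longrightarrow> commute_on H C B"
    and Bs: "comm_invols H Bs" and inv: "\<And>C. C \<in> set Bs \<Longrightarrow> invol H C"
    using Cons.prems(1) by (auto simp: comm_invols_def)
  note lin = linear_opD[OF involD(1)[OF B]]
  have xc: "x \<in> carrier H" using Cons.prems by auto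
  obtain y z where yz: "y \<in> carrier H" "z \<in> carrier H" "x = y \<oplus> z" "B y = y" "B z = (-1) \<odot> z"
    "y = (1/2) \<odot> (x \<oplus> B x)" "z = (1/2) \<odot> (x \<oplus> (-1) \<odot> B x)"
    using eigen_split[OF B xc] .
  \<comment> \<open>The eigenspaces of \<open>B\<close> inside \<open>S\<close> take over the role
    of \<open>S\<close> for the remaining operators, which leave them invariant by
    commutation.\<close>
  have half: "Q u" if u: "u \<in> S" and eig: "B u = of_int s \<odot> u" and s: "s \<in> {1, -1::int}" for u s
  proof (rule Cons.IH[of "{v \<in> S. B v = of_int s \<odot> v}"])
    show "comm_invols H Bs" by (rule Bs)
    show "{v \<in> S. B v = of_int s \<odot> v} \<subseteq> carrier H" using S by auto
    show "u \<in> {v \<in> S. B v = of_int s \<odot> v}" using u eig by simp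
    show "v \<oplus> w \<in> {v \<in> S. B v = of_int s \<odot> v}"
      if "v \<in> {v \<in> S. B v = of_int s \<odot> v}" "w \<in> {v \<in> S. B v = of_int s \<odot> v}" for v w
      using that S by (auto simp: lin sm_distr subset_iff)
    show "a \<odot> v \<in> {v \<in> S. B v = of_int s \<odot> v}" if "v \<in> {v \<in> S. B v = of_int s \<odot> v}" for a v
      using that S by (auto simp: lin subset_iff mult.commute)
    show "C v \<in> {v \<in> S. B v = of_int s \<odot> v}"
      if "C \<in> set Bs" "v \<in> {v \<in> S. B v = of_int s \<odot> v}" for C v
      using that S comm[OF that(1)] linear_opD[OF involD(1)[OF inv[OF that(1)]]]
      by (auto simp: commute_on_def subset_iff) metis
    show "Q (v \<oplus> w)"
      if "v \<in> {v \<in> S. B v = of_int s \<odot> v}" "w \<in> {v \<in> S. B v = of_int s \<odot> v}" "Q v" "Q w" for v w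
      using that Cons.prems(6) by auto
    show "Q v" if "v \<in> {v \<in> S. B v = of_int s \<odot> v}" "joint_eigen H Bs a v" for v a
    proof (rule Cons.prems(7)[of v "s # a"])
      show "joint_eigen H (B # Bs) (s # a) v"
        using that s by (auto simp: joint_eigen_def tuples_def nth_Cons split: nat.splits)
    qed (use that in auto)
  qed
  have yS: "y \<in> S" and zS: "z \<in> S"
    using yz(6,7) Cons.prems(8) S by (metis list.set_intros(1))+
  have "Q y" using half[OF yS, of 1] yz(1,4) by simp
  moreover have "Q z" using half[OF zS, of "-1"] yz(5) by simp
  ultimately show ?case
    unfolding yz(3) by (intro Cons.prems(6) yS zS)
qed

lemma joint_eigen_induct_carrier:
  assumes "comm_invols H Bs"
    and "\<And>x y. x \<in> carrier H \<Longrightarrow> y \<in> carrier H \<Longrightarrow> Q x \<Longrightarrow> Q y \<Longrightarrow> Q (x \<oplus> y)"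
    and "\<And>x a. joint_eigen H Bs a x \<Longrightarrow> Q x"
    and "x \<in> carrier H"
  shows "Q x"
proof (rule joint_eigen_induct[OF assms(1), of "carrier H"])
  show "B x \<in> carrier H" if "B \<in> set Bs" "x \<in> carrier H" for B x
    using assms(1) that by (auto simp: comm_invols_def invol_def linear_op_def)
qed (use assms(2-4) in auto)

section \<open>Multilinear polynomials at commuting operators\<close>

lemma foldr_linear_op:
  assumes "\<forall>B\<in>set Bs. linear_op H B" "\<forall>i\<in>set is. i < length Bs"
  shows "linear_op H (foldr (\<lambda>i. Bs ! i) is)"
  using assms
proof (induction "is")
  case Nil
  then show ?case by (simp add: linear_op_def)
next
  case (Cons i "is")
  then have "linear_op H (Bs ! i)" by auto
  with Cons show ?case by (simp add: linear_op_def)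
qed

lemma eval_op_term:
  assumes "\<forall>B\<in>set Bs. linear_op H B" "S \<in> Pow {..<length Bs}"
  shows "linear_op H (foldr (\<lambda>i. Bs ! i) (sorted_list_of_set S))"
proof -
  have "finite S" using assms(2) finite_subset by blast
  with assms show ?thesis by (intro foldr_linear_op) auto
qed

lemma finsum_linear:
  assumes "linear_op H D" "finite A" "\<And>i. i \<in> A \<Longrightarrow> g i \<in> carrier H"
  shows "D (\<Oplus>i\<in>A. g i) = (\<Oplus>i\<in>A. D (g i))"
  using assms(2,3)
  by (induction A) (auto simp: linear_opD[OF assms(1)] linear_op_zero[OF assms(1)] Pi_def)

lemma finsum_smult:
  assumes "finite A" "x \<in> carrier H"
  shows "(\<Oplus>i\<in>A. k i \<odot> x) = (\<Sum>i\<in>A. k i) \<odot> x"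
  using assms by (induction A) (auto simp: sm_add Pi_def)

lemma eval_op_linear:
  assumes "\<forall>B\<in>set Bs. linear_op H B"
  shows "linear_op H (eval_op H c Bs)"
proof -
  note t = linear_opD[OF eval_op_term[OF assms]]
  have 1: "eval_op H c Bs x \<in> carrier H" if "x \<in> carrier H" for x
    using that unfolding eval_op_def by (intro M.finsum_closed) (auto simp: t)
  have 2: "eval_op H c Bs (x \<oplus> y) = eval_op H c Bs x \<oplus> eval_op H c Bs y"
    if "x \<in> carrier H" "y \<in> carrier H" for x y
  proof -
    have "eval_op H c Bs (x \<oplus> y) = (\<Oplus>S\<in>Pow {..<length Bs}.
        c S \<odot> foldr (\<lambda>i. Bs ! i) (sorted_list_of_set S) x \<oplus>
        c S \<odot> foldr (\<lambda>i. Bs ! i) (sorted_list_of_set S) y)"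
      unfolding eval_op_def using that by (intro M.finsum_cong') (auto simp: t sm_distr)
    also have "\<dots> = eval_op H c Bs x \<oplus> eval_op H c Bs y"
      unfolding eval_op_def using that by (intro M.finsum_addf) (auto simp: t)
    finally show ?thesis .
  qed
  have 3: "eval_op H c Bs (a \<odot> x) = a \<odot> eval_op H c Bs x" if "x \<in> carrier H" for a x
  proof -
    have "linear_op H (\<lambda>x. a \<odot> x)"
      by (simp add: linear_op_def sm_distr mult.commute)
    then have "a \<odot> eval_op H c Bs x = (\<Oplus>S\<in>Pow {..<length Bs}.
        a \<odot> (c S \<odot> foldr (\<lambda>i. Bs ! i) (sorted_list_of_set S) x))"
      unfolding eval_op_def using that by (intro finsum_linear) (auto simp: t)
    also have "\<dots> = eval_op H c Bs (a \<odot> x)"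
      unfolding eval_op_def using that by (intro M.finsum_cong') (auto simp: t mult.commute)
    finally show ?thesis by simp
  qed
  show ?thesis using 1 2 3 by (simp add: linear_op_def)
qed

lemma eval_op_commute:
  assumes Bs: "\<forall>B\<in>set Bs. linear_op H B" and D: "linear_op H D"
    and comm: "\<forall>B\<in>set Bs. commute_on H D B"
  shows "commute_on H D (eval_op H c Bs)"
  unfolding commute_on_def
proof
  fix x assume x: "x \<in> carrier H"
  have fold: "D (foldr (\<lambda>i. Bs ! i) is x) = foldr (\<lambda>i. Bs ! i) is (D x)"
    if "\<forall>i\<in>set is. i < length Bs" for "is"
    using that
  proof (induction "is")
    case (Cons i "is")
    then have "foldr (\<lambda>i. Bs ! i) is x \<in> carrier H" "Bs ! i \<in> set Bs"
      using foldr_linear_op[OF Bs, of "is"] x by (auto simp: linear_op_def)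
    with Cons comm show ?case by (simp add: commute_on_def)
  qed simp
  note t = linear_opD[OF eval_op_term[OF Bs]]
  have "D (eval_op H c Bs x) = (\<Oplus>S\<in>Pow {..<length Bs}. D (c S \<odot> foldr (\<lambda>i. Bs ! i) (sorted_list_of_set S) x))"
    unfolding eval_op_def using x by (intro finsum_linear D) (auto simp: t)
  also have "\<dots> = eval_op H c Bs (D x)"
    unfolding eval_op_def
  proof (rule M.finsum_cong')
    fix S assume S: "S \<in> Pow {..<length Bs}"
    then have "finite S" using finite_subset by blast
    with S have "\<forall>i\<in>set (sorted_list_of_set S). i < length Bs" by auto
    then show "D (c S \<odot> foldr (\<lambda>i. Bs ! i) (sorted_list_of_set S) x)
        = c S \<odot> foldr (\<lambda>i. Bs ! i) (sorted_list_of_set S) (D x)"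
      using x S by (simp add: linear_opD[OF D] t fold)
  qed (use x in \<open>auto simp: t linear_opD[OF D]\<close>)
  finally show "D (eval_op H c Bs x) = eval_op H c Bs (D x)" .
qed

lemma eval_op_eigen:
  assumes lin: "\<forall>B\<in>set Bs. linear_op H B" and eig: "joint_eigen H Bs a x"
  shows "eval_op H c Bs x = eval_bool (length Bs) c a \<odot> x"
proof -
  have x: "x \<in> carrier H" using eig by (simp add: joint_eigen_def)
  have fold: "foldr (\<lambda>i. Bs ! i) is x = prod_list (map (\<lambda>i. of_int (a ! i)) is) \<odot> x"
    if "\<forall>i\<in>set is. i < length Bs" for "is"
    using that
  proof (induction "is")
    case (Cons i "is")
    then have "linear_op H (Bs ! i)" using lin by auto
    with Cons eig x show ?case by (simp add: linear_opD(3)[of H "Bs ! i"] joint_eigen_def mult.commute)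
  qed (simp add: x)
  have "eval_op H c Bs x = (\<Oplus>S\<in>Pow {..<length Bs}. (c S * (\<Prod>i\<in>S. of_int (a ! i))) \<odot> x)"
    unfolding eval_op_def
  proof (rule M.finsum_cong')
    fix S assume S: "S \<in> Pow {..<length Bs}"
    then have fin: "finite S" using finite_subset by blast
    with S have "\<forall>i\<in>set (sorted_list_of_set S). i < length Bs" by auto
    moreover have "prod_list (map (\<lambda>i. of_int (a ! i)) (sorted_list_of_set S)) = (\<Prod>i\<in>S. of_int (a ! i) :: complex)"
      using fin by (subst prod.distinct_set_conv_list[symmetric]) auto
    ultimately show "c S \<odot> foldr (\<lambda>i. Bs ! i) (sorted_list_of_set S) x
        = (c S * (\<Prod>i\<in>S. of_int (a ! i))) \<odot> x"
      using x by (simp add: fold)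
  qed (use x in auto)
  also have "\<dots> = eval_bool (length Bs) c a \<odot> x"
    using x by (simp add: finsum_smult eval_bool_def)
  finally show ?thesis .
qed

text \<open>On a joint eigenvector with label \<open>a\<close> the polynomial acts as the scalar -1
  or 1 according to membership of \<open>a\<close>, and joint eigenvectors span. From here on the
  polynomial is replaced by the condition on labels.\<close>

lemma eval_char_poly_iff:
  assumes Bs: "comm_invols H Bs" and len: "length Bs = fst R"
  shows "(\<forall>x\<in>carrier H. eval_op H (char_poly R) Bs x = \<ominus> x) \<longleftrightarrow>
    (\<forall>x a. joint_eigen H Bs a x \<longrightarrow> x \<noteq> \<zero> \<longrightarrow> a \<in> snd R)" (is "?L \<longleftrightarrow> ?R")
proof -
  have lin: "\<forall>B\<in>set Bs. linear_op H B"
    using Bs by (auto simp: comm_invols_def invol_def)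
  have val: "eval_op H (char_poly R) Bs x = (if a \<in> snd R then -1 else 1) \<odot> x"
    if "joint_eigen H Bs a x" for a x
    using eval_op_eigen[OF lin that, of "char_poly R"] is_char_poly_char_poly[of R] that len
    by (simp add: is_char_poly_def joint_eigen_def)
  show ?thesis
  proof
    assume L: ?L
    show ?R
    proof (intro allI impI)
      fix x a assume e: "joint_eigen H Bs a x" and "x \<noteq> \<zero>"
      then have x: "x \<in> carrier H" by (simp add: joint_eigen_def)
      with e L val[OF e] have "(if a \<in> snd R then -1 else 1) \<odot> x = (-1) \<odot> x"
        by (simp add: minus_sm)
      then show "a \<in> snd R"
        using sm_left_cancel[OF x, of 1 "-1"] \<open>x \<noteq> \<zero>\<close> by (auto split: if_splits)
    qed
  next
    assume R: ?R
    show ?L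
    proof
      fix x assume "x \<in> carrier H"
      then show "eval_op H (char_poly R) Bs x = \<ominus> x"
      proof (rule joint_eigen_induct_carrier[OF Bs, rotated 2])
        fix x y assume "x \<in> carrier H" "y \<in> carrier H"
          "eval_op H (char_poly R) Bs x = \<ominus> x" "eval_op H (char_poly R) Bs y = \<ominus> y"
        then show "eval_op H (char_poly R) Bs (x \<oplus> y) = \<ominus> (x \<oplus> y)"
          by (simp add: linear_opD[OF eval_op_linear[OF lin]] M.minus_add)
      next
        fix x a assume e: "joint_eigen H Bs a x"
        then have x: "x \<in> carrier H" by (simp add: joint_eigen_def)
        show "eval_op H (char_poly R) Bs x = \<ominus> x"
        proof (cases "x = \<zero>")
          case True
          then show ?thesis by (simp add: linear_op_zero[OF eval_op_linear[OF lin]] minus_sm)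
        next
          case False
          with R e val[OF e] x show ?thesis by (simp add: minus_sm)
        qed
      qed
    qed
  qed
qed

lemma selfadjoint_eigen_orthogonal:
  assumes "selfadjoint H B" "x \<in> carrier H" "y \<in> carrier H"
    "B x = of_int s \<odot> x" "B y = of_int t \<odot> y" "s \<noteq> t"
  shows "cinner H x y = 0"
proof -
  have "of_int s * cinner H x y = cinner H (B x) y"
    unfolding assms(4) by (rule cinner_smult_left[OF assms(2,3), symmetric])
  also have "\<dots> = cinner H x (B y)"
    using assms(1-3) by (simp only: selfadjoint_def)
  also have "\<dots> = of_int t * cinner H x y"
    unfolding assms(5) using cinner_smult_right[OF assms(2,3)] by simp
  finally have "of_int s * cinner H x y = of_int t * cinner H x y" .
  with assms(6) show ?thesis by simp
qed

end

text \<open>Functional calculus for functions with values 1 and -1: the characteristic polynomial of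
  the set where \<open>g\<close> is -1 interpolates \<open>g\<close> on all tuples. Defining the
  operator as a polynomial makes linearity and commutation immediate.\<close>

definition op_fun :: "('h, 'm) hilbert_scheme \<Rightarrow> (int list \<Rightarrow> int) \<Rightarrow> ('h \<Rightarrow> 'h) list \<Rightarrow> 'h \<Rightarrow> 'h" where
  "op_fun H g Bs = eval_op H (char_poly (length Bs, {a. g a = -1})) Bs"

context hilbert_space
begin

context
  fixes Bs :: "('h \<Rightarrow> 'h) list" and g :: "int list \<Rightarrow> int"
  assumes Bs: "comm_invols H Bs" and g: "\<And>a. a \<in> tuples (length Bs) \<Longrightarrow> g a = 1 \<or> g a = -1"
begin

lemma op_fun_linear: "linear_op H (op_fun H g Bs)"
  unfolding op_fun_def using Bs by (intro eval_op_linear) (auto simp: comm_invols_def invol_def)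

lemma op_fun_eigen:
  assumes "joint_eigen H Bs a x"
  shows "op_fun H g Bs x = of_int (g a) \<odot> x"
proof -
  have lin: "\<forall>B\<in>set Bs. linear_op H B"
    using Bs by (auto simp: comm_invols_def invol_def)
  have a: "a \<in> tuples (length Bs)" using assms by (simp add: joint_eigen_def)
  let ?R = "(length Bs, {a. g a = -1})"
  have "eval_bool (length Bs) (char_poly ?R) a = of_int (g a)"
    using is_char_poly_char_poly[of ?R] a g[OF a] unfolding is_char_poly_def by auto
  then show ?thesis
    using eval_op_eigen[OF lin assms] by (simp add: op_fun_def)
qed

lemma op_fun_commute:
  assumes "linear_op H D" "\<forall>B\<in>set Bs. commute_on H D B"
  shows "commute_on H D (op_fun H g Bs)"
  unfolding op_fun_def using Bs assms
  by (intro eval_op_commute) (auto simp: comm_invols_def invol_def)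

lemma op_fun_invol: "invol H (op_fun H g Bs)"
  unfolding invol_def
proof (intro conjI ballI)
  note lin = linear_opD[OF op_fun_linear]
  show "linear_op H (op_fun H g Bs)" by (rule op_fun_linear)
  show "op_fun H g Bs (op_fun H g Bs x) = x" if "x \<in> carrier H" for x
  proof (rule joint_eigen_induct_carrier[OF Bs _ _ that])
    fix x a assume e: "joint_eigen H Bs a x"
    then have "g a = 1 \<or> g a = -1" "x \<in> carrier H" using g by (auto simp: joint_eigen_def)
    then show "op_fun H g Bs (op_fun H g Bs x) = x"
      using op_fun_eigen[OF e] by (auto simp: lin)
  qed (simp add: lin)
  \<comment> \<open>Both arguments are decomposed into joint eigenvectors. Equal labels give the
    same real factor on either side; different labels give orthogonal vectors, so both sides
    vanish.\<close>
  show "selfadjoint H (op_fun H g Bs)"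
    unfolding selfadjoint_def
  proof (intro ballI)
    fix x y assume x: "x \<in> carrier H" and y: "y \<in> carrier H"
    show "cinner H (op_fun H g Bs x) y = cinner H x (op_fun H g Bs y)"
    proof (rule joint_eigen_induct_carrier[OF Bs _ _ x])
      fix x a assume ex: "joint_eigen H Bs a x"
      then have xc: "x \<in> carrier H" by (simp add: joint_eigen_def)
      show "cinner H (op_fun H g Bs x) y = cinner H x (op_fun H g Bs y)"
      proof (rule joint_eigen_induct_carrier[OF Bs _ _ y])
        fix y b assume ey: "joint_eigen H Bs b y"
        then have yc: "y \<in> carrier H" by (simp add: joint_eigen_def)
        show "cinner H (op_fun H g Bs x) y = cinner H x (op_fun H g Bs y)"
        proof (cases "a = b")
          case True
          then show ?thesis
            using op_fun_eigen[OF ex] op_fun_eigen[OF ey] xc yc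
            by (simp add: cinner_smult_left cinner_smult_right)
        next
          case False
          have "length a = length Bs" "length b = length Bs"
            using ex ey by (auto simp: joint_eigen_def tuples_def)
          with False obtain i where i: "i < length Bs" "a ! i \<noteq> b ! i"
            by (auto simp: list_eq_iff_nth_eq)
          have "selfadjoint H (Bs ! i)" using Bs i by (auto simp: comm_invols_def invol_def)
          then have "cinner H x y = 0"
            using selfadjoint_eigen_orthogonal[OF _ xc yc _ _ i(2)] ex ey i(1)
            by (auto simp: joint_eigen_def)
          then show ?thesis
            using op_fun_eigen[OF ex] op_fun_eigen[OF ey] xc yc
            by (simp add: cinner_smult_left cinner_smult_right)
        qed
      qed (use xc in \<open>simp add: lin cinner_add_right\<close>)
    qed (use y in \<open>simp add: lin cinner_add_left\<close>)
  qed
qed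

end

end

section \<open>Constant-free instances\<close>

type_synonym vconstraint = "nat list \<times> brel"

definition var_instance :: "nat \<Rightarrow> vconstraint list \<Rightarrow> csp_instance" where
  "var_instance n cs = (n, map (\<lambda>(is, R). (map Var is, R)) cs)"

definition wf_constraints :: "brel set \<Rightarrow> nat \<Rightarrow> vconstraint list \<Rightarrow> bool" where
  "wf_constraints A n cs \<longleftrightarrow> (\<forall>(is, R)\<in>set cs. R \<in> A \<and> length is = fst R \<and> set is \<subseteq> {..<n})"

definition bool_model :: "nat \<Rightarrow> vconstraint list \<Rightarrow> (nat \<Rightarrow> int) \<Rightarrow> bool" where
  "bool_model n cs f \<longleftrightarrow> (\<forall>i<n. f i \<in> {1, -1}) \<and> (\<forall>(is, R)\<in>set cs. map f is \<in> snd R)"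

definition op_constraint ::
    "('h, 'm) hilbert_scheme \<Rightarrow> (nat \<Rightarrow> 'h \<Rightarrow> 'h) \<Rightarrow> nat list \<Rightarrow> brel \<Rightarrow> bool" where
  "op_constraint H f is R \<longleftrightarrow> comm_invols H (map f is) \<and>
     (\<forall>x a. joint_eigen H (map f is) a x \<longrightarrow> x \<noteq> \<zero>\<^bsub>H\<^esub> \<longrightarrow> a \<in> snd R)"

definition op_model ::
    "('h, 'm) hilbert_scheme \<Rightarrow> nat \<Rightarrow> vconstraint list \<Rightarrow> (nat \<Rightarrow> 'h \<Rightarrow> 'h) \<Rightarrow> bool" where
  "op_model H n cs f \<longleftrightarrow> (\<forall>i<n. invol H (f i)) \<and> (\<forall>(is, R)\<in>set cs. op_constraint H f is R)"

text \<open>The property \<open>Q\<close> is arbitrary so that one equivalence serves all three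
  kinds of gaps.\<close>

lemma ex_constant_free_iff:
  "(\<exists>I. instance_over A I \<and> constant_free I \<and> Q I) \<longleftrightarrow>
   (\<exists>n cs. wf_constraints A n cs \<and> Q (var_instance n cs))"
proof
  assume "\<exists>I. instance_over A I \<and> constant_free I \<and> Q I"
  then obtain n ds where I: "instance_over A (n, ds)" "constant_free (n, ds)" "Q (n, ds)"
    by auto
  \<comment> \<open>The value at constants is a default; constant-freeness ensures that it is never
    taken.\<close>
  define un where "un t = (case t of Var i \<Rightarrow> i | Const c \<Rightarrow> 0)" for t
  define cs where "cs = map (\<lambda>(Z, R). (map un Z, R)) ds"
  have Z: "map Var (map un Z) = Z" if "(Z, R) \<in> set ds" for Z R
  proof -
    have "Var (un t) = t" if "t \<in> set Z" for t
      using I(2) \<open>(Z, R) \<in> set ds\<close> that by (force simp: constant_free_def un_def)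
    then show ?thesis by (simp add: map_idI)
  qed
  have "map (\<lambda>(is, R). (map Var is, R)) cs = ds"
    unfolding cs_def map_map comp_def using Z by (intro map_idI) (auto simp: comp_def)
  then have inst: "var_instance n cs = (n, ds)"
    by (simp add: var_instance_def)
  have "wf_constraints A n cs"
    unfolding wf_constraints_def
  proof (intro ballI)
    fix c assume "c \<in> set cs"
    then obtain Z R where c: "c = (map un Z, R)" "(Z, R) \<in> set ds"
      by (auto simp: cs_def)
    have "un t < n" if t: "t \<in> set Z" for t
    proof -
      obtain i where "t = Var i" using I(2) c(2) t by (force simp: constant_free_def)
      then show ?thesis using I(1) c(2) t by (force simp: instance_over_def un_def)
    qed
    moreover have "R \<in> A" "length Z = fst R" using I(1) c(2) by (auto simp: instance_over_def)
    ultimately show "case c of (is, R) \<Rightarrow> R \<in> A \<and> length is = fst R \<and> set is \<subseteq> {..<n}"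
      using c by auto
  qed
  with inst I(3) show "\<exists>n cs. wf_constraints A n cs \<and> Q (var_instance n cs)" by metis
next
  assume "\<exists>n cs. wf_constraints A n cs \<and> Q (var_instance n cs)"
  then obtain n cs where wf: "wf_constraints A n cs" and Q: "Q (var_instance n cs)" by blast
  have "instance_over A (var_instance n cs)"
    using wf by (force simp: instance_over_def var_instance_def wf_constraints_def)
  moreover have "constant_free (var_instance n cs)"
    by (auto simp: constant_free_def var_instance_def)
  ultimately show "\<exists>I. instance_over A I \<and> constant_free I \<and> Q I" using Q by blast
qed

lemma bool_satisfiable_var_instance:
  "bool_satisfiable (var_instance n cs) \<longleftrightarrow> (\<exists>f. bool_model n cs f)"
proof -
  have "bool_val f \<circ> Var = f" for f by (simp add: fun_eq_iff)
  then show ?thesis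
    unfolding bool_satisfiable_def var_instance_def bool_model_def
    by (simp add: split_beta)
qed

lemma satisfying_var_instance:
  assumes H: "hilbert_space H" and wf: "wf_constraints A n cs"
  shows "satisfying_operator_assignment H (var_instance n cs) f \<longleftrightarrow> op_model H n cs f"
proof -
  interpret hilbert_space H by (rule H)
  have val: "op_val H f \<circ> Var = f" by (simp add: fun_eq_iff)
  have assign: "operator_assignment H (var_instance n cs) f \<longleftrightarrow>
      (\<forall>i<n. invol H (f i)) \<and> (\<forall>(is, R)\<in>set cs. comm_invols H (map f is))" (is "?L \<longleftrightarrow> ?R")
  proof
    assume L: ?L
    then have inv: "\<forall>i<n. invol H (f i)"
      by (simp add: operator_assignment_def var_instance_def invol_iff)
    have "comm_invols H (map f is)" if c: "(is, R) \<in> set cs" for "is" R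
    proof -
      have "set is \<subseteq> {..<n}" using wf c by (auto simp: wf_constraints_def)
      moreover have "f i (f j x) = f j (f i x)" if "i \<in> set is" "j \<in> set is" "x \<in> carrier H" for i j x
        using L c that by (force simp: operator_assignment_def var_instance_def)
      ultimately show ?thesis using inv by (auto simp: comm_invols_def commute_on_def)
    qed
    with inv show ?R by auto
  next
    assume R: ?R
    then show ?L
      by (force simp: operator_assignment_def var_instance_def invol_iff comm_invols_def commute_on_def)
  qed
  have char: "(\<forall>x\<in>carrier H. eval_op H (char_poly R) (map f is) x = \<ominus>\<^bsub>H\<^esub> x) \<longleftrightarrow>
      (\<forall>x a. joint_eigen H (map f is) a x \<longrightarrow> x \<noteq> \<zero>\<^bsub>H\<^esub> \<longrightarrow> a \<in> snd R)"
    if "(is, R) \<in> set cs" "comm_invols H (map f is)" for "is" R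
    using that wf by (intro eval_char_poly_iff) (auto simp: wf_constraints_def)
  have "(case c of (is, R) \<Rightarrow> comm_invols H (map f is) \<and>
        (\<forall>x\<in>carrier H. eval_op H (char_poly R) (map f is) x = \<ominus>\<^bsub>H\<^esub> x)) \<longleftrightarrow>
      (case c of (is, R) \<Rightarrow> op_constraint H f is R)" if "c \<in> set cs" for c
    using char that by (cases c) (simp add: op_constraint_def cong: conj_cong)
  then have "op_model H n cs f \<longleftrightarrow> (\<forall>i<n. invol H (f i)) \<and> (\<forall>(is, R)\<in>set cs.
      comm_invols H (map f is) \<and>
      (\<forall>x\<in>carrier H. eval_op H (char_poly R) (map f is) x = \<ominus>\<^bsub>H\<^esub> x))"
    unfolding op_model_def by (metis (no_types, lifting))
  then show ?thesis
    unfolding satisfying_operator_assignment_def assign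
    by (auto simp: var_instance_def val split_beta)
qed

definition nonzero_hilbert_space :: "('h, 'm) hilbert_scheme \<Rightarrow> bool" where
  "nonzero_hilbert_space H \<longleftrightarrow> hilbert_space H \<and> carrier H \<noteq> {\<zero>\<^bsub>H\<^esub>}"

lemma gap_first_iff:
  "gap_first TYPE('h) A \<longleftrightarrow> (\<exists>n cs. wf_constraints A n cs \<and> (\<nexists>f. bool_model n cs f) \<and>
     (\<exists>(H :: 'h hilbert) f. nonzero_hilbert_space H \<and> finite_dimensional H \<and> op_model H n cs f))"
  unfolding gap_first_def ex_constant_free_iff bool_satisfiable_var_instance fd_satisfiable_def
    nonzero_hilbert_space_def
  by (metis satisfying_var_instance)

lemma gap_second_iff:
  "gap_second TYPE('h) A \<longleftrightarrow> (\<exists>n cs. wf_constraints A n cs \<and> (\<nexists>f. bool_model n cs f) \<and>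
     (\<exists>(H :: 'h hilbert) f. nonzero_hilbert_space H \<and> op_model H n cs f))"
  unfolding gap_second_def ex_constant_free_iff bool_satisfiable_var_instance op_satisfiable_def
    nonzero_hilbert_space_def
  by (metis satisfying_var_instance)

lemma gap_third_iff:
  "gap_third TYPE('h) A \<longleftrightarrow> (\<exists>n cs. wf_constraints A n cs \<and>
     (\<exists>(H :: 'h hilbert) f. nonzero_hilbert_space H \<and> op_model H n cs f) \<and>
     \<not> (\<exists>(H :: 'h hilbert) f. nonzero_hilbert_space H \<and> finite_dimensional H \<and> op_model H n cs f))"
  unfolding gap_third_def ex_constant_free_iff op_satisfiable_def fd_satisfiable_def
    nonzero_hilbert_space_def
  by (metis satisfying_var_instance)


section \<open>Languages without gaps\<close>

fun lit_val :: "lit \<Rightarrow> int" where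
  "lit_val (Pos i) = -1"
| "lit_val (Neg i) = 1"

lemma lit_true_iff: "lit_true a l \<longleftrightarrow> a ! lit_index l = lit_val l"
  by (cases l) auto

lemma lit_val_cases: "lit_val l = 1 \<or> lit_val l = -1"
  by (cases l) auto

lemma is_Pos_iff: "is_Pos l \<longleftrightarrow> lit_val l = -1" "\<not> is_Pos l \<longleftrightarrow> lit_val l = 1"
  by (cases l; simp)+

lemma is_Pos_eq: "is_Pos = (\<lambda>l. lit_val l = -1)" "(\<lambda>l. \<not> lit_val l = -1) = (\<lambda>l. lit_val l = 1)"
  using is_Pos_iff lit_val_cases by (auto simp: fun_eq_iff)

context hilbert_space
begin

text \<open>\<open>F\<close> prescribes eigenvalues at some positions only. The vectors obeying
  \<open>F\<close> form a subspace invariant under all operators of the scope, so \<open>x\<close>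
  splits into joint eigenvectors that still obey \<open>F\<close> and whose labels, if the vector is
  nonzero, lie in the relation and extend \<open>F\<close>.\<close>

lemma op_constraint_induct:
  assumes con: "op_constraint H f is R"
    and x: "x \<in> carrier H" and F: "\<And>p s. (p, s) \<in> F \<Longrightarrow> p < length is \<and> f (is ! p) x = of_int s \<odot> x"
    and add: "\<And>x y. x \<in> carrier H \<Longrightarrow> y \<in> carrier H \<Longrightarrow> Q x \<Longrightarrow> Q y \<Longrightarrow> Q (x \<oplus> y)"
    and zero: "Q \<zero>"
    and base: "\<And>x a. joint_eigen H (map f is) a x \<Longrightarrow> a \<in> snd R \<Longrightarrow> (\<And>p s. (p, s) \<in> F \<Longrightarrow> a ! p = s) \<Longrightarrow> Q x"
  shows "Q x"
proof -
  define S where "S = {y \<in> carrier H. \<forall>p s. (p, s) \<in> F \<longrightarrow> f (is ! p) y = of_int s \<odot> y}"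
  have comm: "comm_invols H (map f is)" using con by (simp add: op_constraint_def)
  have lin: "linear_op H (f (is ! p))" if "(p, s) \<in> F" for p s
    using comm F[OF that] by (auto simp: comm_invols_def invol_def)
  show ?thesis
  proof (rule joint_eigen_induct[OF comm, of S])
    show "x \<in> S" using x F by (auto simp: S_def)
    show "S \<subseteq> carrier H" by (auto simp: S_def)
    show "y \<oplus> z \<in> S" if "y \<in> S" "z \<in> S" for y z
      using that by (auto simp: S_def linear_opD(2)[OF lin] sm_distr)
    show "a \<odot> y \<in> S" if "y \<in> S" for a y
      using that by (auto simp: S_def linear_opD(3)[OF lin] mult.commute)
    show "B y \<in> S" if B: "B \<in> set (map f is)" and y: "y \<in> S" for B y
    proof -
      have yc: "y \<in> carrier H" using y by (simp add: S_def)
      have B': "linear_op H B" using B comm by (auto simp: comm_invols_def invol_def)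
      have "f (is ! p) (B y) = of_int s \<odot> B y" if p: "(p, s) \<in> F" for p s
      proof -
        have "f (is ! p) (B y) = B (f (is ! p) y)"
          using comm F[OF p] B yc by (auto simp: comm_invols_def commute_on_def)
        also have "\<dots> = of_int s \<odot> B y"
          using y p linear_opD(3)[OF B' yc] by (auto simp: S_def)
        finally show ?thesis .
      qed
      then show ?thesis using linear_opD(1)[OF B' yc] by (auto simp: S_def)
    qed
    show "Q y" if y: "y \<in> S" and e: "joint_eigen H (map f is) a y" for y a
    proof (cases "y = \<zero>")
      case False
      have "a ! p = s" if p: "(p, s) \<in> F" for p s
      proof (rule ccontr)
        assume "a ! p \<noteq> s"
        moreover have "of_int (a ! p) \<odot> y = of_int s \<odot> y"
          using e y p F[OF p] by (auto simp: joint_eigen_def S_def)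
        ultimately show False
          using sm_left_cancel[of y "of_int (a ! p)" "of_int s"] False y by (auto simp: S_def)
      qed
      then show ?thesis using base[OF e] con e False by (auto simp: op_constraint_def)
    qed (simp add: zero)
  qed (use add in \<open>auto simp: S_def\<close>)
qed

lemma op_constraint_refute:
  assumes "op_constraint H f is R" "x \<in> carrier H"
    and "\<And>p s. (p, s) \<in> F \<Longrightarrow> p < length is \<and> f (is ! p) x = of_int s \<odot> x"
    and "\<And>a. a \<in> snd R \<Longrightarrow> \<exists>(p, s)\<in>F. a ! p \<noteq> s"
  shows "x = \<zero>"
  using assms(1-3)
  by (rule op_constraint_induct) (use assms(4) in force)+

text \<open>An implication between values that holds throughout the relation becomes an implication
  between eigenvalue equations for one vector. This is how clauses act on operators.\<close>

lemma op_constraint_entail: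
  assumes con: "op_constraint H f is R" and x: "x \<in> carrier H"
    and F: "\<And>p s. (p, s) \<in> F \<Longrightarrow> p < length is \<and> f (is ! p) x = of_int s \<odot> x"
    and q: "q < length is"
    and ent: "\<And>a. a \<in> snd R \<Longrightarrow> (\<And>p s. (p, s) \<in> F \<Longrightarrow> a ! p = s) \<Longrightarrow> a ! q = t"
  shows "f (is ! q) x = of_int t \<odot> x"
proof -
  have lin: "linear_op H (f (is ! q))"
    using con q by (auto simp: op_constraint_def comm_invols_def invol_def)
  show ?thesis using con x F
  proof (rule op_constraint_induct)
    show "f (is ! q) \<zero> = of_int t \<odot> \<zero>" by (simp add: linear_op_zero[OF lin])
    show "f (is ! q) y = of_int t \<odot> y"
      if "joint_eigen H (map f is) a y" "a \<in> snd R" "\<And>p s. (p, s) \<in> F \<Longrightarrow> a ! p = s" for y a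
      using ent[OF that(2,3)] that(1) q by (auto simp: joint_eigen_def)
  qed (auto simp: linear_opD(2)[OF lin] sm_distr)
qed

text \<open>Both Horn cases at once: \<open>t\<close> is the value that at most one literal per
  clause may demand. Variables whose operator is the scalar \<open>t\<close> on the whole space
  receive \<open>t\<close>, all others \<open>- t\<close>. The set \<open>D\<close> of the former is
  already closed under propagation, so no iteration is involved.\<close>

lemma horn_bool_model:
  assumes nontriv: "carrier H \<noteq> {\<zero>}" and wf: "wf_constraints A n cs" and mod: "op_model H n cs f"
    and t: "t \<in> {1, -1}"
    and horn: "\<forall>R\<in>A. cnf_definable (\<lambda>C. length (filter (\<lambda>l. lit_val l = t) C) \<le> 1) R"
  shows "\<exists>g. bool_model n cs g"
proof -
  define D where "D = {i. \<forall>v\<in>carrier H. f i v = of_int t \<odot> v}"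
  define g where "g i = (if i \<in> D then t else - t)" for i
  have g: "g i \<in> {1, -1}" for i using t by (auto simp: g_def)
  have "map g is \<in> snd R" if c: "(is, R) \<in> set cs" for "is" R
  proof -
    have R: "R \<in> A" "length is = fst R" using wf c by (auto simp: wf_constraints_def)
    have con: "op_constraint H f is R" using mod c by (auto simp: op_model_def)
    obtain F where F: "\<And>C. C \<in> set F \<Longrightarrow> length (filter (\<lambda>l. lit_val l = t) C) \<le> 1"
        "\<And>C l. C \<in> set F \<Longrightarrow> l \<in> set C \<Longrightarrow> lit_index l < fst R"
        "snd R = cnf_models (fst R) F"
      using horn R(1) unfolding cnf_definable_def by blast
    have "\<exists>l\<in>set C. lit_true (map g is) l" if C: "C \<in> set F" for C
    proof (rule ccontr)
      assume no: "\<not> (\<exists>l\<in>set C. lit_true (map g is) l)"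
      have idx: "lit_index l < length is" if "l \<in> set C" for l using F(2)[OF C that] R(2) by simp
      have val: "g (is ! lit_index l) \<noteq> lit_val l" if "l \<in> set C" for l
        using no that idx[OF that] by (auto simp: lit_true_iff)
      have models: "\<exists>l\<in>set C. a ! lit_index l = lit_val l" if "a \<in> snd R" for a
        using that C unfolding F(3) cnf_models_def lit_true_iff by auto
      \<comment> \<open>The premises of the clause, read as an implication towards its literal of
        value \<open>t\<close>: each other literal is false, so its variable has the scalar operator
        \<open>t\<close>.\<close>
      define G where "G = {(lit_index l, t) |l. l \<in> set C \<and> lit_val l = - t}"
      have G: "p < length is \<and> f (is ! p) x = of_int s \<odot> x"
        if ps: "(p, s) \<in> G" and x: "x \<in> carrier H" for p s x
      proof -
        obtain l where l: "p = lit_index l" "s = t" "l \<in> set C" "lit_val l = - t"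
          using ps by (auto simp: G_def)
        have "is ! p \<in> D" using val[OF l(3)] l by (auto simp: g_def split: if_splits)
        then show ?thesis using l idx x by (auto simp: D_def)
      qed
      have cases: "lit_val l = t \<or> lit_val l = - t" for l
        using lit_val_cases[of l] t by auto
      show False
      proof (cases "filter (\<lambda>l. lit_val l = t) C")
        case Nil
        then have allneg: "lit_val l = - t" if "l \<in> set C" for l
          using cases[of l] that by (auto simp: filter_empty_conv)
        obtain x where x: "x \<in> carrier H" "x \<noteq> \<zero>" using nontriv M.zero_closed by auto
        have "x = \<zero>"
        proof (rule op_constraint_refute[OF con x(1), of G])
          show "\<exists>(p, s)\<in>G. a ! p \<noteq> s" if a: "a \<in> snd R" for a
          proof -
            obtain l where "l \<in> set C" "a ! lit_index l = lit_val l" using models[OF a] by auto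
            moreover have "t \<noteq> - t" using t by auto
            ultimately show ?thesis using allneg by (force simp: G_def)
          qed
        qed (use G x in auto)
        then show False using x by simp
      next
        case (Cons l0 ls)
        then have ls: "filter (\<lambda>l. lit_val l = t) C = [l0]"
          using F(1)[OF C] by simp
        have "l0 \<in> set (filter (\<lambda>l. lit_val l = t) C)"
          unfolding ls by simp
        then have l0: "l0 \<in> set C" "lit_val l0 = t" by simp_all
        have uniq: "l = l0" if "l \<in> set C" "lit_val l = t" for l
        proof -
          have "l \<in> set (filter (\<lambda>l. lit_val l = t) C)" using that by simp
          then show ?thesis unfolding ls by simp
        qed
        have "is ! lit_index l0 \<in> D"
          unfolding D_def
        proof (intro CollectI ballI)
          fix x assume x: "x \<in> carrier H"
          show "f (is ! lit_index l0) x = of_int t \<odot> x"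
          proof (rule op_constraint_entail[OF con x, of G])
            show "a ! lit_index l0 = t"
              if a: "a \<in> snd R" and aG: "\<And>p s. (p, s) \<in> G \<Longrightarrow> a ! p = s" for a
            proof -
              obtain l where l: "l \<in> set C" "a ! lit_index l = lit_val l" using models[OF a] by auto
              have "lit_val l \<noteq> - t"
              proof
                assume "lit_val l = - t"
                with l have "a ! lit_index l = t" using aG[of "lit_index l" t] by (auto simp: G_def)
                then show False using l \<open>lit_val l = - t\<close> t by auto
              qed
              then show ?thesis using uniq[OF l(1)] cases[of l] l l0 by auto
            qed
          qed (use G x idx[OF l0(1)] in auto)
        qed
        then show False using val[OF l0(1)] l0(2) by (simp add: g_def)
      qed
    qed
    moreover have "map g is \<in> tuples (fst R)"
      using g R(2) by (auto simp: tuples_def)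
    ultimately show ?thesis by (simp add: F(3) cnf_models_def)
  qed
  with g show ?thesis unfolding bool_model_def by (intro exI[of _ g]) auto
qed

text \<open>The implication graph of 2-SAT, with inclusion of eigenspaces as implication. A maximal
  consistent set of literals closed under implication is total and gives the assignment.\<close>

lemma bijunctive_bool_model:
  assumes nontriv: "carrier H \<noteq> {\<zero>}" and wf: "wf_constraints A n cs" and mod: "op_model H n cs f"
    and bij: "\<forall>R\<in>A. cnf_definable (\<lambda>C. length C \<le> 2) R"
  shows "\<exists>g. bool_model n cs g"
proof -
  define L where "L = {..<n} \<times> {1, -1::int}"
  define imp where "imp p q \<longleftrightarrow> (\<forall>v\<in>carrier H. f (fst p) v = of_int (snd p) \<odot> v \<longrightarrow>
      f (fst q) v = of_int (snd q) \<odot> v)" for p q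
  define neg where "neg p = (fst p, - snd p)" for p :: "nat \<times> int"
  have neg_L: "neg p \<in> L" if "p \<in> L" for p using that by (auto simp: L_def neg_def)
  have neg_neg: "neg (neg p) = p" for p by (simp add: neg_def)
  have inv: "invol H (f i)" if "i < n" for i using mod that by (simp add: op_model_def)
  have imp_refl: "imp p p" for p by (simp add: imp_def)
  have imp_trans: "imp p r" if "imp p q" "imp q r" for p q r using that by (auto simp: imp_def)
  \<comment> \<open>Write \<open>v\<close> as the sum of its part \<open>u\<close> satisfying
    \<open>p\<close> and the rest \<open>w\<close>. Then \<open>u\<close> satisfies
    \<open>q\<close>, so it is orthogonal to \<open>v\<close>, which satisfies the negation of
    \<open>q\<close>. As \<open>u\<close> is also orthogonal to \<open>w\<close>, its norm is 0 and
    \<open>v\<close> equals \<open>w\<close>.\<close>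
  have contra: "imp (neg q) (neg p)" if pq: "imp p q" and p: "p \<in> L" and q: "q \<in> L" for p q
    unfolding imp_def
  proof (intro ballI impI)
    fix v assume v: "v \<in> carrier H" and nq: "f (fst (neg q)) v = of_int (snd (neg q)) \<odot> v"
    have B: "invol H (f (fst p))" and C: "invol H (f (fst q))" using inv p q by (auto simp: L_def)
    obtain y z where yz: "y \<in> carrier H" "z \<in> carrier H" "v = y \<oplus> z" "f (fst p) y = y"
        "f (fst p) z = (-1) \<odot> z"
      using eigen_split[OF B v] by metis
    have s: "snd p = 1 \<or> snd p = -1" using p by (auto simp: L_def)
    obtain u w where uw: "u \<in> carrier H" "w \<in> carrier H" "v = u \<oplus> w"
        "f (fst p) u = of_int (snd p) \<odot> u" "f (fst p) w = of_int (- snd p) \<odot> w"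
    proof (cases "snd p = 1")
      case True
      then show thesis using that[of y z] yz by simp
    next
      case False
      then show thesis using that[of z y] yz s by (simp add: M.a_comm)
    qed
    have "f (fst q) u = of_int (snd q) \<odot> u" using pq uw by (auto simp: imp_def)
    moreover have "snd q \<noteq> - snd q" using q by (auto simp: L_def)
    ultimately have "cinner H u v = 0"
      using selfadjoint_eigen_orthogonal[OF involD(2)[OF C] uw(1) v, of "snd q" "- snd q"] nq
      by (simp add: neg_def)
    moreover have "cinner H u w = 0"
      using selfadjoint_eigen_orthogonal[OF involD(2)[OF B] uw(1,2), of "snd p" "- snd p"] uw s by auto
    ultimately have "cinner H u u = 0"
      using uw by (simp add: cinner_add_right)
    then have "u = \<zero>" using cinner_pos[OF uw(1)] by auto
    then show "f (fst (neg p)) v = of_int (snd (neg p)) \<odot> v"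
      using uw by (simp add: neg_def)
  qed
  \<comment> \<open>If both literals of a variable implied their negations, both eigenspaces would
    be zero and so would the whole space.\<close>
  have not_both: "\<exists>s\<in>{1, -1}. \<not> imp (i, s) (i, - s)" if i: "i < n" for i
  proof (rule ccontr)
    assume "\<not> ?thesis"
    then have a: "imp (i, 1) (i, -1)" "imp (i, -1) (i, 1)" by auto
    obtain v where v: "v \<in> carrier H" "v \<noteq> \<zero>" using nontriv M.zero_closed by auto
    obtain y z where yz: "y \<in> carrier H" "z \<in> carrier H" "v = y \<oplus> z" "f i y = y" "f i z = (-1) \<odot> z"
      using eigen_split[OF inv[OF i] v(1)] by metis
    have "1 \<odot> y = (-1) \<odot> y" using a(1) yz(1,4) by (auto simp: imp_def)
    then have "y = \<zero>" using sm_left_cancel[OF yz(1), of 1 "-1"] by simp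
    have "1 \<odot> z = (-1) \<odot> z" using a(2) yz(2,5) by (auto simp: imp_def)
    then have "z = \<zero>" using sm_left_cancel[OF yz(2), of 1 "-1"] by simp
    with \<open>y = \<zero>\<close> yz v show False by simp
  qed
  define good where "good S \<longleftrightarrow> S \<subseteq> L \<and> (\<forall>p\<in>S. \<forall>q\<in>L. imp p q \<longrightarrow> q \<in> S) \<and> (\<forall>p\<in>S. neg p \<notin> S)" for S
  have fin: "finite L" by (simp add: L_def)
  have "finite {S. good S}"
    by (rule finite_subset[of _ "Pow L"]) (auto simp: good_def fin)
  moreover have "{} \<in> {S. good S}" by (simp add: good_def)
  ultimately obtain S where S: "good S" and max: "\<And>T. good T \<Longrightarrow> S \<subseteq> T \<Longrightarrow> T = S"
    using finite_has_maximal[of "{S. good S}"] by (metis empty_iff mem_Collect_eq)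
  have total: "\<exists>s\<in>{1, -1}. (i, s) \<in> S" if i: "i < n" for i
  proof (rule ccontr)
    assume none: "\<not> ?thesis"
    obtain s where s: "s \<in> {1, -1}" "\<not> imp (i, s) (i, - s)" using not_both[OF i] by blast
    have iL: "(i, s) \<in> L" using i s by (auto simp: L_def)
    \<comment> \<open>All consequences of a literal that does not imply its own negation. A clash
      between two elements would, by contraposition, either put \<open>neg (i, s)\<close> into
      \<open>S\<close> or make \<open>(i, s)\<close> imply its negation.\<close>
    define T where "T = S \<union> {q \<in> L. imp (i, s) q}"
    have "good T"
      unfolding good_def
    proof (intro conjI ballI impI)
      show "T \<subseteq> L" using S by (auto simp: T_def good_def)
      show "q \<in> T" if "p \<in> T" "q \<in> L" "imp p q" for p q
        using that S imp_trans[of "(i, s)" p q] unfolding T_def good_def by blast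
      show "neg p \<notin> T" if p: "p \<in> T" for p
      proof
        assume np: "neg p \<in> T"
        have *: False if q: "q \<in> S" "imp (i, s) (neg q)" for q
        proof -
          have "imp q (neg (i, s))"
            using contra[OF q(2) iL neg_L] q(1) S neg_neg[of q] unfolding good_def by (metis subsetD)
          then have "neg (i, s) \<in> S" using q(1) S neg_L[OF iL] by (auto simp: good_def)
          then show False using none s by (auto simp: neg_def)
        qed
        have **: False if "imp (i, s) p" "imp (i, s) (neg p)"
        proof -
          have "imp p (neg (i, s))"
            using contra[OF that(2) iL neg_L] p \<open>T \<subseteq> L\<close> neg_neg[of p] by (metis subsetD)
          then show False using imp_trans[OF that(1)] s by (auto simp: neg_def)
        qed
        show False
          using p np * ** S neg_neg[of p] unfolding T_def good_def by (metis (no_types, lifting) Un_iff mem_Collect_eq)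
      qed
    qed
    then have "T = S" using max by (auto simp: T_def)
    moreover have "(i, s) \<in> T" using iL imp_refl by (auto simp: T_def)
    ultimately show False using none s by auto
  qed
  define g where "g i = (if (i, 1) \<in> S then 1 else -1 :: int)" for i
  have g: "g i \<in> {1, -1}" for i by (simp add: g_def)
  have gS: "(i, g i) \<in> S" if "i < n" for i using total[OF that] by (auto simp: g_def)
  have gN: "(i, s) \<notin> S" if "s = - g i" "i < n" for i s
  proof -
    have "neg (i, g i) \<notin> S" using gS[OF that(2)] S by (auto simp: good_def)
    then show ?thesis using that by (simp add: neg_def)
  qed
  have "map g is \<in> snd R" if c: "(is, R) \<in> set cs" for "is" R
  proof -
    have R: "R \<in> A" "length is = fst R" and isn: "set is \<subseteq> {..<n}"
      using wf c by (auto simp: wf_constraints_def)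
    have con: "op_constraint H f is R" using mod c by (auto simp: op_model_def)
    obtain F where F: "\<And>C. C \<in> set F \<Longrightarrow> length C \<le> 2"
        "\<And>C l. C \<in> set F \<Longrightarrow> l \<in> set C \<Longrightarrow> lit_index l < fst R"
        "snd R = cnf_models (fst R) F"
      using bij R(1) unfolding cnf_definable_def by blast
    have "\<exists>l\<in>set C. lit_true (map g is) l" if C: "C \<in> set F" for C
    proof (rule ccontr)
      assume no: "\<not> (\<exists>l\<in>set C. lit_true (map g is) l)"
      have idx: "lit_index l < length is" if "l \<in> set C" for l using F(2)[OF C that] R(2) by simp
      have isl: "is ! lit_index l < n" if "l \<in> set C" for l using idx[OF that] isn by (meson lessThan_iff nth_mem subsetD)
      have val: "- lit_val l = g (is ! lit_index l)" if "l \<in> set C" for l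
        using no that idx[OF that] lit_val_cases[of l] g[of "is ! lit_index l"] by (auto simp: lit_true_iff)
      have models: "\<exists>l\<in>set C. a ! lit_index l = lit_val l" if "a \<in> snd R" for a
        using that C unfolding F(3) cnf_models_def lit_true_iff by auto
      \<comment> \<open>Repeating a literal covers clauses of length one. The falsified clause
        implies its second literal from the negation of the first, which lies in
        \<open>S\<close>.\<close>
      have two: False if l: "l1 \<in> set C" "l2 \<in> set C" "set C \<subseteq> {l1, l2}" for l1 l2
      proof -
        have "imp (is ! lit_index l1, - lit_val l1) (is ! lit_index l2, lit_val l2)"
          unfolding imp_def fst_conv snd_conv
        proof (intro ballI impI)
          fix v assume v: "v \<in> carrier H" "f (is ! lit_index l1) v = of_int (- lit_val l1) \<odot> v"
          show "f (is ! lit_index l2) v = of_int (lit_val l2) \<odot> v"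
          proof (rule op_constraint_entail[OF con v(1), of "{(lit_index l1, - lit_val l1)}"])
            show "a ! lit_index l2 = lit_val l2"
              if a: "a \<in> snd R" and "\<And>p s. (p, s) \<in> {(lit_index l1, - lit_val l1)} \<Longrightarrow> a ! p = s" for a
            proof -
              have "a ! lit_index l1 = - lit_val l1" using that by simp
              then show ?thesis using models[OF a] l lit_val_cases[of l1] by auto
            qed
          qed (use v idx l in auto)
        qed
        moreover have "(is ! lit_index l1, - lit_val l1) \<in> S" using val[OF l(1)] gS[OF isl[OF l(1)]] by simp
        moreover have "(is ! lit_index l2, lit_val l2) \<in> L"
          using isl[OF l(2)] lit_val_cases[of l2] by (auto simp: L_def)
        ultimately have "(is ! lit_index l2, lit_val l2) \<in> S" using S unfolding good_def by blast
        then show False using gN[of "lit_val l2" "is ! lit_index l2"] val[OF l(2)] isl[OF l(2)] by simp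
      qed
      show False
      proof (cases C)
        case Nil
        obtain v where v: "v \<in> carrier H" "v \<noteq> \<zero>" using nontriv M.zero_closed by auto
        have "v = \<zero>"
          by (rule op_constraint_refute[OF con v(1), of "{}"]) (use models Nil in auto)
        with v show False by simp
      next
        case (Cons l1 D)
        show False
        proof (cases D)
          case Nil
          then show False using two[of l1 l1] Cons by simp
        next
          case D: (Cons l2 E)
          then have "C = [l1, l2]" using F(1)[OF C] Cons by simp
          then show False using two[of l1 l2] by simp
        qed
      qed
    qed
    moreover have "map g is \<in> tuples (fst R)"
      using g R(2) by (auto simp: tuples_def)
    ultimately show ?thesis by (simp add: F(3) cnf_models_def)
  qed
  with g show ?thesis unfolding bool_model_def by (intro exI[of _ g]) auto
qed

end

lemma tractable_bool_model:
  assumes "nonzero_hilbert_space H" "wf_constraints A n cs" "op_model H n cs f"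
    and "zero_valid A \<or> one_valid A \<or> bijunctive A \<or> horn A \<or> dual_horn A"
  shows "\<exists>g. bool_model n cs g"
proof -
  interpret hilbert_space H using assms(1) by (simp add: nonzero_hilbert_space_def)
  have nz: "carrier H \<noteq> {\<zero>\<^bsub>H\<^esub>}" using assms(1) by (simp add: nonzero_hilbert_space_def)
  have const: "bool_model n cs (\<lambda>_. s)"
    if "s \<in> {1, -1}" "\<forall>R\<in>A. replicate (fst R) s \<in> snd R" for s
    using assms(2) that by (auto simp: bool_model_def wf_constraints_def map_replicate_const split_beta)
  consider "zero_valid A" | "one_valid A" | "bijunctive A" | "horn A" | "dual_horn A"
    using assms(4) by blast
  then show ?thesis
  proof cases
    case 1 then show ?thesis using const[of 1] by (auto simp: zero_valid_def)
  next
    case 2 then show ?thesis using const[of "-1"] by (auto simp: one_valid_def)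
  next
    case 3 then show ?thesis using bijunctive_bool_model[OF nz assms(2,3)] by (simp add: bijunctive_def)
  next
    case 4 then show ?thesis
      using horn_bool_model[OF nz assms(2,3), of "-1"] by (simp add: horn_def is_Pos_eq)
  next
    case 5 then show ?thesis
      using horn_bool_model[OF nz assms(2,3), of 1] by (simp add: dual_horn_def is_Pos_eq)
  qed
qed

section \<open>An obstruction in finite dimension\<close>

text \<open>Gaussian elimination by induction on the equations. It supplies the linear dependence
  between powers of an operator directly in coordinates.\<close>

lemma homogeneous_system_solution:
  fixes C :: "'j \<Rightarrow> 'm \<Rightarrow> complex"
  assumes "finite M" "finite J" "card M < card J"
  shows "\<exists>c. (\<exists>j\<in>J. c j \<noteq> 0) \<and> (\<forall>m\<in>M. (\<Sum>j\<in>J. c j * C j m) = 0)"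
  using assms
proof (induction M arbitrary: J C rule: finite_induct)
  case empty
  then have "J \<noteq> {}" by auto
  then show ?case by (intro exI[of _ "\<lambda>_. 1"]) auto
next
  case (insert m M)
  show ?case
  proof (cases "\<forall>j\<in>J. C j m = 0")
    case True
    then show ?thesis using insert.IH[of J C] insert by auto
  next
    case False
    then obtain k where k: "k \<in> J" "C k m \<noteq> 0" by auto
    have "finite (J - {k})" "card M < card (J - {k})"
      using insert k by auto
    \<comment> \<open>The coefficients left after unknown \<open>k\<close> has been eliminated by
      means of equation \<open>m\<close>; the value at \<open>k\<close> is restored in
      \<open>c\<close> below.\<close>
    from insert.IH[OF this, of "\<lambda>j n. C j n - C j m / C k m * C k n"]
    obtain d where d: "\<exists>j\<in>J - {k}. d j \<noteq> 0"
      "\<forall>n\<in>M. (\<Sum>j\<in>J - {k}. d j * (C j n - C j m / C k m * C k n)) = 0" by auto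
    define c where "c = d(k := - (\<Sum>j\<in>J - {k}. d j * C j m) / C k m)"
    have c: "(\<Sum>j\<in>J. c j * C j n) = c k * C k n + (\<Sum>j\<in>J - {k}. d j * C j n)" for n
      using insert.prems k by (subst sum.remove[of J k]) (auto simp: c_def intro!: sum.cong)
    have "(\<Sum>j\<in>J. c j * C j n) = 0" if "n \<in> M" for n
    proof -
      have "(\<Sum>j\<in>J - {k}. d j * C j n) - (\<Sum>j\<in>J - {k}. d j * C j m) / C k m * C k n = 0"
        using d(2) that by (simp add: right_diff_distrib sum_subtractf sum_divide_distrib sum_distrib_right mult.assoc)
      then show ?thesis unfolding c by (simp add: c_def)
    qed
    moreover have "(\<Sum>j\<in>J. c j * C j m) = 0" unfolding c using k by (simp add: c_def)
    moreover have "\<exists>j\<in>J. c j \<noteq> 0" using d(1) by (auto simp: c_def)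
    ultimately show ?thesis by (intro exI[of _ c]) auto
  qed
qed

text \<open>The polynomial with these coefficients, constant term first, at \<open>Y\<close>. The
  recursion applies \<open>Y\<close> to the argument, which makes splitting off even and odd powers
  a simple induction. Zero coefficients at the end are allowed, so a nonzero polynomial is one with
  some nonzero coefficient.\<close>

fun opoly :: "('h, 'm) hilbert_scheme \<Rightarrow> ('h \<Rightarrow> 'h) \<Rightarrow> complex list \<Rightarrow> 'h \<Rightarrow> 'h" where
  "opoly H Y [] v = \<zero>\<^bsub>H\<^esub>"
| "opoly H Y (c # cs) v = c \<odot>\<^bsub>H\<^esub> v \<oplus>\<^bsub>H\<^esub> opoly H Y cs (Y v)"

text \<open>The lists E and D with p(X) = E(X^2) + X D(X^2).\<close>

fun evens :: "'a list \<Rightarrow> 'a list" and odds :: "'a list \<Rightarrow> 'a list" where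
  "evens [] = []"
| "evens (x # xs) = x # odds xs"
| "odds [] = []"
| "odds (x # xs) = evens xs"

lemma set_evens_odds: "set xs = set (evens xs) \<union> set (odds xs)"
  by (induction xs) auto

lemma length_evens_odds: "length (evens xs) + length (odds xs) = length xs"
  by (induction xs) auto

lemma length_odds_le: "length (odds xs) \<le> length (evens xs)" "length (evens xs) \<le> Suc (length (odds xs))"
  by (induction xs) auto

context hilbert_space
begin

lemma opoly_linear: "linear_op H Y \<Longrightarrow> linear_op H (opoly H Y cs)"
proof (induction cs)
  case Nil
  then show ?case by (simp add: linear_op_def)
next
  case (Cons c cs)
  note Y = linear_opD[OF Cons.prems] and P = linear_opD[OF Cons.IH[OF Cons.prems]]
  show ?case
    unfolding linear_op_def
  proof (intro conjI ballI allI)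
    show "opoly H Y (c # cs) x \<in> carrier H" if "x \<in> carrier H" for x
      using that by (simp add: Y P)
    show "opoly H Y (c # cs) (x \<oplus> y) = opoly H Y (c # cs) x \<oplus> opoly H Y (c # cs) y"
      if "x \<in> carrier H" "y \<in> carrier H" for x y
      using that by (simp add: Y P sm_distr M.a_ac)
    show "opoly H Y (c # cs) (a \<odot> x) = a \<odot> opoly H Y (c # cs) x" if "x \<in> carrier H" for a x
      using that by (simp add: Y P sm_distr mult.commute)
  qed
qed

text \<open>More powers of \<open>Y\<close> are taken than a matrix has entries, so they are
  linearly dependent. The coordinates \<open>co\<close> are merely chosen, as \<open>B\<close> is a
  spanning set and perhaps no basis; vanishing combinations of chosen coordinates suffice.\<close>

lemma finite_dimensional_annihilator:
  assumes fd: "finite_dimensional H" and Y: "linear_op H Y"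
  obtains cs where "\<exists>c\<in>set cs. c \<noteq> 0" "\<And>v. v \<in> carrier H \<Longrightarrow> opoly H Y cs v = \<zero>"
proof -
  obtain B where B: "finite B" "B \<subseteq> carrier H"
      "\<forall>x\<in>carrier H. \<exists>c. x = (\<Oplus>b\<in>B. c b \<odot> b)"
    using fd by (auto simp: finite_dimensional_def)
  obtain co where co: "\<And>x. x \<in> carrier H \<Longrightarrow> x = (\<Oplus>b\<in>B. co x b \<odot> b)"
    using B(3) by metis
  define L where "L \<kappa> = (\<Oplus>b\<in>B. \<kappa> b \<odot> b)" for \<kappa> :: "'h \<Rightarrow> complex"
  have bc: "b \<in> carrier H" if "b \<in> B" for b using B(2) that by auto
  have L_add: "L (\<lambda>b. \<kappa> b + \<mu> b) = L \<kappa> \<oplus> L \<mu>" for \<kappa> \<mu>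
  proof -
    have "L (\<lambda>b. \<kappa> b + \<mu> b) = (\<Oplus>b\<in>B. \<kappa> b \<odot> b \<oplus> \<mu> b \<odot> b)"
      unfolding L_def by (intro M.finsum_cong') (auto simp: bc sm_add)
    also have "\<dots> = L \<kappa> \<oplus> L \<mu>"
      unfolding L_def by (intro M.finsum_addf) (auto simp: bc)
    finally show ?thesis .
  qed
  have L_smult: "L (\<lambda>b. a * \<kappa> b) = a \<odot> L \<kappa>" for a \<kappa>
  proof -
    have lin: "linear_op H (\<lambda>x. a \<odot> x)"
      by (simp add: linear_op_def sm_distr mult.commute)
    have "a \<odot> L \<kappa> = (\<Oplus>b\<in>B. a \<odot> (\<kappa> b \<odot> b))"
      unfolding L_def using finsum_linear[OF lin B(1)] bc by auto
    also have "\<dots> = L (\<lambda>b. a * \<kappa> b)"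
      unfolding L_def by (intro M.finsum_cong') (auto simp: bc)
    finally show ?thesis by simp
  qed
  have L_zero: "L (\<lambda>b. 0) = \<zero>"
  proof -
    have "L (\<lambda>b. 0) = (\<Oplus>b\<in>B. \<zero>)"
      unfolding L_def by (intro M.finsum_cong') (auto simp: bc)
    then show ?thesis by simp
  qed
  define pw where "pw j b = (Y ^^ j) b" for j b
  have pw: "pw j b \<in> carrier H" if "b \<in> B" for j b
    using bc[OF that] by (induction j) (auto simp: pw_def linear_opD[OF Y])
  \<comment> \<open>The equation \<open>m\<close> is a pair of a basis vector to which the power is
    applied and a basis vector at which the coordinate is read.\<close>
  define C where "C j m = co (pw j (fst m)) (snd m)" for j m
  define N where "N = Suc (card (B \<times> B))"
  obtain c where c: "\<exists>j\<in>{..<N}. c j \<noteq> 0" "\<forall>m\<in>B \<times> B. (\<Sum>j<N. c j * C j m) = 0"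
    using homogeneous_system_solution[of "B \<times> B" "{..<N}" C] B(1) by (auto simp: N_def)
  have step: "opoly H Y (map c [k..<N]) (pw k b) = L (\<lambda>b'. \<Sum>j=k..<N. c j * C j (b, b'))"
    if "k \<le> N" and b: "b \<in> B" for k b
    using that(1)
  proof (induction k rule: inc_induct)
    case base
    then show ?case by (simp add: L_zero)
  next
    case (step k)
    have "opoly H Y (map c [k..<N]) (pw k b)
        = c k \<odot> pw k b \<oplus> opoly H Y (map c [Suc k..<N]) (pw (Suc k) b)"
      using step.hyps by (simp add: upt_conv_Cons pw_def)
    also have "\<dots> = c k \<odot> L (\<lambda>b'. C k (b, b')) \<oplus> L (\<lambda>b'. \<Sum>j=Suc k..<N. c j * C j (b, b'))"
      using step.IH co[OF pw[OF b, of k]] by (simp add: L_def C_def)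
    also have "\<dots> = L (\<lambda>b'. c k * C k (b, b') + (\<Sum>j=Suc k..<N. c j * C j (b, b')))"
      by (simp add: L_add L_smult)
    also have "\<dots> = L (\<lambda>b'. \<Sum>j=k..<N. c j * C j (b, b'))"
      using step.hyps by (simp add: sum.atLeast_Suc_lessThan)
    finally show ?case .
  qed
  define cs where "cs = map c [0..<N]"
  have zero: "opoly H Y cs b = \<zero>" if b: "b \<in> B" for b
  proof -
    have "opoly H Y cs b = L (\<lambda>b'. \<Sum>j=0..<N. c j * C j (b, b'))"
      using step[OF _ b, of 0] by (simp add: cs_def pw_def)
    also have "\<dots> = L (\<lambda>b. 0)"
      unfolding L_def using c(2) b by (intro M.finsum_cong') (auto simp: bc atLeast0LessThan)
    finally show ?thesis by (simp add: L_zero)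
  qed
  note lin = opoly_linear[OF Y, of cs]
  have "opoly H Y cs v = \<zero>" if v: "v \<in> carrier H" for v
  proof -
    have "opoly H Y cs v = opoly H Y cs (\<Oplus>b\<in>B. co v b \<odot> b)" using co[OF v] by simp
    also have "\<dots> = (\<Oplus>b\<in>B. opoly H Y cs (co v b \<odot> b))"
      using finsum_linear[OF lin B(1)] bc by auto
    also have "\<dots> = (\<Oplus>b\<in>B. \<zero>)"
      by (intro M.finsum_cong') (auto simp: linear_opD[OF lin] bc zero)
    finally show ?thesis by simp
  qed
  moreover have "\<exists>c\<in>set cs. c \<noteq> 0" using c(1) by (auto simp: cs_def)
  ultimately show thesis using that by blast
qed

lemma opoly_even_odd:
  assumes Y: "linear_op H Y" and Z: "linear_op H Z" "\<And>x. Z x = Y (Y x)" and v: "v \<in> carrier H"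
  shows "opoly H Y cs v = opoly H Z (evens cs) v \<oplus> opoly H Z (odds cs) (Y v)"
  using v
proof (induction cs arbitrary: v)
  case (Cons c cs)
  note lin = linear_opD(1)[OF opoly_linear[OF Z(1)]] and Yc = linear_opD(1)[OF Y]
  show ?case
    using Cons.IH[OF Yc[OF Cons.prems]] Cons.prems by (simp add: Yc lin Z(2)[of v] M.a_ac)
qed simp

text \<open>The relation is required on an invariant set \<open>K\<close> only, because the
  conjugation of \<open>Y\<close> to its negative is available on one eigenspace of \<open>J\<close>
  only.\<close>

lemma opoly_intertwine:
  assumes Y: "linear_op H Y" and Z: "linear_op H Z" and c: "linear_op H c"
    and K: "K \<subseteq> carrier H" "\<And>v. v \<in> K \<Longrightarrow> Y v \<in> K"
    and comm: "\<And>v. v \<in> K \<Longrightarrow> c (Y v) = Z (c v)" and v: "v \<in> K"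
  shows "c (opoly H Y ds v) = opoly H Z ds (c v)"
  using v
proof (induction ds arbitrary: v)
  case Nil
  then show ?case by (simp add: linear_op_zero[OF c])
next
  case (Cons d ds)
  have "v \<in> carrier H" "Y v \<in> carrier H" using Cons.prems K by auto
  then show ?case
    using Cons.IH[OF K(2)[OF Cons.prems]] comm[OF Cons.prems]
    by (simp add: linear_opD[OF c] linear_opD(1)[OF opoly_linear[OF Y]])
qed

text \<open>If \<open>p(Y) = 0\<close> then the conjugacy of \<open>Y\<close> and \<open>-Y\<close> shows that the even and the odd
  part of \<open>p\<close> vanish at \<open>Y\<close> separately. Both are, up to a factor \<open>Y\<close>, polynomials in
  \<open>Y\<^sup>2\<close> of half the degree, and they annihilate \<open>Y\<close> because \<open>Y\<close> is conjugate to
  \<open>Y\<^sup>2\<close>.\<close>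

lemma no_annihilator:
  assumes Y: "linear_op H Y" and b: "linear_op H b" and c: "linear_op H c"
    and K: "K \<subseteq> carrier H" "w \<in> K" "w \<noteq> \<zero>"
    and YK: "\<And>v. v \<in> K \<Longrightarrow> Y v \<in> K" "\<And>v. v \<in> K \<Longrightarrow> \<exists>u\<in>K. Y u = v"
    and bK: "\<And>v. v \<in> K \<Longrightarrow> b v \<in> K" "\<And>v. v \<in> carrier H \<Longrightarrow> b (b v) = v"
    and cK: "\<And>v. v \<in> K \<Longrightarrow> c v \<in> K" "\<And>v. v \<in> carrier H \<Longrightarrow> c v = \<zero> \<Longrightarrow> v = \<zero>"
    and anti: "\<And>v. v \<in> K \<Longrightarrow> b (Y v) = (-1) \<odot> Y (b v)"
    and sq: "\<And>v. v \<in> K \<Longrightarrow> c (Y v) = Y (Y (c v))"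
    and ann: "\<And>v. v \<in> K \<Longrightarrow> opoly H Y cs v = \<zero>"
  shows "\<forall>d\<in>set cs. d = 0"
  using ann
proof (induction "length cs" arbitrary: cs rule: less_induct)
  case less
  define Z where "Z x = Y (Y x)" for x
  have YY: "linear_op H Z" using Y by (simp add: linear_op_def Z_def)
  have Kc: "v \<in> carrier H" if "v \<in> K" for v using K that by auto
  note lin = opoly_linear[OF YY]
  define E where "E = opoly H Z (evens cs)"
  define D where "D = opoly H Z (odds cs)"
  have E: "linear_op H E" and D: "linear_op H D" using lin by (simp_all add: E_def D_def)
  have bYY: "b (Z v) = Z (b v)" if v: "v \<in> K" for v
    using anti[OF YK(1)[OF v]] anti[OF v] Kc[OF YK(1)[OF v]] Kc[OF bK(1)[OF v]]
    by (simp add: linear_opD[OF Y] Z_def)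
  have YYK: "Z v \<in> K" if "v \<in> K" for v using that YK by (simp add: Z_def)
  have part: "E v = \<zero> \<and> D (Y v) = \<zero>" if v: "v \<in> K" for v
  proof -
    note bv = bK(1)[OF v]
    have c1: "E v \<in> carrier H" "D (Y v) \<in> carrier H" "b (E v) \<in> carrier H" "b (D (Y v)) \<in> carrier H"
      using linear_opD(1)[OF E Kc[OF v]] linear_opD(1)[OF D Kc[OF YK(1)[OF v]]]
      by (simp_all add: linear_opD(1)[OF b])
    have sum: "E v \<oplus> D (Y v) = \<zero>"
      using opoly_even_odd[OF Y YY Z_def Kc[OF v], of cs] less.prems[OF v] by (simp add: E_def D_def)
    have "E (b v) \<oplus> D (Y (b v)) = \<zero>"
      using opoly_even_odd[OF Y YY Z_def Kc[OF bv], of cs] less.prems[OF bv] by (simp add: E_def D_def)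
    moreover have "E (b v) = b (E v)"
      unfolding E_def by (rule opoly_intertwine[OF YY YY b K(1) YYK bYY v, symmetric])
    moreover have "D (Y (b v)) = (-1) \<odot> b (D (Y v))"
    proof -
      have "Y (b v) = (-1) \<odot> b (Y v)" using anti[OF v] Kc[OF YK(1)[OF bv]] by simp
      then have "D (Y (b v)) = (-1) \<odot> D (b (Y v))"
        using linear_opD(3)[OF D Kc[OF bK(1)[OF YK(1)[OF v]]]] by simp
      also have "D (b (Y v)) = b (D (Y v))"
        unfolding D_def by (rule opoly_intertwine[OF YY YY b K(1) YYK bYY YK(1)[OF v], symmetric])
      finally show ?thesis .
    qed
    \<comment> \<open>Conjugation by \<open>b\<close> fixes the even part and changes the sign of
      the odd part. So the sum and the difference of both parts vanish, hence both parts do.\<close>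
    ultimately have "b (E v \<oplus> (-1) \<odot> D (Y v)) = \<zero>"
      using c1 by (simp add: linear_opD[OF b])
    then have "b (b (E v \<oplus> (-1) \<odot> D (Y v))) = \<zero>"
      by (simp add: linear_op_zero[OF b])
    then have diff: "E v \<oplus> (-1) \<odot> D (Y v) = \<zero>"
      using bK(2)[of "E v \<oplus> (-1) \<odot> D (Y v)"] c1 by simp
    have "2 \<odot> E v = (1 + 1) \<odot> E v" by simp
    also have "\<dots> = E v \<oplus> E v \<oplus> (D (Y v) \<oplus> (-1) \<odot> D (Y v))"
      using c1 sm_add[OF c1(1), of 1 1] sm_add[OF c1(2), of 1 "-1"] by simp
    also have "\<dots> = (E v \<oplus> D (Y v)) \<oplus> (E v \<oplus> (-1) \<odot> D (Y v))"
      using c1 by (simp add: M.a_ac)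
    finally have "2 \<odot> E v = \<zero>" using sum diff by simp
    then have "E v = \<zero>" using sm_cancel[OF c1(1), of 2] by simp
    with sum c1 show ?thesis by simp
  qed
  \<comment> \<open>If a polynomial kills \<open>K\<close> at the square of \<open>Y\<close>, it
    kills \<open>K\<close> at \<open>Y\<close>, because \<open>c\<close> intertwines the two
    operators and is injective.\<close>
  have transfer: "opoly H Y ds v = \<zero>" if ds: "\<And>v. v \<in> K \<Longrightarrow> opoly H Z ds v = \<zero>" and v: "v \<in> K" for ds v
  proof -
    have "c (opoly H Y ds v) = opoly H Z ds (c v)"
      using sq by (intro opoly_intertwine[OF Y YY c K(1) YK(1) _ v]) (auto simp: Z_def)
    also have "\<dots> = \<zero>" by (rule ds[OF cK(1)[OF v]])
    finally show ?thesis using cK(2) linear_opD(1)[OF opoly_linear[OF Y] Kc[OF v]] by blast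
  qed
  have ev: "opoly H Y (evens cs) v = \<zero>" if "v \<in> K" for v
    using transfer[of "evens cs" v] part that by (simp add: E_def)
  \<comment> \<open>The odd part is known to vanish only at vectors of the form \<open>Y u\<close>;
    surjectivity of \<open>Y\<close> on \<open>K\<close> covers all of \<open>K\<close>.\<close>
  have od: "opoly H Y (odds cs) v = \<zero>" if "v \<in> K" for v
  proof (rule transfer[OF _ that])
    fix v assume "v \<in> K"
    then obtain u where "u \<in> K" "Y u = v" using YK(2) by blast
    then show "opoly H Z (odds cs) v = \<zero>" using part[of u] by (simp add: D_def)
  qed
  show ?case
  proof (cases "length cs \<ge> 2")
    case True
    then have "length (evens cs) < length cs" "length (odds cs) < length cs"
      using length_evens_odds[of cs] length_odds_le[of cs] by linarith+
    then show ?thesis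
      using less.hyps[OF _ ev] less.hyps[OF _ od] set_evens_odds[of cs] by auto
  next
    case False
    show ?thesis
    proof (cases cs)
      case (Cons d ds)
      then have "ds = []" using False by (cases ds) auto
      then have "d \<odot> w = \<zero>" using less.prems[OF K(2)] Cons Kc[OF K(2)] by simp
      then have "d = 0" using sm_cancel[OF Kc[OF K(2)]] K(3) by blast
      then show ?thesis using Cons \<open>ds = []\<close> by simp
    qed simp
  qed
qed

text \<open>On the subspace \<open>K = {v. J v = -v}\<close> the operator \<open>Y = t\<^sub>0s\<^sub>0\<close> is conjugate to \<open>-Y\<close>
  by \<open>b\<close> and to \<open>Y\<^sup>2\<close> by \<open>WU\<close>.\<close>

lemma finite_dimensional_obstruction:
  assumes fd: "finite_dimensional H" and nz: "carrier H \<noteq> {\<zero>}"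
    and inv: "invol H s0" "invol H s1" "invol H t0" "invol H t1" "invol H u1" "invol H W" "invol H V"
      "invol H U" "invol H b" "invol H J"
    and V: "\<And>x. x \<in> carrier H \<Longrightarrow> V x = W (t0 (t1 x))"
    and comm: "commute_on H V W" "commute_on H t0 t1" "commute_on H t1 s0" "commute_on H J s0"
      "commute_on H J t0" "commute_on H J b" "commute_on H b s0"
    and conj: "\<And>x. x \<in> carrier H \<Longrightarrow> W (s0 (W x)) = s1 x"
      "\<And>x. x \<in> carrier H \<Longrightarrow> V (s0 (V x)) = u1 x"
      "\<And>x. x \<in> carrier H \<Longrightarrow> U (s0 (U x)) = s1 x"
      "\<And>x. x \<in> carrier H \<Longrightarrow> U (t0 (U x)) = u1 x"
      "\<And>x. x \<in> carrier H \<Longrightarrow> b (t0 (b x)) = J (t0 x)"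
      "\<And>x. x \<in> carrier H \<Longrightarrow> W (J (W x)) = (-1) \<odot> J x"
      "\<And>x. x \<in> carrier H \<Longrightarrow> U (J (U x)) = (-1) \<odot> J x"
  shows False
proof -
  note lin = inv[THEN involD(1)]
  note cl = lin[THEN linear_opD(1)] and sq = inv[THEN involD(3)]
  define Y where "Y = t0 \<circ> s0"
  define c where "c = W \<circ> U"
  define K where "K = {v \<in> carrier H. J v = (-1) \<odot> v}"
  have Y: "linear_op H Y" and c: "linear_op H c"
    using lin by (simp_all add: Y_def c_def linear_op_def)
  \<comment> \<open>Both \<open>W\<close> and \<open>U\<close> exchange the eigenspaces of
    \<open>J\<close>, so their product \<open>c\<close> maps \<open>K\<close> into itself.\<close>
  have anti: "J (Z x) = (-1) \<odot> Z (J x)"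
    if "Z \<in> {W, U}" "x \<in> carrier H" for Z x
  proof -
    have Z: "linear_op H Z" "\<And>x. x \<in> carrier H \<Longrightarrow> Z (Z x) = x" "Z (J (Z x)) = (-1) \<odot> J x"
      using that lin sq conj(6,7) by auto
    note Zc = linear_opD(1)[OF Z(1)]
    have "J (Z x) = Z (Z (J (Z x)))" using Z(2) Zc cl(10) that(2) by simp
    also have "\<dots> = (-1) \<odot> Z (J x)"
      unfolding Z(3) using linear_opD(3)[OF Z(1)] cl(10) that(2) by simp
    finally show ?thesis .
  qed
  \<comment> \<open>If \<open>K\<close> were zero, \<open>J\<close> would be the identity,
    contradicting that conjugation by \<open>W\<close> negates it.\<close>
  obtain w where w: "w \<in> K" "w \<noteq> \<zero>"
  proof -
    obtain x where x: "x \<in> carrier H" "x \<noteq> \<zero>" using nz M.zero_closed by auto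
    have "\<exists>w. w \<in> K \<and> w \<noteq> \<zero>"
    proof (rule ccontr)
      assume none: "\<not> ?thesis"
      have J: "J y = y" if y: "y \<in> carrier H" for y
      proof -
        obtain p q where "p \<in> carrier H" "q \<in> carrier H" "y = p \<oplus> q" "J p = p" "J q = (-1) \<odot> q"
          using eigen_split[OF inv(10) y] by metis
        moreover from this have "q = \<zero>" using none by (auto simp: K_def)
        ultimately show ?thesis by simp
      qed
      have "1 \<odot> x = (-1) \<odot> x"
        using conj(6)[OF x(1)] x J cl(6)[OF x(1)] sq(6)[OF x(1)] by simp
      then show False using sm_left_cancel[OF x(1), of 1 "-1"] x by simp
    qed
    then show thesis using that by blast
  qed
  have JY: "J (Y v) = Y (J v)" if "v \<in> carrier H" for v
    using that comm(4,5) cl by (simp add: Y_def commute_on_def)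
  \<comment> \<open>\<open>U\<close> conjugates t0 s0 to u1 s1; then \<open>W\<close> conjugates s1
    to s0 and u1 to t0 s0 t0. Together this gives t0 s0 t0 s0, the square of \<open>Y\<close>. The
    image of u1 follows from V s0 V = u1 and V = t0 t1 W.\<close>
  have sqc: "c (Y v) = Y (Y (c v))" if v: "v \<in> carrier H" for v
  proof -
    have Xv: "U v \<in> carrier H" using v cl by simp
    have Xt: "U (t0 x) = u1 (U x)" if "x \<in> carrier H" for x
      using conj(4)[of "U x"] that cl sq by simp
    have Xs: "U (s0 x) = s1 (U x)" if "x \<in> carrier H" for x
      using conj(3)[of "U x"] that cl sq by simp
    have Ws: "W (s1 x) = s0 (W x)" if "x \<in> carrier H" for x
      using conj(1)[of x, symmetric] that cl sq by simp
    have VW: "V x = t0 (t1 (W x))" if x: "x \<in> carrier H" for x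
    proof -
      have "V x = W (V (W x))" using comm(1) x cl sq by (simp add: commute_on_def)
      also have "\<dots> = t0 (t1 (W x))" using V[of "W x"] x cl sq by simp
      finally show ?thesis .
    qed
    have Wu: "W (u1 x) = t0 (s0 (t0 (W x)))" if x: "x \<in> carrier H" for x
    proof -
      have c: "s0 (V x) \<in> carrier H" using x cl by simp
      have "W (u1 x) = W (V (s0 (V x)))" using conj(2)[OF x] by simp
      also have "\<dots> = t0 (t1 (s0 (V x)))"
        unfolding V[OF c] using c cl sq by simp
      also have "\<dots> = t0 (t1 (s0 (t0 (t1 (W x)))))"
        unfolding VW[OF x] ..
      also have "\<dots> = t0 (s0 (t1 (t0 (t1 (W x)))))"
        using x cl comm(3) by (simp add: commute_on_def)
      also have "\<dots> = t0 (s0 (t1 (t1 (t0 (W x)))))"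
        using x cl comm(2) by (simp add: commute_on_def)
      finally show ?thesis using x cl sq by simp
    qed
    have "c (Y v) = W (u1 (s1 (U v)))"
      using v cl by (simp add: c_def Y_def Xt Xs)
    also have "\<dots> = Y (Y (c v))"
      using v cl by (simp add: c_def Y_def Wu Ws)
    finally show ?thesis .
  qed
  obtain cs where cs: "\<exists>d\<in>set cs. d \<noteq> 0" "\<And>v. v \<in> carrier H \<Longrightarrow> opoly H Y cs v = \<zero>"
    using finite_dimensional_annihilator[OF fd Y] by blast
  have "\<forall>d\<in>set cs. d = 0"
  proof (rule no_annihilator[OF Y lin(9) c, of K w])
    show "K \<subseteq> carrier H" by (auto simp: K_def)
    show "Y v \<in> K" if "v \<in> K" for v
      using that linear_opD[OF Y] JY by (simp add: K_def)
    show "\<exists>u\<in>K. Y u = v" if v: "v \<in> K" for v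
    proof
      have vc: "v \<in> carrier H" "J v = (-1) \<odot> v" using v by (auto simp: K_def)
      have "J (s0 (t0 v)) = s0 (t0 (J v))" using vc(1) comm(4,5) cl by (simp add: commute_on_def)
      also have "\<dots> = (-1) \<odot> s0 (t0 v)"
        unfolding vc(2) using vc(1) cl linear_opD(3)[OF lin(1)] linear_opD(3)[OF lin(3)] by simp
      finally show "s0 (t0 v) \<in> K" using vc cl by (simp add: K_def)
      show "Y (s0 (t0 v)) = v" using vc cl sq by (simp add: Y_def)
    qed
    show "b v \<in> K" if v: "v \<in> K" for v
    proof -
      have vc: "v \<in> carrier H" "J v = (-1) \<odot> v" using v by (auto simp: K_def)
      have "J (b v) = b (J v)" using vc(1) comm(6) by (simp add: commute_on_def)
      then show ?thesis using vc cl linear_opD(3)[OF lin(9)] by (simp add: K_def)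
    qed
    show "c v \<in> K" if v: "v \<in> K" for v
    proof -
      have vc: "v \<in> carrier H" "J v = (-1) \<odot> v" using v by (auto simp: K_def)
      have Xv: "U v \<in> carrier H" using vc cl by simp
      have "J (U v) = U v"
        using anti[of U v] vc linear_opD(3)[OF lin(8) vc(1)] Xv by simp
      then have "J (W (U v)) = (-1) \<odot> W (U v)" using anti[of W "U v"] Xv by simp
      then show ?thesis using Xv cl by (simp add: K_def c_def)
    qed
    show "v = \<zero>" if "v \<in> carrier H" "c v = \<zero>" for v
    proof -
      have "U (W (c v)) = v" using that(1) cl sq by (simp add: c_def)
      then show ?thesis using that(2) linear_op_zero[OF lin(6)] linear_op_zero[OF lin(8)] by simp
    qed
    show "b (Y v) = (-1) \<odot> Y (b v)" if v: "v \<in> K" for v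
    proof -
      have vc: "v \<in> carrier H" "J v = (-1) \<odot> v" using v by (auto simp: K_def)
      have bs: "s0 (b v) \<in> carrier H" using vc cl by simp
      have "b (Y v) = b (t0 (b (s0 (b v))))"
        using vc cl sq comm(7) by (simp add: Y_def commute_on_def)
      also have "\<dots> = J (Y (b v))" using conj(5)[OF bs] by (simp add: Y_def)
      also have "\<dots> = Y (b (J v))" using JY[of "b v"] comm(6) vc(1) cl by (simp add: commute_on_def)
      also have "\<dots> = (-1) \<odot> Y (b v)"
        unfolding vc(2) using vc(1) cl linear_opD(3)[OF lin(9)] linear_opD(3)[OF Y] by simp
      finally show ?thesis .
    qed
  qed (use w cs(2) sqc sq in \<open>auto simp: K_def\<close>)
  with cs(1) show False by blast
qed

end

section \<open>Polymorphisms of Boolean languages\<close>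

definition preserves3 :: "(int \<Rightarrow> int \<Rightarrow> int \<Rightarrow> int) \<Rightarrow> brel \<Rightarrow> bool" where
  "preserves3 g R \<longleftrightarrow> (\<forall>x\<in>snd R. \<forall>y\<in>snd R. \<forall>z\<in>snd R.
     map (\<lambda>i. g (x ! i) (y ! i) (z ! i)) [0..<fst R] \<in> snd R)"

text \<open>Conjunction for \<open>t = -1\<close> and disjunction for \<open>t = 1\<close>, as \<open>-1\<close> encodes truth.\<close>

definition meet_at :: "int \<Rightarrow> int \<Rightarrow> int \<Rightarrow> int" where
  "meet_at t x y = (if x = t \<and> y = t then t else - t)"

definition majority3 :: "int \<Rightarrow> int \<Rightarrow> int \<Rightarrow> int" where
  "majority3 x y z = (if x = y then x else z)"

definition lit_of :: "int \<Rightarrow> nat \<Rightarrow> lit" where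
  "lit_of v i = (if v = -1 then Pos i else Neg i)"

lemma lit_of [simp]: "lit_index (lit_of v i) = i" "v \<in> {1, -1} \<Longrightarrow> lit_val (lit_of v i) = v"
  by (auto simp: lit_of_def)

text \<open>One clause for each tuple outside the relation: false there and true on the relation.
  Finitely many tuples make the conjunction a formula.\<close>

lemma cnf_definable_by_separation:
  assumes R: "bool_relation R"
    and sep: "\<And>a. a \<in> tuples (fst R) \<Longrightarrow> a \<notin> snd R \<Longrightarrow>
      \<exists>C. P C \<and> (\<forall>l\<in>set C. lit_index l < fst R) \<and>
        (\<forall>b\<in>snd R. \<exists>l\<in>set C. b ! lit_index l = lit_val l) \<and> (\<forall>l\<in>set C. a ! lit_index l \<noteq> lit_val l)"
  shows "cnf_definable P R"
proof -
  obtain C where C: "\<And>a. a \<in> tuples (fst R) - snd R \<Longrightarrow> P (C a) \<and> (\<forall>l\<in>set (C a). lit_index l < fst R) \<and>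
        (\<forall>b\<in>snd R. \<exists>l\<in>set (C a). b ! lit_index l = lit_val l) \<and>
        (\<forall>l\<in>set (C a). a ! lit_index l \<noteq> lit_val l)"
    using sep by (metis DiffE)
  obtain as where as: "set as = tuples (fst R) - snd R"
    using finite_list[of "tuples (fst R) - snd R"] finite_tuples by auto
  show ?thesis
    unfolding cnf_definable_def
  proof (intro exI[of _ "map C as"] conjI)
    show "\<forall>c\<in>set (map C as). P c \<and> (\<forall>l\<in>set c. lit_index l < fst R)"
      using C as by auto
    show "snd R = cnf_models (fst R) (map C as)"
      using C as R unfolding cnf_models_def lit_true_iff bool_relation_def by force
  qed
qed

text \<open>Let \<open>B\<close> be the members that take the value \<open>t\<close> wherever
  \<open>a\<close> does. The literals \<open>ns\<close> hold on all other members. If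
  \<open>B\<close> is nonempty, closure gives it a least element \<open>b\<close>, which differs
  from \<open>a\<close> at some \<open>i\<close>; then all of \<open>B\<close> has \<open>t\<close>
  at \<open>i\<close>, and one literal of value \<open>t\<close> completes the clause.\<close>

lemma meet_closed_cnf_definable:
  assumes R: "bool_relation R" and t: "t \<in> {1, -1}"
    and closed: "preserves3 (\<lambda>x y z. meet_at t x y) R"
  shows "cnf_definable (\<lambda>C. length (filter (\<lambda>l. lit_val l = t) C) \<le> 1) R"
proof (rule cnf_definable_by_separation[OF R])
  fix a assume a: "a \<in> tuples (fst R)" "a \<notin> snd R"
  define r where "r = fst R"
  define ns where "ns = map (lit_of (- t)) (filter (\<lambda>i. a ! i = t) [0..<r])"
  have nt: "- t \<in> {1, -1}" "- t \<noteq> t" using t by auto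
  have ns: "\<forall>l\<in>set ns. lit_index l < r \<and> lit_val l = - t \<and> a ! lit_index l = t"
    using nt by (auto simp: ns_def)
  have fns: "filter (\<lambda>l. lit_val l = t) ns = []"
    using ns nt by (auto simp: filter_empty_conv)
  define B where "B = {b \<in> snd R. \<forall>i<r. a ! i = t \<longrightarrow> b ! i = t}"
  have hit: "\<exists>l\<in>set ns. b ! lit_index l = lit_val l" if b: "b \<in> snd R" "b \<notin> B" for b
  proof -
    obtain i where i: "i < r" "a ! i = t" "b ! i \<noteq> t" using b by (auto simp: B_def)
    have "b ! i = - t" using tuples_nth[of b r i] b(1) i R t by (auto simp: bool_relation_def r_def)
    moreover have "lit_of (- t) i \<in> set ns" using i by (auto simp: ns_def)
    ultimately show ?thesis using nt by (metis lit_of)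
  qed
  show "\<exists>C. length (filter (\<lambda>l. lit_val l = t) C) \<le> 1 \<and> (\<forall>l\<in>set C. lit_index l < fst R) \<and>
        (\<forall>b\<in>snd R. \<exists>l\<in>set C. b ! lit_index l = lit_val l) \<and> (\<forall>l\<in>set C. a ! lit_index l \<noteq> lit_val l)"
  proof (cases "B = {}")
    case True
    show ?thesis
      by (rule exI[of _ ns]) (use True hit ns fns nt in \<open>auto simp: r_def\<close>)
  next
    case False
    define wt where "wt b = card {i. i < r \<and> b ! i = t}" for b :: "int list"
    obtain b where b: "b \<in> B" and min: "\<And>c. c \<in> B \<Longrightarrow> wt b \<le> wt c"
      using False arg_min_nat_lemma[of "\<lambda>c. c \<in> B" _ wt] by (metis ex_in_conv)
    have bt: "b \<in> tuples r" using b R by (auto simp: B_def bool_relation_def r_def)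
    have "b \<noteq> a" using b a(2) by (auto simp: B_def)
    then obtain i where i: "i < r" "b ! i \<noteq> a ! i"
      using a(1) bt by (auto simp: tuples_def r_def list_eq_iff_nth_eq)
    have ait: "a ! i \<noteq> t" using b i by (auto simp: B_def)
    have bit: "b ! i = t" using tuples_nth[OF bt i(1)] tuples_nth[of a r i] a i ait t by (auto simp: r_def)
    \<comment> \<open>Otherwise the meet of \<open>b\<close> and \<open>c\<close> would be a member
      of \<open>B\<close> with fewer entries \<open>t\<close> than the minimal
      \<open>b\<close>.\<close>
    have all: "c ! i = t" if c: "c \<in> B" for c
    proof (rule ccontr)
      assume ci: "c ! i \<noteq> t"
      define m where "m = map (\<lambda>i. meet_at t (b ! i) (c ! i)) [0..<r]"
      have "m \<in> snd R" using closed b c by (auto simp: preserves3_def B_def m_def r_def)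
      then have "m \<in> B" using b c by (auto simp: B_def m_def meet_at_def)
      moreover have "wt m < wt b"
      proof -
        have mt: "m ! j = t \<longleftrightarrow> b ! j = t \<and> c ! j = t" if "j < r" for j
          using that nt(2) by (simp add: m_def meet_at_def)
        have "{i. i < r \<and> m ! i = t} \<noteq> {i. i < r \<and> b ! i = t}"
          using mt i(1) bit ci by blast
        moreover have "{i. i < r \<and> m ! i = t} \<subseteq> {i. i < r \<and> b ! i = t}"
          using mt by auto
        ultimately show ?thesis
          unfolding wt_def by (intro psubset_card_mono) auto
      qed
      ultimately show False using min by fastforce
    qed
    show ?thesis
    proof (intro exI[of _ "lit_of t i # ns"] conjI ballI)
      show "length (filter (\<lambda>l. lit_val l = t) (lit_of t i # ns)) \<le> 1" using fns by simp
      show "lit_index l < fst R" if "l \<in> set (lit_of t i # ns)" for l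
        using that ns i(1) by (auto simp: r_def)
      show "\<exists>l\<in>set (lit_of t i # ns). c ! lit_index l = lit_val l" if "c \<in> snd R" for c
        using hit[OF that] all[of c] t by (cases "c \<in> B") auto
      show "a ! lit_index l \<noteq> lit_val l" if "l \<in> set (lit_of t i # ns)" for l
        using that ns ait nt t by auto
    qed
  qed
qed

text \<open>The Baker-Pixley argument: a relation closed under majority is determined by its
  projections to pairs of coordinates.\<close>

lemma majority_closed_cnf_definable:
  assumes R: "bool_relation R" and closed: "preserves3 majority3 R"
  shows "cnf_definable (\<lambda>C. length C \<le> 2) R"
proof (rule cnf_definable_by_separation[OF R])
  fix a assume a: "a \<in> tuples (fst R)" "a \<notin> snd R"
  define r where "r = fst R"
  have len: "length b = r" if "b \<in> snd R" for b
    using that R by (auto simp: bool_relation_def tuples_def r_def)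
  show "\<exists>C. length C \<le> 2 \<and> (\<forall>l\<in>set C. lit_index l < fst R) \<and>
        (\<forall>b\<in>snd R. \<exists>l\<in>set C. b ! lit_index l = lit_val l) \<and> (\<forall>l\<in>set C. a ! lit_index l \<noteq> lit_val l)"
  proof (cases "snd R = {}")
    case True
    then show ?thesis by (intro exI[of _ "[]"]) simp
  next
    case False
    have "\<exists>i<r. \<exists>j<r. \<forall>b\<in>snd R. b ! i \<noteq> a ! i \<or> b ! j \<noteq> a ! j"
    proof (rule ccontr)
      assume no: "\<not> ?thesis"
      \<comment> \<open>Agreement with \<open>a\<close> on pairs extends to all index sets: given
        three distinct indices, take members that agree off each one of them. At every index at
        least two of the three are right, so their majority agrees on all of
        \<open>I\<close>.\<close>
      have "\<exists>b\<in>snd R. \<forall>i\<in>I. b ! i = a ! i" if "I \<subseteq> {..<r}" for I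
        using that
      proof (induction "card I" arbitrary: I rule: less_induct)
        case less
        have fin: "finite I" using less.prems finite_subset by blast
        show ?case
        proof (cases "\<exists>p q s. p \<in> I \<and> q \<in> I \<and> s \<in> I \<and> p \<noteq> q \<and> q \<noteq> s \<and> p \<noteq> s")
          case True
          then obtain p q s where pqs: "p \<in> I" "q \<in> I" "s \<in> I" "p \<noteq> q" "q \<noteq> s" "p \<noteq> s" by blast
          have "\<exists>b\<in>snd R. \<forall>i\<in>I - {v}. b ! i = a ! i" if "v \<in> I" for v
            using less.hyps[of "I - {v}"] less.prems fin that card_Diff1_less[of I v] by auto
          then obtain b1 b2 b3 where b: "b1 \<in> snd R" "b2 \<in> snd R" "b3 \<in> snd R"
            "\<forall>i\<in>I - {p}. b1 ! i = a ! i" "\<forall>i\<in>I - {q}. b2 ! i = a ! i" "\<forall>i\<in>I - {s}. b3 ! i = a ! i"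
            using pqs by meson
          define m where "m = map (\<lambda>i. majority3 (b1 ! i) (b2 ! i) (b3 ! i)) [0..<r]"
          have "m \<in> snd R" using closed b by (auto simp: preserves3_def m_def r_def)
          moreover have "m ! i = a ! i" if i: "i \<in> I" for i
          proof -
            have ir: "i < r" using i less.prems by auto
            have "(b ! i = 1 \<or> b ! i = -1)" if "b \<in> snd R" for b
              using tuples_nth[of b r i] that R ir by (auto simp: bool_relation_def r_def)
            moreover have "a ! i = 1 \<or> a ! i = -1" using tuples_nth[of a r i] a ir by (simp add: r_def)
            ultimately have "b1 ! i \<in> {1,-1}" "b2 ! i \<in> {1,-1}" "b3 ! i \<in> {1,-1}" "a ! i \<in> {1,-1}"
              using b by auto
            moreover have "i \<noteq> p \<longrightarrow> b1 ! i = a ! i" "i \<noteq> q \<longrightarrow> b2 ! i = a ! i" "i \<noteq> s \<longrightarrow> b3 ! i = a ! i"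
              using b i by auto
            ultimately have "majority3 (b1 ! i) (b2 ! i) (b3 ! i) = a ! i"
              using pqs unfolding majority3_def by metis
            then show ?thesis using ir by (simp add: m_def)
          qed
          ultimately show ?thesis by blast
        next
          case False
          show ?thesis
          proof (cases "I = {}")
            case True
            then show ?thesis using \<open>snd R \<noteq> {}\<close> by auto
          next
            case ne: False
            then obtain i where i: "i \<in> I" by auto
            obtain j where j: "j \<in> I" "I \<subseteq> {i, j}" using False i by (metis insertI1 insertI2 subsetI)
            then obtain b where "b \<in> snd R" "b ! i = a ! i" "b ! j = a ! j"
              using no i less.prems by (meson lessThan_iff subsetD)
            then show ?thesis using j by blast
          qed
        qed
      qed
      from this[of "{..<r}"] obtain b where "b \<in> snd R" "\<forall>i<r. b ! i = a ! i" by auto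
      then have "b = a" using a len by (auto simp: tuples_def r_def intro: nth_equalityI)
      with \<open>b \<in> snd R\<close> a show False by simp
    qed
    then obtain i j where ij: "i < r" "j < r" "\<forall>b\<in>snd R. b ! i \<noteq> a ! i \<or> b ! j \<noteq> a ! j" by blast
    have v: "- (a ! k) \<in> {1, -1}" "a ! k \<noteq> - (a ! k)" if "k < r" for k
      using tuples_nth[of a r k] a that by (auto simp: r_def)
    have flip: "b ! k = - (a ! k)" if "b \<in> snd R" "k < r" "b ! k \<noteq> a ! k" for b k
      using tuples_nth[of a r k] tuples_nth[of b r k] a that R by (auto simp: r_def bool_relation_def)
    show ?thesis
      by (rule exI[of _ "[lit_of (- (a ! i)) i, lit_of (- (a ! j)) j]"])
        (use ij v flip in \<open>auto simp: r_def\<close>)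
  qed
qed

section \<open>Polymorphisms of hard languages are affine\<close>

definition pol3 :: "brel set \<Rightarrow> (int \<Rightarrow> int \<Rightarrow> int \<Rightarrow> int) \<Rightarrow> bool" where
  "pol3 A g \<longleftrightarrow> (\<forall>R\<in>A. preserves3 g R)"

definition hard_language :: "brel set \<Rightarrow> bool" where
  "hard_language A \<longleftrightarrow> (\<forall>R\<in>A. bool_relation R) \<and> (\<forall>R\<in>A. snd R \<noteq> {}) \<and>
     \<not> (zero_valid A \<or> one_valid A \<or> bijunctive A \<or> horn A \<or> dual_horn A)"

lemma pol3_comp:
  assumes "pol3 A g" "pol3 A h1" "pol3 A h2" "pol3 A h3"
  shows "pol3 A (\<lambda>x y z. g (h1 x y z) (h2 x y z) (h3 x y z))"
  unfolding pol3_def preserves3_def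
proof (intro ballI)
  fix R x y z assume R: "R \<in> A" and xyz: "x \<in> snd R" "y \<in> snd R" "z \<in> snd R"
  let ?m = "\<lambda>h. map (\<lambda>i. h (x ! i) (y ! i) (z ! i)) [0..<fst R]"
  have "?m h1 \<in> snd R" "?m h2 \<in> snd R" "?m h3 \<in> snd R"
    using assms(2-4) R xyz by (auto simp: pol3_def preserves3_def)
  then have "map (\<lambda>i. g (?m h1 ! i) (?m h2 ! i) (?m h3 ! i)) [0..<fst R] \<in> snd R"
    using assms(1) R by (auto simp: pol3_def preserves3_def)
  also have "map (\<lambda>i. g (?m h1 ! i) (?m h2 ! i) (?m h3 ! i)) [0..<fst R] =
      ?m (\<lambda>x y z. g (h1 x y z) (h2 x y z) (h3 x y z))"
    by (rule map_cong) auto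
  finally show "?m (\<lambda>x y z. g (h1 x y z) (h2 x y z) (h3 x y z)) \<in> snd R" .
qed

lemma pol3_cong:
  assumes A: "\<forall>R\<in>A. bool_relation R" and g: "pol3 A g"
    and eq: "\<And>x y z. x \<in> {1,-1} \<Longrightarrow> y \<in> {1,-1} \<Longrightarrow> z \<in> {1,-1} \<Longrightarrow> g x y z = h x y z"
  shows "pol3 A h"
  unfolding pol3_def preserves3_def
proof (intro ballI)
  fix R x y z assume R: "R \<in> A" and xyz: "x \<in> snd R" "y \<in> snd R" "z \<in> snd R"
  have v: "w ! i \<in> {1,-1}" if "i < fst R" "w \<in> snd R" for w i
    using tuples_nth[of w "fst R" i] that A R by (auto simp: bool_relation_def)
  have "map (\<lambda>i. g (x ! i) (y ! i) (z ! i)) [0..<fst R] \<in> snd R"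
    using g R xyz by (auto simp: pol3_def preserves3_def)
  also have "map (\<lambda>i. g (x ! i) (y ! i) (z ! i)) [0..<fst R] = map (\<lambda>i. h (x ! i) (y ! i) (z ! i)) [0..<fst R]"
    using v xyz eq by (intro map_cong) auto
  finally show "map (\<lambda>i. h (x ! i) (y ! i) (z ! i)) [0..<fst R] \<in> snd R" .
qed

lemma pol3_proj:
  assumes A: "\<forall>R\<in>A. bool_relation R"
  shows "pol3 A (\<lambda>x y z. x)" "pol3 A (\<lambda>x y z. y)" "pol3 A (\<lambda>x y z. z)"
proof -
  have "map (\<lambda>i. w ! i) [0..<fst R] = w" if "R \<in> A" "w \<in> snd R" for R w
  proof -
    have "length w = fst R" using that A by (auto simp: bool_relation_def tuples_def)
    then show ?thesis using map_nth[of w] by simp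
  qed
  then show "pol3 A (\<lambda>x y z. x)" "pol3 A (\<lambda>x y z. y)" "pol3 A (\<lambda>x y z. z)"
    by (auto simp: pol3_def preserves3_def)
qed

text \<open>Each class of the classification is recognised by one polymorphism. Nonempty relations
  supply the tuples to which a constant polymorphism is applied.\<close>

lemma hard_language_not_pol3:
  assumes "hard_language A"
  shows "s \<in> {1, -1} \<Longrightarrow> \<not> pol3 A (\<lambda>x y z. s)"
    and "t \<in> {1, -1} \<Longrightarrow> \<not> pol3 A (\<lambda>x y z. meet_at t x y)"
    and "\<not> pol3 A majority3"
proof -
  have br: "bool_relation R" and ne: "snd R \<noteq> {}" if "R \<in> A" for R
    using that assms by (auto simp: hard_language_def)
  have const: "\<not> pol3 A (\<lambda>x y z. s)" if R: "R \<in> A" "replicate (fst R) s \<notin> snd R" for R s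
  proof
    assume p: "pol3 A (\<lambda>x y z. s)"
    obtain x where "x \<in> snd R" using ne[OF R(1)] by auto
    then have "map (\<lambda>i. s) [0..<fst R] \<in> snd R"
      using p R(1) unfolding pol3_def preserves3_def by blast
    then show False using R(2) by (simp add: map_replicate_const)
  qed
  show "\<not> pol3 A (\<lambda>x y z. s)" if "s \<in> {1, -1}"
    using that assms const unfolding hard_language_def zero_valid_def one_valid_def by blast
  have "\<not> (\<forall>R\<in>A. cnf_definable (\<lambda>C. length (filter (\<lambda>l. lit_val l = t) C) \<le> 1) R)" if "t \<in> {1, -1}" for t
    using that assms by (auto simp: hard_language_def horn_def dual_horn_def is_Pos_eq)
  then show "\<not> pol3 A (\<lambda>x y z. meet_at t x y)" if "t \<in> {1, -1}"
    using meet_closed_cnf_definable[OF br that] that unfolding pol3_def by blast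
  show "\<not> pol3 A majority3"
    using majority_closed_cnf_definable[OF br] assms
    by (auto simp: pol3_def hard_language_def bijunctive_def)
qed

text \<open>Identifying two arguments of \<open>g\<close> yields a projection, since conjunction and
  disjunction are excluded. So \<open>g\<close> is determined by its three values with a single -1,
  which leaves eight functions: the three projections and the sum of three arguments satisfy the
  equation, while majority and majority with one argument negated do not and are excluded.\<close>

lemma pol3_idempotent_linear:
  assumes hard: "hard_language A" and g: "pol3 A g"
    and val: "\<And>x y z. x \<in> {1,-1} \<Longrightarrow> y \<in> {1,-1} \<Longrightarrow> z \<in> {1,-1} \<Longrightarrow> g x y z \<in> {1,-1}"
    and idem: "g 1 1 1 = 1" "g (-1) (-1) (-1) = -1"
  shows "g 1 (-1) 1 * g 1 (-1) (-1) = g 1 1 1 * g 1 1 (-1)"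
proof -
  have A: "\<forall>R\<in>A. bool_relation R" using hard by (simp add: hard_language_def)
  note proj = pol3_proj[OF A]
  have binary: "h (-1) 1 = - h 1 (-1)"
    if p: "pol3 A (\<lambda>x y z. h x y)" and h: "h 1 1 = 1" "h (-1) (-1) = -1"
      and v: "h 1 (-1) = 1 \<or> h 1 (-1) = -1" "h (-1) 1 = 1 \<or> h (-1) 1 = -1" for h
  proof (rule ccontr)
    assume "h (-1) 1 \<noteq> - h 1 (-1)"
    then have "(h 1 (-1) = 1 \<and> h (-1) 1 = 1) \<or> (h 1 (-1) = -1 \<and> h (-1) 1 = -1)" using v by auto
    then have "pol3 A (\<lambda>x y z. meet_at (-1) x y) \<or> pol3 A (\<lambda>x y z. meet_at 1 x y)"
    proof
      assume "h 1 (-1) = 1 \<and> h (-1) 1 = 1"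
      then have "pol3 A (\<lambda>x y z. meet_at (-1) x y)"
        using h by (intro pol3_cong[OF A p]) (auto simp: meet_at_def)
      then show ?thesis ..
    next
      assume "h 1 (-1) = -1 \<and> h (-1) 1 = -1"
      then have "pol3 A (\<lambda>x y z. meet_at 1 x y)"
        using h by (intro pol3_cong[OF A p]) (auto simp: meet_at_def)
      then show ?thesis ..
    qed
    then show False using hard_language_not_pol3(2)[OF hard] by auto
  qed
  have v: "g x y z = 1 \<or> g x y z = -1" if "x \<in> {1,-1}" "y \<in> {1,-1}" "z \<in> {1,-1}" for x y z
    using val[OF that] by auto
  have 1: "g (-1) (-1) 1 = - g 1 1 (-1)"
    using binary[of "\<lambda>x y. g x x y"] pol3_comp[OF g proj(1,1,2)] idem v by simp
  have 2: "g (-1) 1 (-1) = - g 1 (-1) 1"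
    using binary[of "\<lambda>x y. g x y x"] pol3_comp[OF g proj(1,2,1)] idem v by simp
  have 3: "g 1 (-1) (-1) = - g (-1) 1 1"
    using binary[of "\<lambda>x y. g y x x"] pol3_comp[OF g proj(2,1,1)] idem v by simp
  have no_maj: "\<not> (\<forall>x\<in>{1,-1}. \<forall>y\<in>{1,-1}. \<forall>z\<in>{1,-1}. h x y z = majority3 x y z)"
    if "pol3 A h" for h
    using pol3_cong[OF A that, of majority3] hard_language_not_pol3(3)[OF hard] by auto
  note gs = idem 1 2 3
  have maj1: "\<not> (g 1 1 (-1) = 1 \<and> g 1 (-1) 1 = 1 \<and> g (-1) 1 1 = 1)"
    using no_maj[OF g] gs by (auto simp: majority3_def)
  \<comment> \<open>Here \<open>g\<close> is majority with the second argument negated; substituting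
    \<open>g\<close> itself for that argument yields majority. The next two cases treat the other
    arguments, up to a permutation of the variables.\<close>
  have maj2: "\<not> (g 1 1 (-1) = -1 \<and> g 1 (-1) 1 = 1 \<and> g (-1) 1 1 = -1)"
    using no_maj[OF pol3_comp[OF g proj(1) g proj(3)]] gs by (auto simp: majority3_def)
  have maj3: "\<not> (g 1 1 (-1) = 1 \<and> g 1 (-1) 1 = -1 \<and> g (-1) 1 1 = -1)"
    using no_maj[OF pol3_comp[OF g proj(1,3) pol3_comp[OF g proj(1,3,2)]]] gs by (auto simp: majority3_def)
  have maj4: "\<not> (g 1 1 (-1) = -1 \<and> g 1 (-1) 1 = -1 \<and> g (-1) 1 1 = 1)"
    using no_maj[OF pol3_comp[OF g pol3_comp[OF g proj(2,1,3)] proj(1,3)]] gs by (auto simp: majority3_def)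
  show ?thesis
    using v[of 1 1 "-1"] v[of 1 "-1" 1] v[of "-1" 1 1] maj1 maj2 maj3 maj4 gs by auto
qed

text \<open>The unary function obtained by identifying all arguments is not constant, so it is the
  identity or the negation. In the latter case composing \<open>g\<close> with it gives the
  idempotent polymorphism \<open>- g\<close>, and the equation is unaffected by the sign.\<close>

lemma pol3_linear:
  assumes hard: "hard_language A" and g: "pol3 A g"
    and val: "\<And>x y z. x \<in> {1,-1} \<Longrightarrow> y \<in> {1,-1} \<Longrightarrow> z \<in> {1,-1} \<Longrightarrow> g x y z \<in> {1,-1}"
  shows "g 1 (-1) 1 * g 1 (-1) (-1) = g 1 1 1 * g 1 1 (-1)"
    and "g (-1) (-1) (-1) = - g 1 1 1"
proof -
  have A: "\<forall>R\<in>A. bool_relation R" using hard by (simp add: hard_language_def)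
  note proj = pol3_proj[OF A]
  have v: "g x y z = 1 \<or> g x y z = -1" if "x \<in> {1,-1}" "y \<in> {1,-1}" "z \<in> {1,-1}" for x y z
    using val[OF that] by auto
  have u: "pol3 A (\<lambda>x y z. g x x x)" by (rule pol3_comp[OF g proj(1,1,1)])
  show neg: "g (-1) (-1) (-1) = - g 1 1 1"
  proof (rule ccontr)
    assume "\<not> ?thesis"
    then have eq: "g (-1) (-1) (-1) = g 1 1 1" using v[of 1 1 1] v[of "-1" "-1" "-1"] by auto
    have "pol3 A (\<lambda>x y z. g 1 1 1)"
      by (rule pol3_cong[OF A u]) (use eq in auto)
    then show False using hard_language_not_pol3(1)[OF hard val[of 1 1 1]] by auto
  qed
  show "g 1 (-1) 1 * g 1 (-1) (-1) = g 1 1 1 * g 1 1 (-1)"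
  proof (cases "g 1 1 1 = 1")
    case True
    then show ?thesis using pol3_idempotent_linear[OF hard g val] neg by simp
  next
    case False
    then have g1: "g 1 1 1 = -1" using v[of 1 1 1] by auto
    have "pol3 A (\<lambda>x y z. g (g x y z) (g x y z) (g x y z))"
      by (rule pol3_comp[OF g g g g])
    then have p: "pol3 A (\<lambda>x y z. - g x y z)"
    proof (rule pol3_cong[OF A])
      fix x y z :: int assume "x \<in> {1,-1}" "y \<in> {1,-1}" "z \<in> {1,-1}"
      then show "g (g x y z) (g x y z) (g x y z) = - g x y z"
        using v[of x y z] g1 neg by auto
    qed
    have "(- g 1 (-1) 1) * (- g 1 (-1) (-1)) = (- g 1 1 1) * (- g 1 1 (-1))"
      by (rule pol3_idempotent_linear[OF hard p]) (use val g1 neg in \<open>force+\<close>)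
    then show ?thesis by simp
  qed
qed

definition pol :: "brel set \<Rightarrow> nat \<Rightarrow> (int list \<Rightarrow> int) \<Rightarrow> bool" where
  "pol A k f \<longleftrightarrow> (\<forall>R\<in>A. \<forall>ts. length ts = k \<longrightarrow> set ts \<subseteq> snd R \<longrightarrow>
     map (\<lambda>i. f (map (\<lambda>t. t ! i) ts)) [0..<fst R] \<in> snd R)"

lemma pol_minor:
  assumes f: "pol A k f"
  shows "pol3 A (\<lambda>x y z. f (map (\<lambda>j. if P j then z else if Q j then x else y) [0..<k]))"
  unfolding pol3_def preserves3_def
proof (intro ballI)
  fix R x y z assume R: "R \<in> A" and xyz: "x \<in> snd R" "y \<in> snd R" "z \<in> snd R"
  define ts where "ts = map (\<lambda>j. if P j then z else if Q j then x else y) [0..<k]"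
  have "length ts = k" "set ts \<subseteq> snd R" using xyz by (auto simp: ts_def)
  then have "map (\<lambda>i. f (map (\<lambda>t. t ! i) ts)) [0..<fst R] \<in> snd R"
    using f R by (auto simp: pol_def)
  moreover have "map (\<lambda>t. t ! i) ts = map (\<lambda>j. if P j then z ! i else if Q j then x ! i else y ! i) [0..<k]" for i
    by (simp add: ts_def)
  ultimately show "map (\<lambda>i. f (map (\<lambda>j. if P j then z ! i else if Q j then x ! i else y ! i) [0..<k])) [0..<fst R] \<in> snd R"
    by simp
qed

text \<open>In the group of signs this says that \<open>f\<close> is affine: \<open>s i\<close> is
  -1 exactly for the arguments on which \<open>f\<close> depends, and the last equation says that
  their number is odd.\<close>

lemma pol_affine:
  assumes hard: "hard_language A" and f: "pol A k f"
    and val: "\<And>a. a \<in> tuples k \<Longrightarrow> f a = 1 \<or> f a = -1"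
  obtains s where "\<And>i. s i \<in> {1,-1}"
    "\<And>a. a \<in> tuples k \<Longrightarrow> f a = f (replicate k 1) * (\<Prod>i<k. if a ! i = -1 then s i else 1)"
    "(\<Prod>i<k. s i) = -1"
proof -
  define one where "one = replicate k (1::int)"
  define s where "s i = (if i < k then f (one[i := 1]) * f (one[i := -1]) else 1)" for i
  have upd: "a[i := v] \<in> tuples k" if "a \<in> tuples k" "v \<in> {1,-1}" for a i v
    using that set_update_subset_insert[of a i v] by (auto simp: tuples_def)
  have one: "one \<in> tuples k" by (auto simp: one_def tuples_def)
  have s: "s i \<in> {1,-1}" for i
    using val[OF upd[OF one, of 1 i]] val[OF upd[OF one, of "-1" i]] by (auto simp: s_def)
  have m: "map (\<lambda>j. if P j then z else if Q j then x else y) [0..<k] \<in> tuples k"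
    if "x \<in> {1,-1}" "y \<in> {1,-1}" "z \<in> {1,-1}" for P Q x y z
    using that by (auto simp: tuples_def)
  \<comment> \<open>The effect of argument \<open>i\<close> does not depend on the others. The
    ternary minor groups the arguments other than \<open>i\<close> by their value in
    \<open>a\<close>, which reduces the claim to \<open>pol3_linear\<close>.\<close>
  have flip: "f (a[i := 1]) * f (a[i := -1]) = s i" if a: "a \<in> tuples k" and i: "i < k" for a i
  proof -
    define g where "g x y z = f (map (\<lambda>j. if j = i then z else if a ! j = 1 then x else y) [0..<k])" for x y z
    have len: "length a = k" using a by (simp add: tuples_def)
    have aj: "a ! j = 1 \<or> a ! j = -1" if "j < k" for j using tuples_nth[OF a that] .
    have aj': "a ! j = -1" if "j < k" "a ! j \<noteq> 1" for j using aj[OF that(1)] that(2) by simp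
    have "pol3 A g" unfolding g_def by (rule pol_minor[OF f])
    then have "g 1 (-1) 1 * g 1 (-1) (-1) = g 1 1 1 * g 1 1 (-1)"
    proof (rule pol3_linear(1)[OF hard])
      fix x y z :: int assume "x \<in> {1,-1}" "y \<in> {1,-1}" "z \<in> {1,-1}"
      from val[OF m[OF this]] show "g x y z \<in> {1,-1}" by (auto simp: g_def)
    qed
    moreover have "g 1 (-1) z = f (a[i := z])" for z
      unfolding g_def using aj' len by (intro arg_cong[of _ _ f] nth_equalityI) auto
    moreover have "g 1 1 z = f (one[i := z])" for z
      unfolding g_def by (intro arg_cong[of _ _ f] nth_equalityI) (auto simp: one_def)
    ultimately show ?thesis using i by (simp add: s_def)
  qed
  have formula: "f a = f one * (\<Prod>i<k. if a ! i = -1 then s i else 1)" if a: "a \<in> tuples k" for a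
  proof -
    have len: "length a = k" using a by (simp add: tuples_def)
    \<comment> \<open>These tuples lead from the constant 1 to \<open>a\<close> by changing one
      entry at a time.\<close>
    define b where "b m = take m a @ replicate (k - m) 1" for m
    have bt: "b m \<in> tuples k" if "m \<le> k" for m
      using a that set_take_subset[of m a] by (auto simp: b_def tuples_def)
    have "f (b m) = f one * (\<Prod>i<m. if a ! i = -1 then s i else 1)" if "m \<le> k" for m
      using that
    proof (induction m)
      case 0
      then show ?case by (simp add: b_def one_def)
    next
      case (Suc m)
      have m: "m < k" "m \<le> k" using Suc by auto
      have b1: "b m = (b m)[m := 1]"
        using m len by (intro nth_equalityI) (auto simp: b_def nth_list_update nth_append)
      have b2: "b (Suc m) = (b m)[m := a ! m]"
        using m len by (intro nth_equalityI) (auto simp: b_def nth_list_update nth_append less_Suc_eq)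
      have "a ! m = 1 \<or> a ! m = -1" using tuples_nth[OF a m(1)] .
      then show ?case
      proof
        assume "a ! m = 1"
        then show ?thesis using b1 b2 Suc.IH[OF m(2)] by simp
      next
        assume am: "a ! m = -1"
        have fb: "f (b m) * f (b (Suc m)) = s m"
          using flip[OF bt[OF m(2)] m(1)] b1 b2 am by simp
        have "f (b m) * f (b m) = 1" using val[OF bt[OF m(2)]] by auto
        then have "f (b (Suc m)) = f (b m) * (f (b m) * f (b (Suc m)))" by (simp add: mult.assoc[symmetric])
        then have "f (b (Suc m)) = f (b m) * s m" unfolding fb .
        then show ?thesis using Suc.IH[OF m(2)] am by simp
      qed
    qed
    from this[of k] show ?thesis using len by (simp add: b_def)
  qed
  have "f (replicate k (-1)) = - f one"
  proof -
    define g where "g x y z = f (map (\<lambda>j. if False then z else if True then x else y) [0..<k])" for x y z :: int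
    have "pol3 A g" unfolding g_def by (rule pol_minor[OF f])
    then have "g (-1) (-1) (-1) = - g 1 1 1"
    proof (rule pol3_linear(2)[OF hard])
      fix x y z :: int assume "x \<in> {1,-1}" "y \<in> {1,-1}" "z \<in> {1,-1}"
      from val[OF m[OF this, of "\<lambda>_. False" "\<lambda>_. True"]] show "g x y z \<in> {1,-1}" by (auto simp: g_def)
    qed
    then show ?thesis by (simp add: g_def one_def map_replicate_const)
  qed
  moreover have "replicate k (-1) \<in> tuples k" by (auto simp: tuples_def)
  ultimately have "f one * (\<Prod>i<k. s i) = - f one"
    using formula[of "replicate k (-1)"] by simp
  then have "(\<Prod>i<k. s i) = -1" using val[OF one] by auto
  then show thesis using that[of s] s formula by (simp add: one_def)
qed

text \<open>Four arguments serve two ends: the constant factor of an affine polymorphism cancels in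
  a product of four values, and products of three are still expressible with a variable for the
  identity in the last place.\<close>

definition parity4 :: "int \<Rightarrow> brel" where
  "parity4 \<sigma> = (4, {a \<in> tuples 4. a ! 0 * a ! 1 * a ! 2 * a ! 3 = \<sigma>})"

lemma pol_preserves_parity:
  assumes hard: "hard_language A" and f: "pol A k f"
    and val: "\<And>a. a \<in> tuples k \<Longrightarrow> f a = 1 \<or> f a = -1"
    and abcd: "a \<in> tuples k" "b \<in> tuples k" "c \<in> tuples k" "d \<in> tuples k"
    and prod: "\<And>i. i < k \<Longrightarrow> a ! i * b ! i * c ! i * d ! i = \<sigma>" and \<sigma>: "\<sigma> \<in> {1,-1}"
  shows "f a * f b * f c * f d = \<sigma>"
proof -
  obtain s where s: "\<And>i. s i \<in> {1,-1}"
    "\<And>a. a \<in> tuples k \<Longrightarrow> f a = f (replicate k 1) * (\<Prod>i<k. if a ! i = -1 then s i else 1)"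
    "(\<Prod>i<k. s i) = -1"
    using pol_affine[OF hard f val] by blast
  define p where "p x i = (if x = -1 then s i else 1)" for x :: int and i
  define u where "u = f (replicate k 1)"
  have u: "u = 1 \<or> u = -1" unfolding u_def by (rule val[OF replicate_tuples])
  have fp: "f x = u * (\<Prod>i<k. p (x ! i) i)" if "x \<in> tuples k" for x
    using s(2)[OF that] by (simp add: p_def u_def)
  have "f a * f b * f c * f d = (u * u * u * u) * (\<Prod>i<k. p (a ! i) i * p (b ! i) i * p (c ! i) i * p (d ! i) i)"
    by (simp add: fp abcd prod.distrib)
  also have "u * u * u * u = 1" using u by auto
  also have "(\<Prod>i<k. p (a ! i) i * p (b ! i) i * p (c ! i) i * p (d ! i) i) = (\<Prod>i<k. p \<sigma> i)"
  proof (rule prod.cong[OF refl])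
    fix i assume "i \<in> {..<k}"
    then have i: "i < k" by simp
    have "a ! i \<in> {1,-1}" "b ! i \<in> {1,-1}" "c ! i \<in> {1,-1}" "d ! i \<in> {1,-1}"
      using abcd[THEN tuples_nth, OF i] by auto
    then show "p (a ! i) i * p (b ! i) i * p (c ! i) i * p (d ! i) i = p \<sigma> i"
      using prod[OF i] s(1)[of i] unfolding p_def by auto
  qed
  also have "\<dots> = \<sigma>" using \<sigma> s(3) by (auto simp: p_def)
  finally show ?thesis by simp
qed

text \<open>Equal columns would merge two of the four distinguished variables of the gadget.\<close>

lemma parity4_column_distinct:
  assumes \<sigma>: "\<sigma> \<in> {1,-1}" and ij: "i < 4" "j < 4" "i \<noteq> j"
  shows "\<exists>t\<in>snd (parity4 \<sigma>). t ! i \<noteq> t ! j"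
proof -
  \<comment> \<open>For product 1 the columns spell the binary digits of the position; for product
    -1 three tuples with a single -1 separate the positions.\<close>
  define ts where "ts = (if \<sigma> = 1 then [[-1,-1,1,1], [-1,1,-1,1]] else [[-1,1,1,1], [1,-1,1,1], [1,1,-1,1::int]])"
  have "set ts \<subseteq> snd (parity4 \<sigma>)"
    using \<sigma> by (auto simp: ts_def parity4_def tuples_def numeral_eq_Suc)
  moreover have "\<exists>t\<in>set ts. t ! i \<noteq> t ! j"
  proof -
    have "i \<in> {0,1,2,3}" "j \<in> {0,1,2,3}" using ij by auto
    then show ?thesis using ij(3) \<sigma> by (auto simp: ts_def numeral_eq_Suc)
  qed
  ultimately show ?thesis by blast
qed

text \<open>The variables of the gadget are the columns of the list of all tuples of the parity
  relation, that is, the arguments of a polymorphism. Every assignment which violates the parity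
  is not a polymorphism, and one constraint excludes it.\<close>

lemma parity_gadget:
  assumes hard: "hard_language A" and \<sigma>: "\<sigma> \<in> {1,-1}"
  obtains N cs where "4 \<le> N" "wf_constraints A N cs"
    "\<And>\<phi>. bool_model N cs \<phi> \<Longrightarrow> \<phi> 0 * \<phi> 1 * \<phi> 2 * \<phi> 3 = \<sigma>"
    "\<And>a. a \<in> snd (parity4 \<sigma>) \<Longrightarrow> \<exists>\<phi>. bool_model N cs \<phi> \<and> (\<forall>i<4. \<phi> i = a ! i)"
proof -
  have A: "bool_relation R" if "R \<in> A" for R using hard that by (simp add: hard_language_def)
  have "finite (snd (parity4 \<sigma>))" using finite_tuples by (auto simp: parity4_def)
  then obtain ts where ts: "set ts = snd (parity4 \<sigma>)" using finite_list by blast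
  define k where "k = length ts"
  have tsj: "ts ! j \<in> snd (parity4 \<sigma>)" if "j < k" for j
    unfolding ts[symmetric] using that by (simp add: k_def)
  define col where "col i = map (\<lambda>t. t ! i) ts" for i
  have coltup: "col i \<in> tuples k" if "i < 4" for i
  proof -
    have "t ! i = 1 \<or> t ! i = -1" if "t \<in> set ts" for t
      using that tuples_nth[of t 4 i] \<open>i < 4\<close> unfolding ts parity4_def by simp
    then show ?thesis by (auto simp: col_def tuples_def k_def)
  qed
  have colinj: "col i \<noteq> col j" if "i < 4" "j < 4" "i \<noteq> j" for i j
    using parity4_column_distinct[OF \<sigma> that] unfolding ts[symmetric] by (auto simp: col_def)
  obtain ys where ys: "set ys = tuples k - set (map col [0..<4])" "distinct ys"
    using finite_distinct_list[of "tuples k - set (map col [0..<4])"] finite_tuples by blast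
  \<comment> \<open>The four columns come first, so that they are the variables 0 to 3.\<close>
  define xs where "xs = map col [0..<4] @ ys"
  have "inj_on col {0..<4}"
    by (rule inj_onI) (use colinj in \<open>metis atLeastLessThan_iff\<close>)
  then have "distinct (map col [0..<4])" by (simp add: distinct_map)
  then have dist: "distinct xs" using ys by (auto simp: xs_def)
  have setxs: "set xs = tuples k" using ys coltup by (auto simp: xs_def)
  define N where "N = length xs"
  have N4: "4 \<le> N" by (simp add: N_def xs_def)
  have xs4: "xs ! i = col i" if "i < 4" for i using that by (simp add: xs_def nth_append)
  define idx where "idx a = (SOME i. i < N \<and> xs ! i = a)" for a
  have idx: "idx a < N" "xs ! idx a = a" if "a \<in> tuples k" for a
  proof -
    have "\<exists>i<N. xs ! i = a" using that setxs by (auto simp: N_def in_set_conv_nth)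
    then have "idx a < N \<and> xs ! idx a = a" unfolding idx_def by (rule someI_ex)
    then show "idx a < N" "xs ! idx a = a" by auto
  qed
  have xst: "xs ! i \<in> tuples k" if "i < N" for i
    unfolding setxs[symmetric] using that by (simp add: N_def)
  have idx_xs: "idx (xs ! i) = i" if "i < N" for i
    using idx[OF xst[OF that]] nth_eq_iff_index_eq[OF dist, of "idx (xs ! i)" i] that by (simp add: N_def)
  define bad where "bad = {p \<in> tuples N. p ! 0 * p ! 1 * p ! 2 * p ! 3 \<noteq> \<sigma>}"
  \<comment> \<open>An assignment of the gadget is a function on \<open>tuples k\<close>. If no
    constraint over \<open>A\<close> excluded it, it would be a polymorphism, and these preserve the
    parity.\<close>
  have witness: "\<exists>R us. R \<in> A \<and> length us = k \<and> set us \<subseteq> snd R \<and>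
      map (\<lambda>i. p ! idx (map (\<lambda>t. t ! i) us)) [0..<fst R] \<notin> snd R" if p: "p \<in> bad" for p
  proof (rule ccontr)
    assume "\<not> ?thesis"
    then have f: "pol A k (\<lambda>a. p ! idx a)" by (auto simp: pol_def)
    have pt: "p \<in> tuples N" using p by (simp add: bad_def)
    have "p ! idx (col 0) * p ! idx (col 1) * p ! idx (col 2) * p ! idx (col 3) = \<sigma>"
    proof (rule pol_preserves_parity[OF hard f])
      show "p ! idx a = 1 \<or> p ! idx a = -1" if "a \<in> tuples k" for a
        using tuples_nth[OF pt idx(1)[OF that]] .
      show "col 0 ! i * col 1 ! i * col 2 ! i * col 3 ! i = \<sigma>" if "i < k" for i
        using tsj[OF that] that by (simp add: col_def k_def parity4_def)
    qed (use coltup \<sigma> in auto)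
    moreover have "idx (col i) = i" if "i < 4" for i
      using idx_xs[of i] that N4 xs4[OF that] by simp
    ultimately show False using p by (simp add: bad_def)
  qed
  then obtain RR us where w: "\<And>p. p \<in> bad \<Longrightarrow> RR p \<in> A \<and> length (us p) = k \<and> set (us p) \<subseteq> snd (RR p) \<and>
      map (\<lambda>i. p ! idx (map (\<lambda>t. t ! i) (us p))) [0..<fst (RR p)] \<notin> snd (RR p)"
    by metis
  have ucol: "map (\<lambda>t. t ! i) (us p) \<in> tuples k" if p: "p \<in> bad" and i: "i < fst (RR p)" for p i
  proof -
    have "t ! i = 1 \<or> t ! i = -1" if "t \<in> set (us p)" for t
      using tuples_nth[of t "fst (RR p)" i] A[of "RR p"] w[OF p] that i by (auto simp: bool_relation_def)
    then show ?thesis using w[OF p] by (auto simp: tuples_def)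
  qed
  have "finite bad" using finite_tuples by (simp add: bad_def)
  then obtain bs where bs: "set bs = bad" using finite_list by blast
  define con where "con p = (map (\<lambda>i. idx (map (\<lambda>t. t ! i) (us p))) [0..<fst (RR p)], RR p)" for p
  define cs where "cs = map con bs"
  show thesis
  proof (rule that[OF N4, of cs])
    show "wf_constraints A N cs"
      using w idx(1)[OF ucol] bs by (auto simp: wf_constraints_def cs_def con_def)
    show "\<phi> 0 * \<phi> 1 * \<phi> 2 * \<phi> 3 = \<sigma>" if m: "bool_model N cs \<phi>" for \<phi>
    proof (rule ccontr)
      assume neq: "\<phi> 0 * \<phi> 1 * \<phi> 2 * \<phi> 3 \<noteq> \<sigma>"
      define p where "p = map \<phi> [0..<N]"
      have pn: "p ! i = \<phi> i" if "i < N" for i using that by (simp add: p_def)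
      have p: "p \<in> bad"
      proof -
        have "p \<in> tuples N" using m by (auto simp: tuples_def bool_model_def p_def)
        moreover have "p ! 0 = \<phi> 0" "p ! 1 = \<phi> 1" "p ! 2 = \<phi> 2" "p ! 3 = \<phi> 3"
          using pn N4 by simp_all
        ultimately show ?thesis using neq by (simp only: bad_def mem_Collect_eq) blast
      qed
      then have "map \<phi> (fst (con p)) \<in> snd (RR p)"
        using m bs by (force simp: bool_model_def cs_def con_def)
      also have "map \<phi> (fst (con p)) = map (\<lambda>i. p ! idx (map (\<lambda>t. t ! i) (us p))) [0..<fst (RR p)]"
        using pn idx(1)[OF ucol[OF p]] by (simp add: con_def)
      finally show False using w[OF p] by simp
    qed
    show "\<exists>\<phi>. bool_model N cs \<phi> \<and> (\<forall>i<4. \<phi> i = a ! i)" if a: "a \<in> snd (parity4 \<sigma>)" for a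
    proof -
      obtain j where j: "j < k" "a = ts ! j" using a unfolding ts[symmetric] in_set_conv_nth k_def by metis
      \<comment> \<open>The projection to argument \<open>j\<close>, a polymorphism of every
        language, takes the columns to the given tuple \<open>ts ! j\<close>.\<close>
      define \<phi> where "\<phi> i = xs ! i ! j" for i
      have "\<phi> i \<in> {1,-1}" if "i < N" for i
        using tuples_nth[OF xst[OF that] j(1)] by (simp add: \<phi>_def)
      moreover have "map \<phi> is \<in> snd R" if c: "(is, R) \<in> set cs" for "is" R
      proof -
        obtain p where p: "p \<in> bad" "is = fst (con p)" "R = RR p"
          using c bs by (auto simp: cs_def con_def)
        have usj: "us p ! j \<in> snd R" using w[OF p(1)] j(1) p(3) by auto
        have "map \<phi> is = map (\<lambda>i. us p ! j ! i) [0..<fst R]"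
          using idx(2)[OF ucol[OF p(1)]] w[OF p(1)] j(1) by (simp add: p \<phi>_def con_def)
        also have "\<dots> = us p ! j"
        proof -
          have "length (us p ! j) = fst R"
            using usj A[of R] w[OF p(1)] p(3) by (auto simp: bool_relation_def tuples_def)
          then show ?thesis using map_nth[of "us p ! j"] by simp
        qed
        finally show ?thesis using usj by simp
      qed
      moreover have "\<forall>i<4. \<phi> i = a ! i"
        using xs4 j by (simp add: \<phi>_def col_def k_def)
      ultimately show ?thesis by (intro exI[of _ \<phi>]) (auto simp: bool_model_def)
    qed
  qed
qed

section \<open>Reduction from parity constraints\<close>

lemma comm_involsD:
  assumes "comm_invols H Bs" "B \<in> set Bs"
  shows "invol H B" "C \<in> set Bs \<Longrightarrow> commute_on H B C"
  using assms by (auto simp: comm_invols_def)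

lemma op_constraint_cong:
  "(\<And>i. i \<in> set is \<Longrightarrow> f i = g i) \<Longrightarrow> op_constraint H f is R = op_constraint H g is R"
  unfolding op_constraint_def by (metis map_cong)

lemma op_model_append:
  "op_model H n (cs @ ds) f \<longleftrightarrow> op_model H n cs f \<and> op_model H n ds f"
  by (auto simp: op_model_def)

lemma op_model_cong:
  assumes "wf_constraints A n cs" "\<And>i. i < n \<Longrightarrow> f i = g i"
  shows "op_model H n cs f = op_model H n cs g"
proof -
  have "op_constraint H f is R = op_constraint H g is R" if "(is, R) \<in> set cs" for "is" R
    using assms that by (intro op_constraint_cong) (force simp: wf_constraints_def)
  then show ?thesis using assms(2) by (auto simp: op_model_def)
qed

context hilbert_space
begin

text \<open>The vectors with label \<open>b\<close> for \<open>Cs\<close> form a subspace invariant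
  under \<open>Bs\<close>; being nonzero, it contains a nonzero joint eigenvector of
  \<open>Bs\<close>.\<close>

lemma joint_eigen_refine:
  assumes Bs: "comm_invols H Bs" and Cs: "\<And>C. C \<in> set Cs \<Longrightarrow> linear_op H C"
    and comm: "\<And>B C. B \<in> set Bs \<Longrightarrow> C \<in> set Cs \<Longrightarrow> commute_on H B C"
    and y: "joint_eigen H Cs b y" "y \<noteq> \<zero>"
  shows "\<exists>z a. z \<noteq> \<zero> \<and> joint_eigen H Bs a z \<and> joint_eigen H Cs b z"
proof (rule ccontr)
  assume none: "\<not> ?thesis"
  have lin: "linear_op H (Cs ! i)" if "i < length Cs" for i using Cs that by simp
  have b: "b \<in> tuples (length Cs)" using y by (simp add: joint_eigen_def)
  have "y = \<zero>"
  proof (rule joint_eigen_induct[OF Bs, where S = "{z. joint_eigen H Cs b z}" and Q = "\<lambda>z. z = \<zero>"])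
    show "{z. joint_eigen H Cs b z} \<subseteq> carrier H" by (auto simp: joint_eigen_def)
    show "u \<oplus> v \<in> {z. joint_eigen H Cs b z}"
      if "u \<in> {z. joint_eigen H Cs b z}" "v \<in> {z. joint_eigen H Cs b z}" for u v
      using that by (auto simp: joint_eigen_def linear_opD(2)[OF lin] sm_distr)
    show "a \<odot> u \<in> {z. joint_eigen H Cs b z}" if "u \<in> {z. joint_eigen H Cs b z}" for a u
      using that by (auto simp: joint_eigen_def linear_opD(3)[OF lin] mult.commute)
    show "B u \<in> {z. joint_eigen H Cs b z}" if B: "B \<in> set Bs" and u: "u \<in> {z. joint_eigen H Cs b z}" for B u
    proof -
      have uc: "u \<in> carrier H" using u by (simp add: joint_eigen_def)
      note Bl = linear_opD[OF involD(1)[OF comm_involsD(1)[OF Bs B]]]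
      have "(Cs ! i) (B u) = of_int (b ! i) \<odot> B u" if i: "i < length Cs" for i
      proof -
        have "(Cs ! i) (B u) = B ((Cs ! i) u)"
          using commute_onD[OF comm[OF B nth_mem[OF i]] uc] by simp
        also have "(Cs ! i) u = of_int (b ! i) \<odot> u" using u i by (simp add: joint_eigen_def)
        also have "B (of_int (b ! i) \<odot> u) = of_int (b ! i) \<odot> B u" using Bl(3)[OF uc] .
        finally show ?thesis .
      qed
      then show ?thesis using Bl(1)[OF uc] b by (simp add: joint_eigen_def)
    qed
  qed (use none y in auto)
  with y(2) show False by simp
qed

lemma joint_eigen_unique:
  assumes "B z = of_int s \<odot> z" "B z = of_int t \<odot> z" "z \<in> carrier H" "z \<noteq> \<zero>"
  shows "s = t"
  using sm_left_cancel[of z "of_int s" "of_int t"] assms by auto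

lemma invol_comp:
  assumes B: "invol H B" and C: "invol H C" and comm: "commute_on H B C"
  shows "invol H (\<lambda>x. B (C x))"
proof -
  note Bl = linear_opD[OF involD(1)[OF B]] and Cl = linear_opD[OF involD(1)[OF C]]
  have "selfadjoint H (\<lambda>x. B (C x))"
    unfolding selfadjoint_def
  proof (intro ballI)
    fix x y assume x: "x \<in> carrier H" and y: "y \<in> carrier H"
    have "cinner H (B (C x)) y = cinner H (C x) (B y)"
      using involD(2)[OF B] Cl(1)[OF x] y unfolding selfadjoint_def by blast
    also have "\<dots> = cinner H x (C (B y))"
      using involD(2)[OF C] Bl(1)[OF y] x unfolding selfadjoint_def by blast
    finally show "cinner H (B (C x)) y = cinner H x (B (C y))"
      using commute_onD[OF comm y] by simp
  qed
  moreover have "B (C (B (C x))) = x" if x: "x \<in> carrier H" for x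
    using commute_onD[OF comm] involD(3,4)[OF B] involD(3,4)[OF C] x by simp
  ultimately show ?thesis
    by (simp add: invol_def linear_op_def Bl Cl)
qed

lemma op_constraint_full2:
  "op_constraint H f [i, j] full2 \<longleftrightarrow> invol H (f i) \<and> invol H (f j) \<and> commute_on H (f i) (f j)"
  by (auto simp: op_constraint_def comm_invols_def full2_def joint_eigen_def numeral_2_eq_2
      intro: commute_on_sym)

lemma op_constraint_parity4:
  "op_constraint H f [i, j, k, l] (parity4 sg) \<longleftrightarrow> comm_invols H [f i, f j, f k, f l] \<and>
     (\<forall>x\<in>carrier H. f i (f j (f k (f l x))) = of_int sg \<odot> x)"
proof (cases "comm_invols H [f i, f j, f k, f l]")
  case True
  let ?Bs = "[f i, f j, f k, f l]"
  have lin: "linear_op H (f i)" "linear_op H (f j)" "linear_op H (f k)" "linear_op H (f l)"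
    using True by (auto simp: comm_invols_def invol_def)
  note L = lin[THEN linear_opD(1)] lin[THEN linear_opD(2)] lin[THEN linear_opD(3)]
  have val: "f i (f j (f k (f l x))) = of_int (a ! 0 * a ! 1 * a ! 2 * a ! 3) \<odot> x"
    if e: "joint_eigen H ?Bs a x" for a x
  proof -
    have x: "x \<in> carrier H" using e by (simp add: joint_eigen_def)
    have "\<And>m. m < 4 \<Longrightarrow> (?Bs ! m) x = of_int (a ! m) \<odot> x" using e by (simp add: joint_eigen_def)
    from this[of 0] this[of 1] this[of 2] this[of 3]
    show ?thesis using x by (simp add: L mult_ac)
  qed
  have "(\<forall>x a. joint_eigen H ?Bs a x \<longrightarrow> x \<noteq> \<zero> \<longrightarrow> a \<in> snd (parity4 sg)) \<longleftrightarrow>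
      (\<forall>x\<in>carrier H. f i (f j (f k (f l x))) = of_int sg \<odot> x)" (is "?L \<longleftrightarrow> ?R")
  proof
    assume L': ?L
    show ?R
    proof
      fix x assume "x \<in> carrier H"
      then show "f i (f j (f k (f l x))) = of_int sg \<odot> x"
      proof (rule joint_eigen_induct_carrier[OF True, rotated 2])
        fix x a assume e: "joint_eigen H ?Bs a x"
        show "f i (f j (f k (f l x))) = of_int sg \<odot> x"
        proof (cases "x = \<zero>")
          case True
          then show ?thesis using lin[THEN linear_op_zero] by simp
        next
          case False
          then have "a ! 0 * a ! 1 * a ! 2 * a ! 3 = sg" using L' e by (auto simp: parity4_def)
          then show ?thesis using val[OF e] by simp
        qed
      qed (simp add: L sm_distr)
    qed
  next
    assume R': ?R
    show ?L
    proof (intro allI impI)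
      fix x a assume e: "joint_eigen H ?Bs a x" and nz: "x \<noteq> \<zero>"
      then have x: "x \<in> carrier H" by (simp add: joint_eigen_def)
      have eq: "of_int (a ! 0 * a ! 1 * a ! 2 * a ! 3) \<odot> x = of_int sg \<odot> x"
        using val[OF e] R' x by simp
      have "a ! 0 * a ! 1 * a ! 2 * a ! 3 = sg"
      proof (rule ccontr)
        assume "a ! 0 * a ! 1 * a ! 2 * a ! 3 \<noteq> sg"
        then show False using sm_left_cancel[OF x eq] nz by (simp del: of_int_mult)
      qed
      moreover have "a \<in> tuples 4" using e by (simp add: joint_eigen_def numeral_eq_Suc)
      ultimately show "a \<in> snd (parity4 sg)" by (simp add: parity4_def)
    qed
  qed
  then show ?thesis using True by (simp add: op_constraint_def)
qed (simp add: op_constraint_def)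

end

text \<open>Both directions compare labels. Operators of the scope determine the auxiliary ones by
  functional calculus; conversely, the label of a common eigenvector of all gadget operators is a
  Boolean model of the gadget.\<close>

lemma parity_step:
  assumes hard: "hard_language A" and sg: "sg \<in> {1,-1}" and "is": "set is \<subseteq> {..<n}" "length is = 4"
  obtains n' ds where "n \<le> n'" "wf_constraints (A \<union> {full2}) n' ds"
    "\<And>(H :: 'h hilbert) f. hilbert_space H \<Longrightarrow> \<forall>i<n. invol H (f i) \<Longrightarrow> op_constraint H f is (parity4 sg) \<Longrightarrow>
       \<exists>f'. (\<forall>i<n. f' i = f i) \<and> op_model H n' ds f'"
    "\<And>(H :: 'h hilbert) f. hilbert_space H \<Longrightarrow> op_model H n' ds f \<Longrightarrow> op_constraint H f is (parity4 sg)"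
proof -
  obtain N cs where N: "4 \<le> N" and wf: "wf_constraints A N cs"
    and snd: "\<And>\<phi>. bool_model N cs \<phi> \<Longrightarrow> \<phi> 0 * \<phi> 1 * \<phi> 2 * \<phi> 3 = sg"
    and cpl: "\<And>a. a \<in> snd (parity4 sg) \<Longrightarrow> \<exists>\<phi>. bool_model N cs \<phi> \<and> (\<forall>i<4. \<phi> i = a ! i)"
    using parity_gadget[OF hard sg] by blast
  define sub where "sub m = (if m < 4 then is ! m else n + m)" for m
  define vs where "vs = map sub [0..<N]"
  have sub_less: "sub m < n + N" if "m < N" for m
  proof (cases "m < 4")
    case True
    then have "is ! m \<in> set is" using "is" by simp
    then have "is ! m < n" using "is"(1) by blast
    then show ?thesis using True by (simp add: sub_def)
  next
    case False
    then show ?thesis using that by (simp add: sub_def)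
  qed
  have is_sub: "is = map sub [0..<4]"
    using "is"(2) by (intro nth_equalityI) (auto simp: sub_def)
  \<comment> \<open>The full relation on every pair of gadget variables makes all their operators
    commute, also those that share no constraint over \<open>A\<close>.\<close>
  define ds where "ds = map (\<lambda>(js, R). (map sub js, R)) cs @ map (\<lambda>(u, v). ([u, v], full2)) (List.product vs vs)"
  have js: "R \<in> A \<and> length js = fst R \<and> (\<forall>m\<in>set js. m < N)" if "(js, R) \<in> set cs" for js R
    using wf that by (auto simp: wf_constraints_def)
  show thesis
  proof (rule that[of "n + N" ds])
    show "n \<le> n + N" by simp
    show "wf_constraints (A \<union> {full2}) (n + N) ds"
      using js sub_less by (auto simp: wf_constraints_def ds_def vs_def full2_def)
  next
    fix H :: "'h hilbert" and f
    assume H: "hilbert_space H" and inv: "\<forall>i<n. invol H (f i)" and con: "op_constraint H f is (parity4 sg)"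
    interpret hilbert_space H by (rule H)
    define Bs where "Bs = map f is"
    have Bs: "comm_invols H Bs" using con by (simp add: op_constraint_def Bs_def)
    have lenB: "length Bs = 4" using "is" by (simp add: Bs_def)
    obtain \<phi> where \<phi>: "\<And>a. a \<in> snd (parity4 sg) \<Longrightarrow> bool_model N cs (\<phi> a) \<and> (\<forall>i<4. \<phi> a i = a ! i)"
      using cpl by metis
    \<comment> \<open>The value of gadget variable \<open>m\<close> as a function of the scope. The
      default 1 concerns tuples off the parity, which label no nonzero vector.\<close>
    define g where "g m a = (if a \<in> snd (parity4 sg) \<and> m < N then \<phi> a m else 1)" for m a
    have g: "g m a = 1 \<or> g m a = -1" for m a
      using \<phi>[of a] by (auto simp: g_def bool_model_def)
    define f' where "f' v = (if v < n then f v else op_fun H (g (v - n)) Bs)" for v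
    have f'_inv: "invol H (f' v)" for v
      using inv op_fun_invol[OF Bs g] by (simp add: f'_def)
    have f'_is: "f' (is ! m) = Bs ! m \<and> is ! m < n" if "m < 4" for m
    proof -
      have "is ! m \<in> set is" using "is" that by simp
      then have "is ! m < n" using "is"(1) by blast
      then show ?thesis using "is" that by (simp add: f'_def Bs_def)
    qed
    define F where "F m = f' (sub m)" for m
    have F: "F m = (if m < 4 then Bs ! m else op_fun H (g m) Bs)" for m
    proof (cases "m < 4")
      case True
      then show ?thesis using f'_is[OF True] by (simp add: F_def sub_def)
    qed (simp add: F_def sub_def f'_def)
    have Fl: "linear_op H (F m)" for m unfolding F_def by (rule involD(1)[OF f'_inv])
    have FB: "commute_on H B (F m)" if "B \<in> set Bs" for B m
    proof (cases "m < 4")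
      case True
      then show ?thesis using Bs that lenB by (simp add: F comm_invols_def)
    next
      case False
      then show ?thesis
        using op_fun_commute[OF Bs, where g = "g m" and D = B] g that Bs
        by (auto simp: F comm_invols_def invol_def)
    qed
    have FF: "commute_on H (F m) (F m')" for m m'
    proof (cases "m' < 4")
      case True
      then show ?thesis using FB[of "Bs ! m'" m] lenB by (simp add: F[of m'] commute_on_sym)
    next
      case False
      then show ?thesis
        using op_fun_commute[OF Bs, where g = "g m'" and D = "F m"] g Fl FB[THEN commute_on_sym]
        by (simp add: F[of m'])
    qed
    have Fe: "F m z = of_int (\<phi> a m) \<odot>\<^bsub>H\<^esub> z" if "joint_eigen H Bs a z" "a \<in> snd (parity4 sg)" "m < N" for m a z
    proof (cases "m < 4")
      case True
      then show ?thesis using that lenB \<phi>[OF that(2)] by (simp add: F joint_eigen_def)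
    next
      case False
      have "op_fun H (g m) Bs z = of_int (g m a) \<odot>\<^bsub>H\<^esub> z"
        using g by (intro op_fun_eigen[OF Bs _ that(1)])
      then show ?thesis using False that by (simp add: F g_def)
    qed
    have cmF: "comm_invols H (map f' (map sub js'))" for js'
      using f'_inv FF by (auto simp: comm_invols_def F_def)
    have "op_constraint H f' (map sub js) R" if c: "(js, R) \<in> set cs" for js R
      unfolding op_constraint_def
    proof (intro conjI allI impI)
      show "comm_invols H (map f' (map sub js))" by (rule cmF)
      fix y b assume y: "joint_eigen H (map f' (map sub js)) b y" "y \<noteq> \<zero>\<^bsub>H\<^esub>"
      \<comment> \<open>Passing to a joint eigenvector of the scope with the same label
        \<open>b\<close> makes \<open>b\<close> the restriction of the Boolean model chosen for
        \<open>a\<close>.\<close>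
      have "\<exists>z a. z \<noteq> \<zero>\<^bsub>H\<^esub> \<and> joint_eigen H Bs a z \<and> joint_eigen H (map f' (map sub js)) b z"
      proof (rule joint_eigen_refine[OF Bs _ _ y])
        show "linear_op H C" if "C \<in> set (map f' (map sub js))" for C
          using that Fl by (auto simp: F_def)
        show "commute_on H B C" if "B \<in> set Bs" "C \<in> set (map f' (map sub js))" for B C
          using that FB by (auto simp: F_def)
      qed
      then obtain z a where z: "z \<noteq> \<zero>\<^bsub>H\<^esub>" "joint_eigen H Bs a z" "joint_eigen H (map f' (map sub js)) b z" by blast
      have zc: "z \<in> carrier H" using z(2) by (simp add: joint_eigen_def)
      have a: "a \<in> snd (parity4 sg)" using con z by (auto simp: op_constraint_def Bs_def)
      have "b = map (\<phi> a) js"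
      proof (rule nth_equalityI)
        show len: "length b = length (map (\<phi> a) js)" using z(3) by (simp add: joint_eigen_def tuples_def)
        fix p assume "p < length b"
        then have p: "p < length js" using len by simp
        have "F (js ! p) z = of_int (b ! p) \<odot>\<^bsub>H\<^esub> z" using z(3) p by (simp add: joint_eigen_def F_def)
        moreover have "F (js ! p) z = of_int (\<phi> a (js ! p)) \<odot>\<^bsub>H\<^esub> z"
          using Fe[OF z(2) a] js[OF c] p by simp
        ultimately show "b ! p = map (\<phi> a) js ! p"
          using joint_eigen_unique[of "F (js ! p)" z] zc z(1) p by simp
      qed
      then show "b \<in> snd R" using \<phi>[OF a] c by (auto simp: bool_model_def)
    qed
    moreover have "op_constraint H f' [u, v] full2" if "u \<in> set vs" "v \<in> set vs" for u v
      using that f'_inv FF by (auto simp: op_constraint_full2 vs_def F_def)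
    ultimately have "op_model H (n + N) ds f'"
      using f'_inv by (auto simp: op_model_def ds_def)
    moreover have "\<forall>i<n. f' i = f i" by (simp add: f'_def)
    ultimately show "\<exists>f'. (\<forall>i<n. f' i = f i) \<and> op_model H (n + N) ds f'" by blast
  next
    fix H :: "'h hilbert" and f
    assume H: "hilbert_space H" and mod: "op_model H (n + N) ds f"
    interpret hilbert_space H by (rule H)
    define F where "F m = f (sub m)" for m
    have FF: "invol H (F m) \<and> commute_on H (F m) (F m')" if "m < N" "m' < N" for m m'
    proof -
      have "(sub m, sub m') \<in> set (List.product vs vs)" using that by (auto simp: vs_def)
      then have "([sub m, sub m'], full2) \<in> set ds" unfolding ds_def by force
      then have "op_constraint H f [sub m, sub m'] full2"
        using mod unfolding op_model_def by blast
      then show ?thesis by (simp add: op_constraint_full2 F_def)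
    qed
    have F_inv: "invol H (F m)" if "m < N" for m using FF[OF that that] by simp
    have F_comm: "commute_on H (F m) (F m')" if "m < N" "m' < N" for m m' using FF[OF that] by simp
    define Bs where "Bs = map F [0..<N]"
    have Bs: "comm_invols H Bs" using F_inv F_comm by (auto simp: comm_invols_def Bs_def)
    have fis: "map f is = map F [0..<4]" by (subst is_sub) (simp add: F_def)
    have cmi: "comm_invols H (map f is)" unfolding fis using F_inv F_comm N by (auto simp: comm_invols_def)
    show "op_constraint H f is (parity4 sg)"
      unfolding op_constraint_def
    proof (intro conjI allI impI cmi)
      fix y b assume y: "joint_eigen H (map f is) b y" "y \<noteq> \<zero>\<^bsub>H\<^esub>"
      have "\<exists>z a. z \<noteq> \<zero>\<^bsub>H\<^esub> \<and> joint_eigen H Bs a z \<and> joint_eigen H (map f is) b z"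
      proof (rule joint_eigen_refine[OF Bs _ _ y])
        show "linear_op H C" if "C \<in> set (map f is)" for C
          using that cmi by (auto simp: comm_invols_def invol_def)
        show "commute_on H B C" if "B \<in> set Bs" "C \<in> set (map f is)" for B C
          using that F_comm N unfolding fis by (auto simp: Bs_def)
      qed
      then obtain z a where z: "z \<noteq> \<zero>\<^bsub>H\<^esub>" "joint_eigen H Bs a z" "joint_eigen H (map f is) b z" by blast
      have zc: "z \<in> carrier H" using z(2) by (simp add: joint_eigen_def)
      have at: "a \<in> tuples N" using z(2) by (simp add: joint_eigen_def Bs_def)
      have az: "F m z = of_int (a ! m) \<odot>\<^bsub>H\<^esub> z" if "m < N" for m
        using z(2) that by (simp add: joint_eigen_def Bs_def)
      have "bool_model N cs (\<lambda>m. a ! m)"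
        unfolding bool_model_def
      proof (intro conjI ballI allI impI)
        show "a ! i \<in> {1,-1}" if "i < N" for i using tuples_nth[OF at that] by auto
        fix c assume c: "c \<in> set cs"
        obtain js R where cR: "c = (js, R)" by (cases c)
        have "op_constraint H f (map sub js) R"
        proof -
          have "(map sub js, R) \<in> set ds" using c cR unfolding ds_def by force
          then show ?thesis using mod unfolding op_model_def by blast
        qed
        moreover have "joint_eigen H (map f (map sub js)) (map (\<lambda>m. a ! m) js) z"
          using az zc js[of js R] c cR tuples_nth[OF at]
          by (auto simp: joint_eigen_def tuples_def F_def)
        ultimately show "case c of (is, R) \<Rightarrow> map (\<lambda>m. a ! m) is \<in> snd R"
          using z(1) cR by (auto simp: op_constraint_def)
      qed
      then have prod: "a ! 0 * a ! 1 * a ! 2 * a ! 3 = sg" by (rule snd)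
      have "a ! m = b ! m" if "m < 4" for m
      proof (rule joint_eigen_unique[of "F m" z])
        show "F m z = of_int (a ! m) \<odot>\<^bsub>H\<^esub> z" using az that N by simp
        show "F m z = of_int (b ! m) \<odot>\<^bsub>H\<^esub> z" using z(3) that unfolding fis by (simp add: joint_eigen_def)
      qed (use zc z in auto)
      then have "b ! 0 * b ! 1 * b ! 2 * b ! 3 = sg" using prod by simp
      then show "b \<in> snd (parity4 sg)"
        using z(3) "is"(2) by (simp add: parity4_def joint_eigen_def)
    qed
  qed
qed

definition parity_language :: "brel set" where
  "parity_language = {full2, parity4 1, parity4 (-1)}"

text \<open>The gadgets are added one at a time. Extensions keep the operators of old variables, so
  constraints translated earlier remain satisfied.\<close>

lemma parity_reduction:
  assumes hard: "hard_language A" and wf: "wf_constraints parity_language n ls"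
  obtains n' cs where "n \<le> n'" "wf_constraints (A \<union> {full2}) n' cs"
    "\<And>(H :: 'h hilbert) f. hilbert_space H \<Longrightarrow> op_model H n ls f \<Longrightarrow>
       \<exists>f'. (\<forall>i<n. f' i = f i) \<and> op_model H n' cs f'"
    "\<And>(H :: 'h hilbert) f. hilbert_space H \<Longrightarrow> op_model H n' cs f \<Longrightarrow> op_model H n ls f"
proof -
  have "\<exists>n' cs. n \<le> n' \<and> wf_constraints (A \<union> {full2}) n' cs \<and>
    (\<forall>(H :: 'h hilbert) f. hilbert_space H \<longrightarrow> op_model H n ls f \<longrightarrow>
       (\<exists>f'. (\<forall>i<n. f' i = f i) \<and> op_model H n' cs f')) \<and>
    (\<forall>(H :: 'h hilbert) f. hilbert_space H \<longrightarrow> op_model H n' cs f \<longrightarrow> op_model H n ls f)"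
    using wf
  proof (induction ls)
    case Nil
    show ?case
      by (rule exI[of _ n], rule exI[of _ "[]"]) (auto simp: wf_constraints_def)
  next
    case (Cons c ls)
    obtain "is" R where c: "c = (is, R)" by (cases c)
    have "is": "set is \<subseteq> {..<n}" "length is = fst R" and R: "R \<in> parity_language"
      using Cons.prems c by (auto simp: wf_constraints_def)
    have "wf_constraints parity_language n ls" using Cons.prems by (simp add: wf_constraints_def)
    from Cons.IH[OF this] obtain n1 cs1 where 1: "n \<le> n1" "wf_constraints (A \<union> {full2}) n1 cs1"
      "\<And>(H :: 'h hilbert) f. hilbert_space H \<Longrightarrow> op_model H n ls f \<Longrightarrow> \<exists>f'. (\<forall>i<n. f' i = f i) \<and> op_model H n1 cs1 f'"
      "\<And>(H :: 'h hilbert) f. hilbert_space H \<Longrightarrow> op_model H n1 cs1 f \<Longrightarrow> op_model H n ls f"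
      by blast
    have split: "op_model H n (c # ls) f \<longleftrightarrow> op_constraint H f is R \<and> op_model H n ls f" for H :: "'h hilbert" and f
      by (auto simp: op_model_def c)
    have agree: "op_constraint H f' is R \<longleftrightarrow> op_constraint H f is R" if "\<forall>i<n. f' i = f i"
      for H :: "'h hilbert" and f f'
      using that "is"(1) by (intro op_constraint_cong) auto
    show ?case
    proof (cases "R = full2")
      case True
      show ?thesis
      proof (rule exI[of _ n1], rule exI[of _ "c # cs1"], intro conjI allI impI)
        show "n \<le> n1" by (rule 1)
        show "wf_constraints (A \<union> {full2}) n1 (c # cs1)"
          using 1(1,2) "is" True by (auto simp: wf_constraints_def c)
        have split1: "op_model H n1 (c # cs1) f \<longleftrightarrow> op_constraint H f is R \<and> op_model H n1 cs1 f"
          for H :: "'h hilbert" and f by (auto simp: op_model_def c)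
        show "\<exists>f'. (\<forall>i<n. f' i = f i) \<and> op_model H n1 (c # cs1) f'"
          if "hilbert_space H" "op_model H n (c # ls) f" for H :: "'h hilbert" and f
          using 1(3)[OF that(1), of f] that(2) agree unfolding split split1 by blast
        show "op_model H n (c # ls) f"
          if "hilbert_space H" "op_model H n1 (c # cs1) f" for H :: "'h hilbert" and f
          using 1(4)[OF that(1)] that(2) unfolding split split1 by blast
      qed
    next
      case False
      then obtain sg where sg: "sg \<in> {1,-1}" "R = parity4 sg" using R by (auto simp: parity_language_def)
      have "set is \<subseteq> {..<n1}" "length is = 4" using "is" 1(1) sg by (auto simp: parity4_def)
      from parity_step[OF hard sg(1) this] obtain n2 ds where 2: "n1 \<le> n2" "wf_constraints (A \<union> {full2}) n2 ds"
        "\<And>(H :: 'h hilbert) f. hilbert_space H \<Longrightarrow> \<forall>i<n1. invol H (f i) \<Longrightarrow> op_constraint H f is (parity4 sg) \<Longrightarrow>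
           \<exists>f'. (\<forall>i<n1. f' i = f i) \<and> op_model H n2 ds f'"
        "\<And>(H :: 'h hilbert) f. hilbert_space H \<Longrightarrow> op_model H n2 ds f \<Longrightarrow> op_constraint H f is (parity4 sg)"
        by blast
      show ?thesis
      proof (rule exI[of _ n2], rule exI[of _ "cs1 @ ds"], intro conjI allI impI)
        show "n \<le> n2" using 1 2 by simp
        show "wf_constraints (A \<union> {full2}) n2 (cs1 @ ds)"
          using 1(2) 2(1,2) by (force simp: wf_constraints_def)
        show "\<exists>f'. (\<forall>i<n. f' i = f i) \<and> op_model H n2 (cs1 @ ds) f'"
          if H: "hilbert_space H" and mod: "op_model H n (c # ls) f" for H :: "'h hilbert" and f
        proof -
          obtain f1 where f1: "\<forall>i<n. f1 i = f i" "op_model H n1 cs1 f1"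
            using 1(3)[OF H] mod unfolding split by blast
          have "op_constraint H f1 is (parity4 sg)"
            using mod agree[OF f1(1)] sg unfolding split by simp
          then obtain f2 where f2: "\<forall>i<n1. f2 i = f1 i" "op_model H n2 ds f2"
            using 2(3)[OF H, of f1] f1(2) by (auto simp: op_model_def)
          have "op_model H n1 cs1 f2" using f1(2) f2(1) op_model_cong[OF 1(2), of f1 f2 H] by simp
          then have "op_model H n2 (cs1 @ ds) f2"
            using f2(2) by (auto simp: op_model_def)
          then show ?thesis using f1(1) f2(1) 1(1) by (intro exI[of _ f2]) auto
        qed
        show "op_model H n (c # ls) f"
          if H: "hilbert_space H" and mod: "op_model H n2 (cs1 @ ds) f" for H :: "'h hilbert" and f
        proof -
          have "op_model H n1 cs1 f" "op_model H n2 ds f"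
            using mod 2(1) by (auto simp: op_model_def)
          then show ?thesis unfolding split using 1(4)[OF H] 2(4)[OF H] sg by simp
        qed
      qed
    qed
  qed
  then show thesis using that by blast
qed

section \<open>Commutators from parity constraints\<close>

lemma wf_constraints_append:
  "wf_constraints A n (cs @ ds) \<longleftrightarrow> wf_constraints A n cs \<and> wf_constraints A n ds"
  by (auto simp: wf_constraints_def)

lemma wf_constraints_mono: "wf_constraints A n cs \<Longrightarrow> n \<le> m \<Longrightarrow> wf_constraints A m cs"
  by (fastforce simp: wf_constraints_def)

definition unital :: "('h, 'm) hilbert_scheme \<Rightarrow> (nat \<Rightarrow> 'h \<Rightarrow> 'h) \<Rightarrow> bool" where
  "unital H f \<longleftrightarrow> (\<forall>x\<in>carrier H. f 0 x = x)"

fun square_relation ::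
    "('h, 'm) hilbert_scheme \<Rightarrow> (nat \<Rightarrow> 'h \<Rightarrow> 'h) \<Rightarrow> int \<times> nat \<times> nat \<times> nat \<Rightarrow> bool" where
  "square_relation H f (sg, a, b, q) \<longleftrightarrow>
     (\<forall>x\<in>carrier H. f a (f b (f a (f b x))) = of_int sg \<odot>\<^bsub>H\<^esub> f q x)"

text \<open>The Mermin-Peres magic square with the entries
  \<^item> \<open>a, c, ac\<close>
  \<^item> \<open>d, b, db\<close>
  \<^item> \<open>ad, cb, adcb\<close>

  where \<open>c, d, ac, db, ad, cb, adcb\<close> are the variables \<open>m, \<dots>, m + 6\<close>. The rows and the first two columns have
  product \<open>1\<close>, and the product of the last column is the commutator of \<open>a\<close> and \<open>b\<close>.
  The variable \<open>0\<close> stands for the identity.\<close>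

fun square_gadget :: "int \<times> nat \<times> nat \<times> nat \<Rightarrow> nat \<Rightarrow> vconstraint list" where
  "square_gadget (sg, a, b, q) m =
     [([a, m, m + 2, 0], parity4 1), ([m + 1, b, m + 3, 0], parity4 1),
      ([m + 4, m + 5, m + 6, 0], parity4 1), ([a, m + 1, m + 4, 0], parity4 1),
      ([m, b, m + 5, 0], parity4 1), ([m + 2, m + 3, m + 6, q], parity4 sg)]"

text \<open>The Pauli matrices X and Z on an extra tensor factor; they provide the entries
  \<open>c\<close> and \<open>d\<close> of a magic square whose column product is -1.\<close>

definition ancilla :: "('h, 'm) hilbert_scheme \<Rightarrow> ('h \<Rightarrow> 'h) \<Rightarrow> ('h \<Rightarrow> 'h) \<Rightarrow> bool" where
  "ancilla H U Z \<longleftrightarrow> invol H U \<and> invol H Z \<and> (\<forall>x\<in>carrier H. U (Z x) = (-1) \<odot>\<^bsub>H\<^esub> Z (U x))"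

context hilbert_space
begin

text \<open>With the identity in the last place a parity constraint defines one involution as the
  product of two commuting ones.\<close>

lemma parity_triple_iff:
  assumes "unital H f" "invol H (f 0)"
  shows "op_constraint H f [i, j, k, 0] (parity4 1) \<longleftrightarrow> invol H (f i) \<and> invol H (f j) \<and> invol H (f k) \<and>
    commute_on H (f i) (f j) \<and> (\<forall>x\<in>carrier H. f k x = f i (f j x))" (is "?L \<longleftrightarrow> ?R")
proof
  assume ?L
  then have inv: "invol H (f i)" "invol H (f j)" "invol H (f k)" and comm: "commute_on H (f i) (f j)"
    and prod: "\<And>x. x \<in> carrier H \<Longrightarrow> f i (f j (f k (f 0 x))) = x"
    by (auto simp: op_constraint_parity4 comm_invols_def)
  have "f k x = f i (f j x)" if x: "x \<in> carrier H" for x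
  proof -
    have "f j (f i (f i (f j (f k x)))) = f j (f i x)"
      using prod[OF x] assms(1) x by (simp add: unital_def)
    then show ?thesis
      using commute_onD[OF comm x] x inv[THEN involD(3)] inv[THEN involD(4)] by simp
  qed
  with inv comm show ?R by simp
next
  assume R: ?R
  note inv = R[THEN conjunct1] R[THEN conjunct2, THEN conjunct1]
  note cl = inv[THEN involD(4)] and sq = inv[THEN involD(3)]
  have comm: "\<And>x. x \<in> carrier H \<Longrightarrow> f j (f i x) = f i (f j x)" and fk: "\<And>x. x \<in> carrier H \<Longrightarrow> f k x = f i (f j x)"
    using R by (auto simp: commute_on_def)
  have f0: "\<And>x. x \<in> carrier H \<Longrightarrow> f 0 x = x" using assms by (simp add: unital_def)
  have "comm_invols H [f i, f j, f k, f 0]"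
    using R assms(2) by (auto simp: comm_invols_def commute_on_def f0 fk comm cl sq involD(4))
  then show ?L
    by (simp add: op_constraint_parity4 f0 fk comm cl sq)
qed

lemma square_gadget_sound:
  assumes u: "unital H f" and i0: "invol H (f 0)"
    and con: "\<And>is R. (is, R) \<in> set (square_gadget (sg, a, b, q) m) \<Longrightarrow> op_constraint H f is R"
  shows "square_relation H f (sg, a, b, q)"
proof -
  note t = parity_triple_iff[OF u i0]
  have T: "op_constraint H f [a, m, m + 2, 0] (parity4 1)" "op_constraint H f [m + 1, b, m + 3, 0] (parity4 1)"
      "op_constraint H f [m + 4, m + 5, m + 6, 0] (parity4 1)" "op_constraint H f [a, m + 1, m + 4, 0] (parity4 1)"
      "op_constraint H f [m, b, m + 5, 0] (parity4 1)"
    and L: "op_constraint H f [m + 2, m + 3, m + 6, q] (parity4 sg)"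
    by (auto intro!: con)
  note T' = T[unfolded t commute_on_def]
  have inv: "invol H (f a)" "invol H (f b)" "invol H (f m)" "invol H (f (m + 1))" using T' by auto
  note cl = inv[THEN involD(4)] and sq = inv[THEN involD(3)]
  have comm: "f m (f a x) = f a (f m x)" "f m (f b x) = f b (f m x)"
    "f (m + 1) (f a x) = f a (f (m + 1) x)" "f (m + 1) (f b x) = f b (f (m + 1) x)"
    if "x \<in> carrier H" for x
    using T' that by auto
  have def: "f (m + 2) x = f a (f m x)" "f (m + 3) x = f (m + 1) (f b x)" "f (m + 4) x = f a (f (m + 1) x)"
    "f (m + 5) x = f m (f b x)" if "x \<in> carrier H" for x
    using T' that by auto
  have def6: "f (m + 6) x = f (m + 4) (f (m + 5) x)" if "x \<in> carrier H" for x
    using T' that by auto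
  have prod: "f (m + 2) (f (m + 3) (f (m + 6) (f q x))) = of_int sg \<odot> x" if "x \<in> carrier H" for x
    using L that by (auto simp: op_constraint_parity4)
  have fq: "invol H (f q)" using L by (auto simp: op_constraint_parity4 comm_invols_def)
  have "f a (f b (f a (f b x))) = of_int sg \<odot> f q x" if x: "x \<in> carrier H" for x
  proof -
    have "of_int sg \<odot> f q x = f (m + 2) (f (m + 3) (f (m + 6) (f q (f q x))))"
      using prod[OF involD(4)[OF fq x]] by simp
    also have "f q (f q x) = x" by (rule involD(3)[OF fq x])
    \<comment> \<open>The product is a c d b a d c b. As \<open>c\<close> and \<open>d\<close>
      commute with \<open>a\<close> and \<open>b\<close>, it equals the square of a b times c d d c,
      which is the identity.\<close>
    also have "f (m + 2) (f (m + 3) (f (m + 6) x)) = f a (f b (f a (f b x)))"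
      using x by (simp add: def def6 comm cl sq del: add_2_eq_Suc' One_nat_def add_Suc_right)
    finally show ?thesis by simp
  qed
  then show ?thesis by simp
qed

text \<open>A controlled gate: \<open>U\<close> on the eigenspace of \<open>B\<close> where
  \<open>s\<close> times the eigenvalue is -1, and the identity on the other one.\<close>

definition controlled :: "int \<Rightarrow> ('h \<Rightarrow> 'h) \<Rightarrow> ('h \<Rightarrow> 'h) \<Rightarrow> 'h \<Rightarrow> 'h" where
  "controlled s B U = op_fun H (\<lambda>u. if s * u ! 0 = -1 then u ! 1 else 1) [B, U]"

lemma controlled:
  assumes B: "invol H B" and U: "invol H U" and BU: "commute_on H B U"
  shows "invol H (controlled s B U)"
    and "linear_op H D \<Longrightarrow> commute_on H D B \<Longrightarrow> commute_on H D U \<Longrightarrow> commute_on H D (controlled s B U)"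
    and "z \<in> carrier H \<Longrightarrow> B z = of_int u \<odot> z \<Longrightarrow> controlled s B U z = (if s * u = -1 then U z else z)"
proof -
  define g where "g u = (if s * u ! 0 = -1 then u ! 1 else 1)" for u :: "int list"
  have C: "controlled s B U = op_fun H g [B, U]"
    unfolding controlled_def g_def ..
  have Bs: "comm_invols H [B, U]"
    using B U BU commute_on_sym[OF BU] by (auto simp: comm_invols_def)
  have g: "g a = 1 \<or> g a = -1" if "a \<in> tuples (length [B, U])" for a
    using tuples_nth[of a "length [B, U]" 1] that by (auto simp: g_def)
  show inv: "invol H (controlled s B U)" unfolding C by (rule op_fun_invol[OF Bs g])
  show "commute_on H D (controlled s B U)" if "linear_op H D" "commute_on H D B" "commute_on H D U"
    unfolding C using that by (intro op_fun_commute[OF Bs g]) auto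
  show "controlled s B U z = (if s * u = -1 then U z else z)" if z: "z \<in> carrier H" and Bz: "B z = of_int u \<odot> z"
  proof (rule joint_eigen_induct[OF Bs, where S = "{z \<in> carrier H. B z = of_int u \<odot> z}"
        and Q = "\<lambda>z. controlled s B U z = (if s * u = -1 then U z else z)"])
    note Bl = linear_opD[OF involD(1)[OF B]] and Ul = linear_opD[OF involD(1)[OF U]]
      and Cl = linear_opD[OF involD(1)[OF inv]]
    show "x \<oplus> y \<in> {z \<in> carrier H. B z = of_int u \<odot> z}"
      if "x \<in> {z \<in> carrier H. B z = of_int u \<odot> z}" "y \<in> {z \<in> carrier H. B z = of_int u \<odot> z}" for x y
      using that by (simp add: Bl sm_distr)
    show "a \<odot> x \<in> {z \<in> carrier H. B z = of_int u \<odot> z}"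
      if "x \<in> {z \<in> carrier H. B z = of_int u \<odot> z}" for a x
      using that by (simp add: Bl mult.commute)
    show "Y x \<in> {z \<in> carrier H. B z = of_int u \<odot> z}"
      if "Y \<in> set [B, U]" "x \<in> {z \<in> carrier H. B z = of_int u \<odot> z}" for Y x
    proof -
      have x: "x \<in> carrier H" "B x = of_int u \<odot> x" using that by auto
      have "B (U x) = of_int u \<odot> U x"
        using commute_onD[OF BU x(1)] x Ul(3)[OF x(1)] by simp
      moreover have "B (B x) = of_int u \<odot> B x"
        using x by (simp add: Bl)
      ultimately show ?thesis using that(1) x by (auto simp: Bl(1) Ul(1))
    qed
    show "controlled s B U (x \<oplus> y) = (if s * u = -1 then U (x \<oplus> y) else x \<oplus> y)"
      if "x \<in> {z \<in> carrier H. B z = of_int u \<odot> z}" "y \<in> {z \<in> carrier H. B z = of_int u \<odot> z}"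
        "controlled s B U x = (if s * u = -1 then U x else x)"
        "controlled s B U y = (if s * u = -1 then U y else y)" for x y
      using that by (auto simp: Cl(2) Ul(2))
    show "controlled s B U x = (if s * u = -1 then U x else x)"
      if x: "x \<in> {z \<in> carrier H. B z = of_int u \<odot> z}" and e: "joint_eigen H [B, U] a x" for x a
    proof (cases "x = \<zero>")
      case True
      then show ?thesis by (simp add: linear_op_zero[OF involD(1)[OF inv]] linear_op_zero[OF involD(1)[OF U]])
    next
      case False
      have xc: "x \<in> carrier H" using x by simp
      have ev: "([B, U] ! i) x = of_int (a ! i) \<odot> x" if "i < 2" for i
        using e that by (simp add: joint_eigen_def)
      have "a ! 0 = u"
        using joint_eigen_unique[of B x "a ! 0" u] ev[of 0] x False by simp
      moreover have "U x = of_int (a ! 1) \<odot> x" using ev[of 1] by simp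
      moreover have "controlled s B U x = of_int (g a) \<odot> x"
        unfolding C by (rule op_fun_eigen[OF Bs g e])
      ultimately show ?thesis using xc by (simp add: g_def)
    qed
  qed (use z Bz in auto)
qed

text \<open>Where \<open>q\<close> times the sign is 1, \<open>a\<close> and \<open>b\<close>
  commute and \<open>c\<close>, \<open>d\<close> are the identity. Where it is -1, \<open>a\<close>
  and \<open>b\<close> anticommute and \<open>c\<close>, \<open>d\<close> are the anticommuting
  pair. So \<open>c\<close> and \<open>d\<close> have the same commutator as \<open>a\<close> and
  \<open>b\<close>, as the square requires.\<close>

lemma square_operators:
  assumes sg: "sg \<in> {1, -1}" and inv: "invol H a" "invol H b" "invol H q"
    and sq: "\<And>x. x \<in> carrier H \<Longrightarrow> a (b (a (b x))) = of_int sg \<odot> q x"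
    and anc: "ancilla H U Z"
    and comm: "commute_on H a U" "commute_on H b U" "commute_on H q U"
      "commute_on H a Z" "commute_on H b Z" "commute_on H q Z"
  obtains c d where "invol H c" "invol H d"
    "\<And>x. x \<in> carrier H \<Longrightarrow> c (a x) = a (c x)" "\<And>x. x \<in> carrier H \<Longrightarrow> c (b x) = b (c x)"
    "\<And>x. x \<in> carrier H \<Longrightarrow> d (a x) = a (d x)" "\<And>x. x \<in> carrier H \<Longrightarrow> d (b x) = b (d x)"
    "\<And>x. x \<in> carrier H \<Longrightarrow> c (q x) = q (c x)" "\<And>x. x \<in> carrier H \<Longrightarrow> d (q x) = q (d x)"
    "\<And>x. x \<in> carrier H \<Longrightarrow> a (q x) = q (a x)" "\<And>x. x \<in> carrier H \<Longrightarrow> b (q x) = q (b x)"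
    "\<And>x. x \<in> carrier H \<Longrightarrow> c (d x) = of_int sg \<odot> q (d (c x))"
    "\<And>x. x \<in> carrier H \<Longrightarrow> a (b x) = of_int sg \<odot> q (b (a x))"
proof -
  note cl = inv[THEN involD(4)] and ii = inv[THEN involD(3)]
  note lin = inv[THEN involD(1), THEN linear_opD(3)]
  have s2: "of_int sg * of_int sg = (1::complex)" using sg by auto
  have q: "q x = of_int sg \<odot> a (b (a (b x)))" if "x \<in> carrier H" for x
    using that by (simp add: sq cl s2)
  \<comment> \<open>Since \<open>q\<close> squares to the identity, the fourth power of a b does
    too; hence the squares of a b and of b a coincide, and \<open>q\<close> commutes with
    \<open>a\<close> and \<open>b\<close>.\<close>
  have qq: "a (b (a (b (a (b (a (b x))))))) = x" if "x \<in> carrier H" for x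
    using that sq[of "a (b (a (b x)))"] by (simp add: sq cl lin ii s2)
  have rev: "b (a (b (a x))) = a (b (a (b x)))" if x: "x \<in> carrier H" for x
    using arg_cong[OF qq[OF x], of "\<lambda>y. b (a (b (a y)))"] x by (simp add: cl ii)
  have aq: "a (q x) = q (a x)" if x: "x \<in> carrier H" for x
    using rev[of "a x"] x by (simp add: q cl lin ii)
  have bq: "b (q x) = q (b x)" if x: "x \<in> carrier H" for x
    using rev[of "b x"] rev[of x] x by (simp add: q cl lin ii)
  have ab: "a (b x) = of_int sg \<odot> q (b (a x))" if x: "x \<in> carrier H" for x
    using sq[of "b (a x)"] x by (simp add: cl ii)
  have U: "invol H U" and Z: "invol H Z" and UZ: "\<And>x. x \<in> carrier H \<Longrightarrow> U (Z x) = (-1) \<odot> Z (U x)"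
    using anc by (auto simp: ancilla_def)
  define c where "c = controlled sg q U"
  define d where "d = controlled sg q Z"
  have ci: "invol H c" and di: "invol H d"
    unfolding c_def d_def by (rule controlled(1)[OF inv(3) U comm(3)] controlled(1)[OF inv(3) Z comm(6)])+
  have c_apply: "c z = (if sg * u = -1 then U z else z)" and d_apply: "d z = (if sg * u = -1 then Z z else z)"
    if "z \<in> carrier H" "q z = of_int u \<odot> z" for z u
    unfolding c_def d_def using that
    by (rule controlled(3)[OF inv(3) U comm(3)] controlled(3)[OF inv(3) Z comm(6)])+
  have commq: "commute_on H a q" "commute_on H b q" using aq bq by (auto simp: commute_on_def)
  have cc: "commute_on H a c" "commute_on H b c" "commute_on H q c"
    unfolding c_def using commq comm inv[THEN involD(1)]
    by (auto intro!: controlled(2)[OF inv(3) U comm(3)])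
  have dd: "commute_on H a d" "commute_on H b d" "commute_on H q d"
    unfolding d_def using commq comm inv[THEN involD(1)]
    by (auto intro!: controlled(2)[OF inv(3) Z comm(6)])
  have cd: "c (d x) = of_int sg \<odot> q (d (c x))" if x: "x \<in> carrier H" for x
  proof -
    have eig: "c (d z) = of_int sg \<odot> q (d (c z))"
      if z: "z \<in> carrier H" "q z = of_int u \<odot> z" and u: "u \<in> {1,-1}" for z u
    proof -
      have Xz: "U z \<in> carrier H" "q (U z) = of_int u \<odot> U z" and Zz: "Z z \<in> carrier H" "q (Z z) = of_int u \<odot> Z z"
        using z commute_onD[OF comm(3) z(1)] commute_onD[OF comm(6) z(1)] involD(4)[OF U z(1)] involD(4)[OF Z z(1)]
          linear_opD(3)[OF involD(1)[OF U] z(1)] linear_opD(3)[OF involD(1)[OF Z] z(1)] by auto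
      have ZU: "Z (U z) \<in> carrier H" using involD(4)[OF Z Xz(1)] .
      have qZX: "q (Z (U z)) = of_int u \<odot> Z (U z)"
        using commute_onD[OF comm(6) Xz(1)] Xz linear_opD(3)[OF involD(1)[OF Z] Xz(1)] by simp
      show ?thesis
      proof (cases "sg * u = -1")
        case True
        then have "c (d z) = (-1) \<odot> Z (U z)"
          using c_apply[OF Zz] d_apply[OF z] UZ[OF z(1)] by simp
        moreover have "of_int sg \<odot> q (d (c z)) = (of_int sg * of_int u) \<odot> Z (U z)"
          using c_apply[OF z] d_apply[OF Xz] True qZX ZU by simp
        moreover have "of_int sg * of_int u = (-1 :: complex)"
          using True by (metis of_int_1 of_int_minus of_int_mult)
        ultimately show ?thesis by simp
      next
        case False
        then have "sg * u = 1" using sg u by auto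
        then have "of_int sg * of_int u = (1 :: complex)"
          by (metis of_int_1 of_int_mult)
        then show ?thesis using c_apply[OF z] d_apply[OF z] False z by simp
      qed
    qed
    obtain y z where yz: "y \<in> carrier H" "z \<in> carrier H" "x = y \<oplus> z" "q y = y" "q z = (-1) \<odot> z"
      using eigen_split[OF inv(3) x] by metis
    note al = linear_opD[OF involD(1)[OF ci]] linear_opD[OF involD(1)[OF di]] linear_opD[OF involD(1)[OF inv(3)]]
    have "c (d y) = of_int sg \<odot> q (d (c y))" "c (d z) = of_int sg \<odot> q (d (c z))"
      using eig[of y 1] eig[of z "-1"] yz by auto
    then show ?thesis
      using yz(1,2) unfolding yz(3) by (simp add: al(1,2,4,5,7,8) sm_distr)
  qed
  show thesis
    by (rule that[OF ci di]) (use cc dd in \<open>auto simp: commute_on_def aq bq cd intro: ab\<close>)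
qed

lemma square_gadget_complete:
  assumes sg: "sg \<in> {1, -1}" and u: "unital H f" and inv: "invol H (f 0)" "invol H (f a)" "invol H (f b)" "invol H (f q)"
    and less: "0 < m" "a < m" "b < m" "q < m"
    and sq: "square_relation H f (sg, a, b, q)" and anc: "ancilla H U Z"
    and comm: "commute_on H (f a) U" "commute_on H (f b) U" "commute_on H (f q) U"
      "commute_on H (f a) Z" "commute_on H (f b) Z" "commute_on H (f q) Z"
  shows "\<exists>f'. (\<forall>i<m. f' i = f i) \<and> (\<forall>i. m \<le> i \<longrightarrow> i < m + 7 \<longrightarrow> invol H (f' i)) \<and>
    (\<forall>(is, R)\<in>set (square_gadget (sg, a, b, q) m). op_constraint H f' is R)"
proof -
  define A where "A = f a"
  define B where "B = f b"
  define q' where "q' = f q"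
  have iA: "invol H A" and iB: "invol H B" and iq: "invol H q'" using inv by (auto simp: A_def B_def q'_def)
  have sq': "\<And>x. x \<in> carrier H \<Longrightarrow> A (B (A (B x))) = of_int sg \<odot> q' x"
    using sq by (auto simp: A_def B_def q'_def)
  obtain c d where ci: "invol H c" and di: "invol H d" and
    r: "\<And>x. x \<in> carrier H \<Longrightarrow> c (A x) = A (c x)" "\<And>x. x \<in> carrier H \<Longrightarrow> c (B x) = B (c x)"
    "\<And>x. x \<in> carrier H \<Longrightarrow> d (A x) = A (d x)" "\<And>x. x \<in> carrier H \<Longrightarrow> d (B x) = B (d x)"
    "\<And>x. x \<in> carrier H \<Longrightarrow> c (q' x) = q' (c x)" "\<And>x. x \<in> carrier H \<Longrightarrow> d (q' x) = q' (d x)"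
    "\<And>x. x \<in> carrier H \<Longrightarrow> A (q' x) = q' (A x)" "\<And>x. x \<in> carrier H \<Longrightarrow> B (q' x) = q' (B x)"
    and cd: "\<And>x. x \<in> carrier H \<Longrightarrow> c (d x) = of_int sg \<odot> q' (d (c x))"
    and AB: "\<And>x. x \<in> carrier H \<Longrightarrow> A (B x) = of_int sg \<odot> q' (B (A x))"
    using square_operators[OF sg iA iB iq sq' anc comm[folded A_def B_def q'_def]] by blast
  note invs = iA iB iq ci di
  note cl = invs[THEN involD(4)] and ii = invs[THEN involD(3)]
  note lin = invs[THEN involD(1), THEN linear_opD(3)]
  have s2: "of_int sg * of_int sg = (1::complex)" "of_int sg * (of_int sg * z) = (z::complex)" for z using sg by auto
  note rules = r cd AB cl ii lin s2
  define e where "e x = A (c x)" for x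
  define g where "g x = d (B x)" for x
  define h where "h x = A (d x)" for x
  define k where "k x = c (B x)" for x
  define p where "p x = h (k x)" for x
  have ei: "invol H e" unfolding e_def by (rule invol_comp[OF iA ci]) (simp add: commute_on_def r)
  have gi: "invol H g" unfolding g_def by (rule invol_comp[OF di iB]) (simp add: commute_on_def r)
  have hi: "invol H h" unfolding h_def by (rule invol_comp[OF iA di]) (simp add: commute_on_def r)
  have ki: "invol H k" unfolding k_def by (rule invol_comp[OF ci iB]) (simp add: commute_on_def r)
  \<comment> \<open>Exchanging the two products reverses the order of \<open>a\<close>,
    \<open>b\<close> and that of \<open>c\<close>, \<open>d\<close>; the two equal commutators
    cancel.\<close>
  have hk: "commute_on H h k" by (simp add: commute_on_def h_def k_def rules)
  have pi: "invol H p" unfolding p_def by (rule invol_comp[OF hi ki hk])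
  define f' where "f' v = (if v = m then c else if v = m + 1 then d else if v = m + 2 then e else
    if v = m + 3 then g else if v = m + 4 then h else if v = m + 5 then k else if v = m + 6 then p else f v)" for v
  have f': "f' m = c" "f' (m + 1) = d" "f' (m + 2) = e" "f' (m + 3) = g" "f' (m + 4) = h" "f' (m + 5) = k" "f' (m + 6) = p"
    by (simp_all add: f'_def)
  have old: "f' i = f i" if "i < m" for i using that by (simp add: f'_def)
  have f'o: "f' a = A" "f' b = B" "f' q = q'" using less by (simp_all add: old A_def B_def q'_def)
  have u': "unital H f'" "invol H (f' 0)" using u inv less by (simp_all add: unital_def old)
  note t = parity_triple_iff[OF u']
  have 1: "op_constraint H f' [a, m, m + 2, 0] (parity4 1)"
    unfolding t f' f'o using iA ci ei by (simp add: commute_on_def e_def r)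
  have 2: "op_constraint H f' [m + 1, b, m + 3, 0] (parity4 1)"
    unfolding t f' f'o using iB di gi by (simp add: commute_on_def g_def r)
  have 3: "op_constraint H f' [m + 4, m + 5, m + 6, 0] (parity4 1)"
    unfolding t f' f'o using hi ki pi hk by (simp add: p_def)
  have 4: "op_constraint H f' [a, m + 1, m + 4, 0] (parity4 1)"
    unfolding t f' f'o using iA di hi by (simp add: commute_on_def h_def r)
  have 5: "op_constraint H f' [m, b, m + 5, 0] (parity4 1)"
    unfolding t f' f'o using iB ci ki by (simp add: commute_on_def k_def r)
  have 6: "op_constraint H f' [m + 2, m + 3, m + 6, q] (parity4 sg)"
    unfolding op_constraint_parity4 f' f'o
  proof
    show "comm_invols H [e, g, p, q']"
      using ei gi pi iq by (simp add: comm_invols_def commute_on_def e_def g_def p_def h_def k_def rules)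
    show "\<forall>x\<in>carrier H. e (g (p (q' x))) = of_int sg \<odot> x"
      by (simp add: e_def g_def p_def h_def k_def rules)
  qed
  have "\<forall>i. m \<le> i \<longrightarrow> i < m + 7 \<longrightarrow> invol H (f' i)"
  proof (intro allI impI)
    fix i assume "m \<le> i" "i < m + 7"
    then have "i = m \<or> i = m + 1 \<or> i = m + 2 \<or> i = m + 3 \<or> i = m + 4 \<or> i = m + 5 \<or> i = m + 6" by auto
    then show "invol H (f' i)" using f' ci di ei gi hi ki pi by auto
  qed
  moreover have "\<forall>(is, R)\<in>set (square_gadget (sg, a, b, q) m). op_constraint H f' is R"
    unfolding square_gadget.simps using 1 2 3 4 5 6 by (simp del: add_2_eq_Suc' One_nat_def add_Suc_right)
  ultimately show ?thesis using old by blast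
qed

end

lemma square_gadget_wf:
  assumes "0 < m" "a < m" "b < m" "q < m" "sg \<in> {1,-1}"
  shows "wf_constraints parity_language (m + 7) (square_gadget (sg, a, b, q) m)"
  using assms by (auto simp: wf_constraints_def parity_language_def parity4_def)

text \<open>Each square involves only the first \<open>n\<close> variables besides its own fresh
  ones. So commutation with the ancilla is demanded of the first \<open>n\<close> operators only,
  and one ancilla serves all squares.\<close>

lemma squares_reduction:
  assumes n: "0 < n"
    and sqs: "\<And>sg a b q. (sg, a, b, q) \<in> set sqs \<Longrightarrow> sg \<in> {1,-1} \<and> a < n \<and> b < n \<and> q < n"
  obtains n' ls where "n \<le> n'" "wf_constraints parity_language n' ls"
    "\<And>(H :: 'h hilbert) f U Z. hilbert_space H \<Longrightarrow> \<forall>i<n. invol H (f i) \<Longrightarrow> unital H f \<Longrightarrow> ancilla H U Z \<Longrightarrow>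
       \<forall>i<n. commute_on H (f i) U \<and> commute_on H (f i) Z \<Longrightarrow> \<forall>s\<in>set sqs. square_relation H f s \<Longrightarrow>
       \<exists>f'. (\<forall>i<n. f' i = f i) \<and> op_model H n' ls f'"
    "\<And>(H :: 'h hilbert) f. hilbert_space H \<Longrightarrow> op_model H n' ls f \<Longrightarrow> unital H f \<Longrightarrow>
       \<forall>s\<in>set sqs. square_relation H f s"
proof -
  have "\<exists>n' ls. n \<le> n' \<and> wf_constraints parity_language n' ls \<and>
    (\<forall>(H :: 'h hilbert) f U Z. hilbert_space H \<longrightarrow> (\<forall>i<n. invol H (f i)) \<longrightarrow> unital H f \<longrightarrow> ancilla H U Z \<longrightarrow>
       (\<forall>i<n. commute_on H (f i) U \<and> commute_on H (f i) Z) \<longrightarrow> (\<forall>s\<in>set sqs. square_relation H f s) \<longrightarrow>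
       (\<exists>f'. (\<forall>i<n. f' i = f i) \<and> op_model H n' ls f')) \<and>
    (\<forall>(H :: 'h hilbert) f. hilbert_space H \<longrightarrow> op_model H n' ls f \<longrightarrow> unital H f \<longrightarrow>
       (\<forall>s\<in>set sqs. square_relation H f s))"
    using sqs
  proof (induction sqs)
    case Nil
    show ?case
      by (rule exI[of _ n], rule exI[of _ "[]"]) (auto simp: wf_constraints_def op_model_def)
  next
    case (Cons s sqs)
    obtain sg a b q where s: "s = (sg, a, b, q)" by (cases s)
    have sg: "sg \<in> {1,-1}" and less: "a < n" "b < n" "q < n" using Cons.prems s by auto
    have prems: "sg \<in> {1,-1} \<and> a < n \<and> b < n \<and> q < n" if "(sg, a, b, q) \<in> set sqs" for sg a b q
      by (rule Cons.prems) (use that in simp)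
    from Cons.IH[OF prems] obtain n1 ls1 where 1: "n \<le> n1" "wf_constraints parity_language n1 ls1"
      "\<And>(H :: 'h hilbert) f U Z. hilbert_space H \<Longrightarrow> \<forall>i<n. invol H (f i) \<Longrightarrow> unital H f \<Longrightarrow> ancilla H U Z \<Longrightarrow>
         \<forall>i<n. commute_on H (f i) U \<and> commute_on H (f i) Z \<Longrightarrow> \<forall>s\<in>set sqs. square_relation H f s \<Longrightarrow>
         \<exists>f'. (\<forall>i<n. f' i = f i) \<and> op_model H n1 ls1 f'"
      "\<And>(H :: 'h hilbert) f. hilbert_space H \<Longrightarrow> op_model H n1 ls1 f \<Longrightarrow> unital H f \<Longrightarrow>
         \<forall>s\<in>set sqs. square_relation H f s"
      by blast
    have less1: "0 < n1" "a < n1" "b < n1" "q < n1" using less n 1(1) by auto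
    show ?case
    proof (rule exI[of _ "n1 + 7"], rule exI[of _ "ls1 @ square_gadget s n1"], intro conjI allI impI)
      show "n \<le> n1 + 7" using 1(1) by simp
      show "wf_constraints parity_language (n1 + 7) (ls1 @ square_gadget s n1)"
        unfolding wf_constraints_append s
        using wf_constraints_mono[OF 1(2)] square_gadget_wf[OF less1 sg] by (simp del: square_gadget.simps)
    next
      fix H :: "'h hilbert" and f U Z
      assume H: "hilbert_space H" and inv: "\<forall>i<n. invol H (f i)" and u: "unital H f" and anc: "ancilla H U Z"
        and comm: "\<forall>i<n. commute_on H (f i) U \<and> commute_on H (f i) Z"
        and sq: "\<forall>t\<in>set (s # sqs). square_relation H f t"
      interpret hilbert_space H by (rule H)
      obtain f1 where f1: "\<forall>i<n. f1 i = f i" "op_model H n1 ls1 f1"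
        using 1(3)[OF H inv u anc comm] sq by auto
      have eq: "f1 0 = f 0" "f1 a = f a" "f1 b = f b" "f1 q = f q" using f1(1) less n by auto
      obtain f2 where f2: "\<forall>i<n1. f2 i = f1 i" "\<forall>i. n1 \<le> i \<longrightarrow> i < n1 + 7 \<longrightarrow> invol H (f2 i)"
        "\<forall>(is, R)\<in>set (square_gadget (sg, a, b, q) n1). op_constraint H f2 is R"
        using square_gadget_complete[OF sg, of f1 a b q n1 U Z] less less1 u inv comm n sq anc
        by (auto simp: eq unital_def s)
      have "op_model H n1 ls1 f2" using f1(2) f2(1) op_model_cong[OF 1(2), of f1 f2 H] by simp
      then have "op_model H (n1 + 7) (ls1 @ square_gadget s n1) f2"
        using f2(2,3) unfolding op_model_append s
        by (auto simp: op_model_def not_less[symmetric] simp del: square_gadget.simps)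
      then show "\<exists>f'. (\<forall>i<n. f' i = f i) \<and> op_model H (n1 + 7) (ls1 @ square_gadget s n1) f'"
        using f1(1) f2(1) 1(1) by (intro exI[of _ f2]) auto
    next
      fix H :: "'h hilbert" and f
      assume H: "hilbert_space H" and mod: "op_model H (n1 + 7) (ls1 @ square_gadget s n1) f" and u: "unital H f"
      interpret hilbert_space H by (rule H)
      have "op_model H n1 ls1 f" using mod by (auto simp: op_model_def)
      then have "\<forall>s\<in>set sqs. square_relation H f s" by (rule 1(4)[OF H _ u])
      moreover have "square_relation H f s"
        unfolding s
      proof (rule square_gadget_sound[OF u])
        show "invol H (f 0)" using mod by (simp add: op_model_def)
        show "op_constraint H f is R" if "(is, R) \<in> set (square_gadget (sg, a, b, q) n1)" for "is" R
          using mod that unfolding op_model_def s by auto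
      qed
      ultimately show "\<forall>t\<in>set (s # sqs). square_relation H f t" by simp
    qed
  qed
  then show thesis using that by blast
qed

definition unit_constraints :: "nat \<Rightarrow> vconstraint list" where
  "unit_constraints n = map (\<lambda>i. ([0, i], full2)) [0..<n]"

text \<open>Multiplying all operators by the one assigned to the variable \<open>0\<close>, which commutes with
  all of them, turns the latter into the identity. Parity constraints are not affected, since the
  arity is even.\<close>

lemma (in hilbert_space) unitalize:
  assumes n: "0 < n" and wf: "wf_constraints parity_language n ls"
    and mod: "op_model H n (ls @ unit_constraints n) f"
  shows "\<exists>g. unital H g \<and> op_model H n ls g"
proof -
  have inv: "invol H (f i)" if "i < n" for i using mod that by (simp add: op_model_def)
  have comm: "commute_on H (f 0) (f i)" if "i < n" for i
  proof -
    have "([0, i], full2) \<in> set (ls @ unit_constraints n)" using that by (auto simp: unit_constraints_def)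
    then have "op_constraint H f [0, i] full2" using mod unfolding op_model_def by blast
    then show ?thesis by (simp add: op_constraint_full2)
  qed
  define g where "g i x = f 0 (f i x)" for i x
  note cl = involD(4)[OF inv] and ii = involD(3)[OF inv]
  have c0: "f i (f 0 x) = f 0 (f i x)" if "i < n" "x \<in> carrier H" for i x
    using commute_onD[OF comm[OF that(1)] that(2)] by simp
  have ginv: "invol H (g i)" if "i < n" for i
    unfolding g_def by (rule invol_comp[OF inv[OF n] inv[OF that] comm[OF that]])
  have gcomm: "commute_on H (g i) (g j)" if "i < n" "j < n" "commute_on H (f i) (f j)" for i j
    using that n commute_onD[OF that(3)] by (simp add: commute_on_def g_def cl ii c0)
  have con: "op_constraint H g is R" if c: "(is, R) \<in> set ls" for "is" R
  proof -
    have "is": "set is \<subseteq> {..<n}" "length is = fst R" and R: "R \<in> parity_language"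
      using wf c by (auto simp: wf_constraints_def)
    have f: "op_constraint H f is R" using mod c by (auto simp: op_model_def)
    show ?thesis
    proof (cases "R = full2")
      case True
      then obtain i j where ij: "is = [i, j]"
        using "is"(2) by (auto simp: full2_def length_Suc_conv numeral_2_eq_2)
      then show ?thesis using f True "is"(1) ginv gcomm by (simp add: op_constraint_full2)
    next
      case False
      then obtain sg where sg: "R = parity4 sg" using R by (auto simp: parity_language_def)
      then obtain i j k l where ij: "is = [i, j, k, l]"
        using "is"(2) by (auto simp: parity4_def length_Suc_conv numeral_eq_Suc)
      have less: "i < n" "j < n" "k < n" "l < n" using "is"(1) ij by auto
      have F: "comm_invols H [f i, f j, f k, f l]" "\<And>x. x \<in> carrier H \<Longrightarrow> f i (f j (f k (f l x))) = of_int sg \<odot> x"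
        using f unfolding sg ij op_constraint_parity4 by auto
      have "comm_invols H [g i, g j, g k, g l]"
        using F(1) less ginv gcomm by (auto simp: comm_invols_def)
      moreover have "g i (g j (g k (g l x))) = of_int sg \<odot> x" if "x \<in> carrier H" for x
        using that n less F(2)[OF that] by (simp add: g_def cl ii c0)
      ultimately show ?thesis unfolding sg ij op_constraint_parity4 by simp
    qed
  qed
  have "unital H g" using n by (simp add: unital_def g_def ii)
  moreover have "op_model H n ls g" using ginv con by (auto simp: op_model_def)
  ultimately show ?thesis by blast
qed

text \<open>A finite presentation by parities \<open>ls\<close> and squares \<open>sqs\<close>
  becomes an instance over the language. Models of the presentation must leave room for the ancilla;
  in the other direction a model is first normalised so that variable 0 is the identity.\<close>

lemma group_reduction:
  assumes hard: "hard_language A" and n: "0 < n" and wf: "wf_constraints parity_language n ls"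
    and sqs: "\<And>sg a b q. (sg, a, b, q) \<in> set sqs \<Longrightarrow> sg \<in> {1,-1} \<and> a < n \<and> b < n \<and> q < n"
  obtains n' cs where "wf_constraints (A \<union> {full2}) n' cs"
    "\<And>(H :: 'h hilbert) f U Z. hilbert_space H \<Longrightarrow> op_model H n ls f \<Longrightarrow> unital H f \<Longrightarrow> ancilla H U Z \<Longrightarrow>
       \<forall>i<n. commute_on H (f i) U \<and> commute_on H (f i) Z \<Longrightarrow> \<forall>s\<in>set sqs. square_relation H f s \<Longrightarrow>
       \<exists>f'. op_model H n' cs f'"
    "\<And>(H :: 'h hilbert) f. hilbert_space H \<Longrightarrow> op_model H n' cs f \<Longrightarrow>
       \<exists>g. unital H g \<and> op_model H n ls g \<and> (\<forall>s\<in>set sqs. square_relation H g s)"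
proof (rule squares_reduction[where ?'h = 'h, OF n sqs])
  fix n1 ls1
  assume 1: "n \<le> n1" "wf_constraints parity_language n1 ls1"
    "\<And>(H :: 'h hilbert) f U Z. hilbert_space H \<Longrightarrow> \<forall>i<n. invol H (f i) \<Longrightarrow> unital H f \<Longrightarrow> ancilla H U Z \<Longrightarrow>
       \<forall>i<n. commute_on H (f i) U \<and> commute_on H (f i) Z \<Longrightarrow> \<forall>s\<in>set sqs. square_relation H f s \<Longrightarrow>
       \<exists>f'. (\<forall>i<n. f' i = f i) \<and> op_model H n1 ls1 f'"
    "\<And>(H :: 'h hilbert) f. hilbert_space H \<Longrightarrow> op_model H n1 ls1 f \<Longrightarrow> unital H f \<Longrightarrow>
       \<forall>s\<in>set sqs. square_relation H f s"
  have n1: "0 < n1" using n 1(1) by simp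
  have wf1: "wf_constraints parity_language n1 (ls @ ls1)"
    unfolding wf_constraints_append using wf_constraints_mono[OF wf 1(1)] 1(2) by simp
  moreover have "wf_constraints parity_language n1 (unit_constraints n1)"
    using n1 by (auto simp: wf_constraints_def unit_constraints_def parity_language_def full2_def)
  ultimately have wf2: "wf_constraints parity_language n1 ((ls @ ls1) @ unit_constraints n1)"
    unfolding wf_constraints_append by simp
  show thesis
  proof (rule parity_reduction[where ?'h = 'h, OF hard wf2])
    fix n2 cs
    assume 2: "n1 \<le> n2" "wf_constraints (A \<union> {full2}) n2 cs"
    "\<And>(H :: 'h hilbert) f. hilbert_space H \<Longrightarrow> op_model H n1 ((ls @ ls1) @ unit_constraints n1) f \<Longrightarrow>
       \<exists>f'. (\<forall>i<n1. f' i = f i) \<and> op_model H n2 cs f'"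
    "\<And>(H :: 'h hilbert) f. hilbert_space H \<Longrightarrow> op_model H n2 cs f \<Longrightarrow> op_model H n1 ((ls @ ls1) @ unit_constraints n1) f"
    show thesis
    proof (rule that[OF 2(2)])
      fix H :: "'h hilbert" and f U Z
      assume H: "hilbert_space H" and mod: "op_model H n ls f" and u: "unital H f" and anc: "ancilla H U Z"
        and comm: "\<forall>i<n. commute_on H (f i) U \<and> commute_on H (f i) Z" and sq: "\<forall>s\<in>set sqs. square_relation H f s"
      interpret hilbert_space H by (rule H)
      have "\<forall>i<n. invol H (f i)" using mod by (simp add: op_model_def)
      from 1(3)[OF H this u anc comm sq] obtain f1 where f1: "\<forall>i<n. f1 i = f i" "op_model H n1 ls1 f1" by blast
      have "op_model H n ls f1" using mod op_model_cong[OF wf, of f f1 H] f1(1) by simp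
      moreover have u1: "f1 0 x = x" if "x \<in> carrier H" for x using u f1(1) n that by (simp add: unital_def)
      have inv1: "invol H (f1 i)" if "i < n1" for i using f1(2) that by (simp add: op_model_def)
      have "op_model H n1 (unit_constraints n1) f1"
        using inv1 n1 involD(4)[OF inv1]
        by (auto simp: op_model_def unit_constraints_def op_constraint_full2 commute_on_def u1)
      ultimately have "op_model H n1 ((ls @ ls1) @ unit_constraints n1) f1"
        using f1(2) by (auto simp: op_model_def)
      then show "\<exists>f'. op_model H n2 cs f'" using 2(3)[OF H] by blast
    next
      fix H :: "'h hilbert" and f
      assume H: "hilbert_space H" and mod: "op_model H n2 cs f"
      interpret hilbert_space H by (rule H)
      obtain g where g: "unital H g" "op_model H n1 (ls @ ls1) g"
        using unitalize[OF n1 wf1 2(4)[OF H mod]] by blast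
      then have "op_model H n1 ls1 g" "op_model H n ls g" using 1(1) by (auto simp: op_model_def)
      then show "\<exists>g. unital H g \<and> op_model H n ls g \<and> (\<forall>s\<in>set sqs. square_relation H g s)"
        using g(1) 1(4)[OF H _ g(1)] by blast
    qed
  qed
qed

section \<open>Square summable functions as a Hilbert space\<close>

definition sq_summable :: "'i set \<Rightarrow> ('i \<Rightarrow> complex) set" where
  "sq_summable D = {f. (\<forall>i. i \<notin> D \<longrightarrow> f i = 0) \<and> (\<lambda>i. (cmod (f i))\<^sup>2) summable_on D}"

definition sq_norm :: "'i set \<Rightarrow> ('i \<Rightarrow> complex) \<Rightarrow> real" where
  "sq_norm D f = sqrt (\<Sum>\<^sub>\<infinity>i\<in>D. (cmod (f i))\<^sup>2)"

text \<open>The Hilbert space is carried over to the type \<open>'h\<close> by an injection \<open>e\<close>.\<close>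

definition ell2 :: "(('i \<Rightarrow> complex) \<Rightarrow> 'h) \<Rightarrow> 'i set \<Rightarrow> 'h hilbert" where
  "ell2 e D = \<lparr>carrier = e ` sq_summable D, monoid.mult = undefined, one = undefined,
     zero = e (\<lambda>_. 0), add = (\<lambda>x y. e (\<lambda>i. inv_into UNIV e x i + inv_into UNIV e y i)),
     module.smult = (\<lambda>a x. e (\<lambda>i. a * inv_into UNIV e x i)),
     cinner = (\<lambda>x y. \<Sum>\<^sub>\<infinity>i\<in>D. inv_into UNIV e x i * cnj (inv_into UNIV e y i))\<rparr>"

section \<open>Norm estimates and completeness of square summable functions\<close>

lemma sq_norm_nonneg [simp]: "0 \<le> sq_norm D f"
  by (simp add: sq_norm_def infsum_nonneg)

lemma L2_set_le_sq_norm: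
  assumes "f \<in> sq_summable D" "finite F" "F \<subseteq> D"
  shows "L2_set (\<lambda>i. cmod (f i)) F \<le> sq_norm D f"
  unfolding L2_set_def sq_norm_def using assms
  by (intro real_sqrt_le_mono finite_sum_le_infsum) (auto simp: sq_summable_def)

text \<open>A uniform bound on finite partial sums gives summability and the same bound on the norm.
  The triangle inequality and completeness are thereby reduced to finite sums.\<close>

lemma sq_summable_bounded:
  assumes supp: "\<And>i. i \<notin> D \<Longrightarrow> f i = 0"
    and bound: "\<And>F. finite F \<Longrightarrow> F \<subseteq> D \<Longrightarrow> L2_set (\<lambda>i. cmod (f i)) F \<le> C"
  shows "f \<in> sq_summable D" "sq_norm D f \<le> C"
proof -
  have C: "0 \<le> C" using bound[of "{}"] by simp
  have le: "(\<Sum>i\<in>F. (cmod (f i))\<^sup>2) \<le> C\<^sup>2" if "finite F" "F \<subseteq> D" for F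
  proof -
    have "sqrt (\<Sum>i\<in>F. (cmod (f i))\<^sup>2) \<le> C" using bound[OF that] by (simp add: L2_set_def)
    then show ?thesis by (simp add: sqrt_le_D)
  qed
  have s: "(\<lambda>i. (cmod (f i))\<^sup>2) summable_on D"
    by (rule nonneg_bdd_above_summable_on) (auto intro!: bdd_aboveI2[of _ _ "C\<^sup>2"] le)
  then show "f \<in> sq_summable D" using supp by (simp add: sq_summable_def)
  have "(\<Sum>\<^sub>\<infinity>i\<in>D. (cmod (f i))\<^sup>2) \<le> C\<^sup>2"
    by (rule infsum_le_finite_sums[OF s le])
  then show "sq_norm D f \<le> C"
    unfolding sq_norm_def using C by (simp add: real_le_lsqrt infsum_nonneg)
qed

lemma sq_summable_add:
  assumes "f \<in> sq_summable D" "g \<in> sq_summable D"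
  shows "(\<lambda>i. f i + g i) \<in> sq_summable D" "sq_norm D (\<lambda>i. f i + g i) \<le> sq_norm D f + sq_norm D g"
proof -
  have supp: "f i + g i = 0" if "i \<notin> D" for i using assms that by (simp add: sq_summable_def)
  have le: "L2_set (\<lambda>i. cmod (f i + g i)) F \<le> sq_norm D f + sq_norm D g" if F: "finite F" "F \<subseteq> D" for F
  proof -
    have "L2_set (\<lambda>i. cmod (f i + g i)) F \<le> L2_set (\<lambda>i. cmod (f i) + cmod (g i)) F"
      by (intro L2_set_mono norm_triangle_ineq) auto
    also have "\<dots> \<le> L2_set (\<lambda>i. cmod (f i)) F + L2_set (\<lambda>i. cmod (g i)) F"
      by (rule L2_set_triangle_ineq)
    also have "\<dots> \<le> sq_norm D f + sq_norm D g"
      using L2_set_le_sq_norm[OF assms(1) F] L2_set_le_sq_norm[OF assms(2) F] by simp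
    finally show ?thesis .
  qed
  show "(\<lambda>i. f i + g i) \<in> sq_summable D" by (rule sq_summable_bounded(1)[OF supp le])
  show "sq_norm D (\<lambda>i. f i + g i) \<le> sq_norm D f + sq_norm D g" by (rule sq_summable_bounded(2)[OF supp le])
qed

lemma sq_summable_cmult: "f \<in> sq_summable D \<Longrightarrow> (\<lambda>i. a * f i) \<in> sq_summable D"
  by (auto simp: sq_summable_def norm_mult power_mult_distrib intro: summable_on_cmult_right)

lemma sq_norm_uminus: "sq_norm D (\<lambda>i. g i - f i) = sq_norm D (\<lambda>i. f i - g i)"
  by (simp add: sq_norm_def norm_minus_commute)

lemma sq_summable_diff:
  assumes "f \<in> sq_summable D" "g \<in> sq_summable D"
  shows "(\<lambda>i. f i - g i) \<in> sq_summable D"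
  using sq_summable_add(1)[OF assms(1) sq_summable_cmult[OF assms(2), of "-1"]] by simp

lemma sq_summable_zero: "(\<lambda>_. 0) \<in> sq_summable D"
  by (simp add: sq_summable_def)

lemma cmod_le_sq_norm:
  assumes "f \<in> sq_summable D"
  shows "cmod (f i) \<le> sq_norm D f"
proof (cases "i \<in> D")
  case True
  then show ?thesis using L2_set_le_sq_norm[OF assms, of "{i}"] by simp
next
  case False
  then show ?thesis using assms by (simp add: sq_summable_def)
qed

lemma inner_summable:
  assumes "f \<in> sq_summable D" "g \<in> sq_summable D"
  shows "(\<lambda>i. f i * cnj (g i)) summable_on D"
proof -
  show ?thesis
    by (rule abs_summable_summable[OF abs_summable_product])
      (use assms in \<open>auto simp: sq_summable_def norm_mult power2_eq_square\<close>)
qed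

text \<open>The limit exists pointwise because single values are bounded by the norm.\<close>

lemma sq_summable_complete:
  fixes f :: "nat \<Rightarrow> 'i \<Rightarrow> complex"
  assumes f: "\<And>n. f n \<in> sq_summable D"
    and cauchy: "\<And>\<epsilon>. \<epsilon> > 0 \<Longrightarrow> \<exists>N. \<forall>m n. N \<le> m \<longrightarrow> N \<le> n \<longrightarrow> sq_norm D (\<lambda>i. f m i - f n i) < \<epsilon>"
  obtains g where "g \<in> sq_summable D"
    "\<And>\<epsilon>. \<epsilon> > 0 \<Longrightarrow> \<exists>N. \<forall>n\<ge>N. sq_norm D (\<lambda>i. f n i - g i) < \<epsilon>"
proof -
  have diff: "(\<lambda>i. f m i - f n i) \<in> sq_summable D" for m n by (rule sq_summable_diff[OF f f])
  have "Cauchy (\<lambda>n. f n i)" for i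
  proof (rule metric_CauchyI)
    fix \<epsilon> :: real assume "\<epsilon> > 0"
    then obtain N where N: "\<And>m n. N \<le> m \<Longrightarrow> N \<le> n \<Longrightarrow> sq_norm D (\<lambda>i. f m i - f n i) < \<epsilon>"
      using cauchy by blast
    have "dist (f m i) (f n i) < \<epsilon>" if "m \<ge> N" "n \<ge> N" for m n
      using cmod_le_sq_norm[OF diff[of m n], of i] N[OF that] by (simp add: dist_norm)
    then show "\<exists>M. \<forall>m\<ge>M. \<forall>n\<ge>M. dist (f m i) (f n i) < \<epsilon>" by blast
  qed
  then have "\<exists>l. (\<lambda>n. f n i) \<longlonglongrightarrow> l" for i
    using Cauchy_convergent convergent_def by blast
  then obtain g where g: "\<And>i. (\<lambda>n. f n i) \<longlonglongrightarrow> g i" by metis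
  have g0: "g i = 0" if "i \<notin> D" for i
  proof -
    have "f n i = 0" for n using f[of n] that by (simp add: sq_summable_def)
    then show ?thesis using g[of i] LIMSEQ_unique[OF _ tendsto_const[of 0]] by simp
  qed
  \<comment> \<open>On a finite set the Cauchy estimate passes to the pointwise limit in
    \<open>n\<close>; the bound is independent of that set.\<close>
  have near: "(\<lambda>i. f m i - g i) \<in> sq_summable D \<and> sq_norm D (\<lambda>i. f m i - g i) \<le> \<epsilon>"
    if N: "\<forall>m n. N \<le> m \<longrightarrow> N \<le> n \<longrightarrow> sq_norm D (\<lambda>i. f m i - f n i) < \<epsilon>" and m: "m \<ge> N" for m N \<epsilon>
  proof -
    have supp: "f m i - g i = 0" if "i \<notin> D" for i
      using f[of m] that g0 by (simp add: sq_summable_def)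
    have le: "L2_set (\<lambda>i. cmod (f m i - g i)) F \<le> \<epsilon>" if F: "finite F" "F \<subseteq> D" for F
    proof (rule LIMSEQ_le_const2)
      show "(\<lambda>n. L2_set (\<lambda>i. cmod (f m i - f n i)) F) \<longlonglongrightarrow> L2_set (\<lambda>i. cmod (f m i - g i)) F"
        unfolding L2_set_def by (intro tendsto_intros g)
      show "\<exists>N. \<forall>n\<ge>N. L2_set (\<lambda>i. cmod (f m i - f n i)) F \<le> \<epsilon>"
        using L2_set_le_sq_norm[OF diff F] N m by (meson le_less_trans less_imp_le)
    qed
    show ?thesis using sq_summable_bounded[OF supp le] by blast
  qed
  obtain N1 where N1: "\<forall>m n. N1 \<le> m \<longrightarrow> N1 \<le> n \<longrightarrow> sq_norm D (\<lambda>i. f m i - f n i) < 1"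
    using cauchy[of 1] by auto
  have "(\<lambda>i. f N1 i - (f N1 i - g i)) \<in> sq_summable D"
    using sq_summable_diff[OF f near[OF N1, THEN conjunct1]] by blast
  then have gD: "g \<in> sq_summable D" by simp
  moreover have "\<exists>N. \<forall>n\<ge>N. sq_norm D (\<lambda>i. f n i - g i) < \<epsilon>" if eps: "\<epsilon> > 0" for \<epsilon>
  proof -
    obtain N where "\<forall>m n. N \<le> m \<longrightarrow> N \<le> n \<longrightarrow> sq_norm D (\<lambda>i. f m i - f n i) < \<epsilon> / 2"
      using cauchy[of "\<epsilon> / 2"] eps by auto
    from near[OF this] have "\<forall>n\<ge>N. sq_norm D (\<lambda>i. f n i - g i) < \<epsilon>" using eps by force
    then show ?thesis by blast
  qed
  ultimately show thesis using that by blast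
qed

section \<open>The Hilbert space on the image of the injection\<close>

context
  fixes e :: "('i \<Rightarrow> complex) \<Rightarrow> 'h" and D :: "'i set"
  assumes e: "inj e"
begin

lemma inv_e [simp]: "inv_into UNIV e (e f) = f"
  by (rule inv_f_f[OF e])

lemma e_eq_iff [simp]: "e f = e g \<longleftrightarrow> f = g"
  using e by (auto dest: injD)

lemma ell2_simps [simp]:
  "carrier (ell2 e D) = e ` sq_summable D"
  "\<zero>\<^bsub>ell2 e D\<^esub> = e (\<lambda>_. 0)"
  "e f \<oplus>\<^bsub>ell2 e D\<^esub> e g = e (\<lambda>i. f i + g i)"
  "a \<odot>\<^bsub>ell2 e D\<^esub> e f = e (\<lambda>i. a * f i)"
  "cinner (ell2 e D) (e f) (e g) = (\<Sum>\<^sub>\<infinity>i\<in>D. f i * cnj (g i))"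
  by (simp_all add: ell2_def)

lemma ell2_abelian_group: "abelian_group (ell2 e D)"
proof (rule abelian_groupI)
  show "\<exists>y\<in>carrier (ell2 e D). y \<oplus>\<^bsub>ell2 e D\<^esub> x = \<zero>\<^bsub>ell2 e D\<^esub>" if x: "x \<in> carrier (ell2 e D)" for x
  proof -
    obtain f where f: "f \<in> sq_summable D" "x = e f" using x by auto
    show ?thesis
      by (rule bexI[of _ "e (\<lambda>i. - 1 * f i)"]) (use f sq_summable_cmult[of f D "-1"] in auto)
  qed
qed (auto simp: sq_summable_add sq_summable_zero add_ac)

lemma ell2_module: "Module.module (ring_of_type_algebra :: complex ring) (ell2 e D)"
proof (rule moduleI)
  show "cring (ring_of_type_algebra :: complex ring)" by (rule cring_from_type_algebra)
  show "abelian_group (ell2 e D)" by (rule ell2_abelian_group)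
qed (auto simp: ring_of_type_algebra_def sq_summable_cmult algebra_simps)

lemma ell2_cinner_self:
  assumes "f \<in> sq_summable D"
  shows "Re (cinner (ell2 e D) (e f) (e f)) = (\<Sum>\<^sub>\<infinity>i\<in>D. (cmod (f i))\<^sup>2)"
  unfolding ell2_simps infsum_Re[OF inner_summable[OF assms assms], symmetric]
  by (rule infsum_cong) (simp add: complex_norm_square[symmetric] del: of_real_power)

lemma ell2_hnorm: "f \<in> sq_summable D \<Longrightarrow> hnorm (ell2 e D) (e f) = sq_norm D f"
  by (simp add: hnorm_def sq_norm_def ell2_cinner_self del: ell2_simps(5))

lemma ell2_hdist:
  assumes "f \<in> sq_summable D" "g \<in> sq_summable D"
  shows "hdist (ell2 e D) (e f) (e g) = sq_norm D (\<lambda>i. f i - g i)"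
proof -
  interpret abelian_group "ell2 e D" by (rule ell2_abelian_group)
  have "\<ominus>\<^bsub>ell2 e D\<^esub> e g = e (\<lambda>i. - g i)"
    using assms(2) sq_summable_cmult[OF assms(2), of "-1"] by (intro minus_equality) auto
  then have "e f \<ominus>\<^bsub>ell2 e D\<^esub> e g = e (\<lambda>i. f i - g i)"
    by (simp add: a_minus_def)
  then show ?thesis using assms by (simp add: hdist_def ell2_hnorm sq_summable_diff)
qed

lemma ell2_Metric_space: "Metric_space (carrier (ell2 e D)) (hdist (ell2 e D))"
proof
  let ?d = "hdist (ell2 e D)"
  have rep: "\<exists>f\<in>sq_summable D. x = e f" if "x \<in> carrier (ell2 e D)" for x using that by auto
  show "0 \<le> ?d x y" for x y
  proof (cases "x \<in> carrier (ell2 e D) \<and> y \<in> carrier (ell2 e D)")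
    case True
    then show ?thesis using rep ell2_hdist by (metis sq_norm_nonneg)
  next
    case False
    then show ?thesis by (auto simp: hdist_def)
  qed
  show "?d x y = ?d y x" for x y
  proof (cases "x \<in> carrier (ell2 e D) \<and> y \<in> carrier (ell2 e D)")
    case True
    then obtain f g where "f \<in> sq_summable D" "g \<in> sq_summable D" "x = e f" "y = e g" using rep by metis
    then show ?thesis by (simp add: ell2_hdist) (rule sq_norm_uminus)
  next
    case False
    then show ?thesis by (auto simp: hdist_def)
  qed
  show "?d x y = 0 \<longleftrightarrow> x = y" if xy: "x \<in> carrier (ell2 e D)" "y \<in> carrier (ell2 e D)" for x y
  proof -
    obtain f g where fg: "f \<in> sq_summable D" "g \<in> sq_summable D" "x = e f" "y = e g" using rep xy by metis
    have "f = g" if "sq_norm D (\<lambda>i. f i - g i) = 0"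
    proof
      fix i show "f i = g i"
        using cmod_le_sq_norm[OF sq_summable_diff[OF fg(1,2)], of i] that by simp
    qed
    moreover have "sq_norm D (\<lambda>i. 0) = 0" by (simp add: sq_norm_def)
    ultimately show ?thesis using fg by (auto simp: ell2_hdist)
  qed
  show "?d x z \<le> ?d x y + ?d y z"
    if xyz: "x \<in> carrier (ell2 e D)" "y \<in> carrier (ell2 e D)" "z \<in> carrier (ell2 e D)" for x y z
  proof -
    obtain f g h where fgh: "f \<in> sq_summable D" "g \<in> sq_summable D" "h \<in> sq_summable D"
      "x = e f" "y = e g" "z = e h" using rep xyz by metis
    show ?thesis
      using sq_summable_add(2)[OF sq_summable_diff[OF fgh(1,2)] sq_summable_diff[OF fgh(2,3)]] fgh
      by (simp add: ell2_hdist)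
  qed
qed

lemma hilbert_space_ell2: "hilbert_space (ell2 e D)"
  unfolding hilbert_space_def hilbert_space_axioms_def
proof (intro conjI allI impI)
  show "Module.module (ring_of_type_algebra :: complex ring) (ell2 e D)" by (rule ell2_module)
  let ?H = "ell2 e D"
  show "cinner ?H (x \<oplus>\<^bsub>?H\<^esub> y) z = cinner ?H x z + cinner ?H y z"
    if "x \<in> carrier ?H" "y \<in> carrier ?H" "z \<in> carrier ?H" for x y z
    using that by (auto simp: distrib_right inner_summable infsum_add)
  show "cinner ?H (a \<odot>\<^bsub>?H\<^esub> x) y = a * cinner ?H x y" if "x \<in> carrier ?H" "y \<in> carrier ?H" for a x y
    using that by (auto simp: mult.assoc inner_summable intro!: infsum_cmult_right)
  show "cinner ?H y x = cnj (cinner ?H x y)" if "x \<in> carrier ?H" "y \<in> carrier ?H" for x y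
    using that by (auto simp: infsum_cnj[symmetric] mult.commute simp del: infsum_cnj)
  show "0 < Re (cinner ?H x x)" if x: "x \<in> carrier ?H" "x \<noteq> \<zero>\<^bsub>?H\<^esub>" for x
  proof -
    obtain f where f: "f \<in> sq_summable D" "x = e f" using x by auto
    obtain i where i: "f i \<noteq> 0" using x f by (auto simp: fun_eq_iff)
    have "0 < sq_norm D f" using cmod_le_sq_norm[OF f(1), of i] i by (meson less_le_trans zero_less_norm_iff)
    then show ?thesis using f by (simp add: ell2_cinner_self sq_norm_def del: ell2_simps(5))
  qed
  interpret Metric_space "carrier ?H" "hdist ?H" by (rule ell2_Metric_space)
  show "Metric_space.mcomplete (carrier ?H) (hdist ?H)"
    unfolding mcomplete_def
  proof (intro allI impI)
    fix s assume s: "MCauchy s"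
    define f where "f n = inv_into UNIV e (s n)" for n
    have sc: "s n \<in> carrier ?H" for n using s unfolding MCauchy_def by blast
    have f: "f n \<in> sq_summable D" "s n = e (f n)" for n using sc[of n] by (auto simp: f_def)
    have "\<exists>N. \<forall>m n. N \<le> m \<longrightarrow> N \<le> n \<longrightarrow> sq_norm D (\<lambda>i. f m i - f n i) < \<epsilon>" if "\<epsilon> > 0" for \<epsilon>
      using s that f(1) unfolding MCauchy_def f(2) by (simp add: ell2_hdist del: ell2_simps)
    from sq_summable_complete[OF f(1) this] obtain g where g: "g \<in> sq_summable D"
      "\<And>\<epsilon>. \<epsilon> > 0 \<Longrightarrow> \<exists>N. \<forall>n\<ge>N. sq_norm D (\<lambda>i. f n i - g i) < \<epsilon>" by metis
    have "limitin mtopology s (e g) sequentially"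
      unfolding limit_metric_sequentially f(2)
      using g f(1) by (simp add: ell2_hdist)
    then show "\<exists>x. limitin mtopology s x sequentially" by blast
  qed
qed

lemma nonzero_hilbert_space_ell2:
  assumes "D \<noteq> {}"
  shows "nonzero_hilbert_space (ell2 e D)"
proof -
  obtain i where i: "i \<in> D" using assms by auto
  have "(\<lambda>j. if j = i then 1 else 0) \<in> sq_summable D"
  proof (rule sq_summable_bounded(1))
    show "L2_set (\<lambda>j. cmod (if j = i then 1 else 0)) F \<le> 1" if "finite F" for F
    proof -
      have "(\<Sum>j\<in>F. (cmod (if j = i then 1 else 0))\<^sup>2) = (\<Sum>j\<in>F. if j = i then 1 else 0)"
        by (intro sum.cong) auto
      also have "\<dots> \<le> (1::real)" using that by simp
      finally show ?thesis by (simp add: L2_set_def)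
    qed
  qed (use i in auto)
  then have "e (\<lambda>j. if j = i then 1 else 0) \<in> carrier (ell2 e D)" by simp
  moreover have "(\<lambda>j. if j = i then 1 else 0 :: complex) \<noteq> (\<lambda>_. 0)" by (auto simp: fun_eq_iff)
  ultimately show ?thesis
    using hilbert_space_ell2 unfolding nonzero_hilbert_space_def by (metis e_eq_iff ell2_simps(2) singletonD)
qed

lemma finite_dimensional_ell2:
  assumes "finite D"
  shows "finite_dimensional (ell2 e D)"
proof -
  let ?H = "ell2 e D"
  interpret hilbert_space ?H by (rule hilbert_space_ell2)
  define \<delta> where "\<delta> i = e (\<lambda>j. if j = i then 1 else 0)" for i
  have inj: "inj \<delta>"
    by (rule injI) (auto simp: \<delta>_def fun_eq_iff split: if_splits)
  have all: "f \<in> sq_summable D" if "\<And>i. i \<notin> D \<Longrightarrow> f i = 0" for f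
    using that assms by (simp add: sq_summable_def)
  have \<delta>: "\<delta> i \<in> carrier ?H" if "i \<in> D" for i
  proof -
    have "(\<lambda>j. if j = i then 1 else 0) \<in> sq_summable D" using that by (intro all) auto
    then show ?thesis by (simp add: \<delta>_def)
  qed
  show ?thesis
    unfolding finite_dimensional_def
  proof (intro exI[of _ "\<delta> ` D"] conjI ballI)
    show "finite (\<delta> ` D)" using assms by simp
    show "\<delta> ` D \<subseteq> carrier ?H" using \<delta> by auto
    fix x assume "x \<in> carrier ?H"
    then obtain f where f: "f \<in> sq_summable D" "x = e f" by auto
    define c where "c b = f (inv_into UNIV \<delta> b)" for b
    have "(\<Oplus>\<^bsub>?H\<^esub>b\<in>\<delta> ` F. c b \<odot>\<^bsub>?H\<^esub> b) = e (\<lambda>i. if i \<in> F then f i else 0)" if "finite F" "F \<subseteq> D" for F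
      using that
    proof (induction F)
      case empty
      then show ?case by simp
    next
      case (insert i F)
      have "(\<Oplus>\<^bsub>?H\<^esub>b\<in>\<delta> ` insert i F. c b \<odot>\<^bsub>?H\<^esub> b)
          = c (\<delta> i) \<odot>\<^bsub>?H\<^esub> \<delta> i \<oplus>\<^bsub>?H\<^esub> (\<Oplus>\<^bsub>?H\<^esub>b\<in>\<delta> ` F. c b \<odot>\<^bsub>?H\<^esub> b)"
        unfolding image_insert
        using insert \<delta> inj by (intro M.finsum_insert) (auto simp: inj_image_mem_iff simp del: ell2_simps)
      also have "\<dots> = e (\<lambda>j. f i * (if j = i then 1 else 0) + (if j \<in> F then f j else 0))"
        using insert inj by (simp add: c_def inv_f_f) (simp add: \<delta>_def)
      also have "(\<lambda>j. f i * (if j = i then 1 else 0) + (if j \<in> F then f j else 0)) =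
          (\<lambda>j. if j \<in> insert i F then f j else 0)"
        using insert by (auto simp: fun_eq_iff)
      finally show ?case .
    qed
    from this[of D] have "(\<Oplus>\<^bsub>?H\<^esub>b\<in>\<delta> ` D. c b \<odot>\<^bsub>?H\<^esub> b) = e (\<lambda>i. if i \<in> D then f i else 0)"
      using assms by simp
    also have "(\<lambda>i. if i \<in> D then f i else 0) = f" using f by (auto simp: sq_summable_def fun_eq_iff)
    finally show "\<exists>c. x = (\<Oplus>\<^bsub>?H\<^esub>b\<in>\<delta> ` D. c b \<odot>\<^bsub>?H\<^esub> b)" using f(2) by metis
  qed
qed

text \<open>The value 0 outside \<open>D\<close> keeps the result inside the carrier.\<close>

definition signed_perm :: "('i \<Rightarrow> complex) \<Rightarrow> ('i \<Rightarrow> 'i) \<Rightarrow> 'h \<Rightarrow> 'h" where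
  "signed_perm s \<pi> x = e (\<lambda>i. if i \<in> D then s i * inv_into UNIV e x (\<pi> i) else 0)"

lemma signed_perm_e [simp]: "signed_perm s \<pi> (e f) = e (\<lambda>i. if i \<in> D then s i * f (\<pi> i) else 0)"
  by (simp add: signed_perm_def cong: if_cong)

lemma signed_perm_invol:
  assumes \<pi>: "\<And>i. i \<in> D \<Longrightarrow> \<pi> i \<in> D \<and> \<pi> (\<pi> i) = i"
    and s: "\<And>i. i \<in> D \<Longrightarrow> s i \<in> {1, -1} \<and> s (\<pi> i) = s i"
  shows "invol (ell2 e D) (signed_perm s \<pi>)"
proof -
  let ?H = "ell2 e D"
  have bij: "bij_betw \<pi> D D"
    by (rule bij_betw_byWitness[of _ \<pi>]) (use \<pi> in auto)
  have closed: "(\<lambda>i. if i \<in> D then s i * f (\<pi> i) else 0) \<in> sq_summable D" if f: "f \<in> sq_summable D" for f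
  proof -
    have "(\<lambda>i. (cmod (f (\<pi> i)))\<^sup>2) summable_on D"
      using f summable_on_reindex_bij_betw[OF bij, of "\<lambda>i. (cmod (f i))\<^sup>2"] by (simp add: sq_summable_def)
    moreover have "(\<lambda>i. (cmod (if i \<in> D then s i * f (\<pi> i) else 0))\<^sup>2) summable_on D \<longleftrightarrow>
        (\<lambda>i. (cmod (f (\<pi> i)))\<^sup>2) summable_on D"
    proof (rule summable_on_cong)
      show "(cmod (if i \<in> D then s i * f (\<pi> i) else 0))\<^sup>2 = (cmod (f (\<pi> i)))\<^sup>2" if "i \<in> D" for i
        using s[OF that] that by (auto simp: norm_mult)
    qed
    ultimately show ?thesis by (simp add: sq_summable_def)
  qed
  have "linear_op ?H (signed_perm s \<pi>)"
    by (auto simp: linear_op_def closed fun_eq_iff algebra_simps)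
  moreover have "signed_perm s \<pi> (signed_perm s \<pi> x) = x" if x: "x \<in> carrier ?H" for x
  proof -
    obtain f where f: "f \<in> sq_summable D" "x = e f" using x by auto
    have eq: "(if i \<in> D then s i * (if \<pi> i \<in> D then s (\<pi> i) * f (\<pi> (\<pi> i)) else 0) else 0) = f i" for i
      using f(1) \<pi>[of i] s[of i] by (auto simp: sq_summable_def)
    show ?thesis
      unfolding f(2) signed_perm_e by (rule arg_cong[of _ _ e], rule ext, rule eq)
  qed
  \<comment> \<open>Reindexing the sum by the permutation moves it to the other argument; the signs
    are real and constant on its orbits.\<close>
  moreover have "selfadjoint ?H (signed_perm s \<pi>)"
    unfolding selfadjoint_def
  proof (intro ballI)
    fix x y assume "x \<in> carrier ?H" "y \<in> carrier ?H"
    then obtain f g where fg: "f \<in> sq_summable D" "g \<in> sq_summable D" "x = e f" "y = e g" by auto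
    have "cinner ?H (signed_perm s \<pi> x) y = (\<Sum>\<^sub>\<infinity>i\<in>D. s i * f (\<pi> i) * cnj (g i))"
      by (simp add: fg) (rule infsum_cong, simp)
    also have "\<dots> = (\<Sum>\<^sub>\<infinity>i\<in>D. f (\<pi> i) * cnj (s (\<pi> i) * g (\<pi> (\<pi> i))))"
    proof (rule infsum_cong)
      show "s i * f (\<pi> i) * cnj (g i) = f (\<pi> i) * cnj (s (\<pi> i) * g (\<pi> (\<pi> i)))" if "i \<in> D" for i
        using \<pi>[OF that] s[OF that] by auto
    qed
    also have "\<dots> = (\<Sum>\<^sub>\<infinity>i\<in>D. f i * cnj (s i * g (\<pi> i)))"
      by (rule infsum_reindex_bij_betw[OF bij])
    also have "\<dots> = cinner ?H x (signed_perm s \<pi> y)"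
      by (simp add: fg) (rule infsum_cong, simp)
    finally show "cinner ?H (signed_perm s \<pi> x) y = cinner ?H x (signed_perm s \<pi> y)" .
  qed
  ultimately show ?thesis by (simp add: invol_def)
qed

end

text \<open>A function is recorded by the rational lower cuts of its real and imaginary parts, that
  is, by a subset of a countable set, and there are as many sets of naturals as reals.\<close>

lemma inj_countable_functions_real:
  shows "\<exists>\<phi> :: ('i::countable \<Rightarrow> complex) \<Rightarrow> real. inj \<phi>"
proof -
  obtain \<psi> :: "nat set \<Rightarrow> real" where \<psi>: "inj \<psi>"
    using nat_sets_eqpoll_reals by (auto simp: eqpoll_def bij_betw_def)
  define S where "S f = to_nat ` ({(i, True, q) |i q. of_rat q < Re (f i)} \<union> {(i, False, q) |i q. of_rat q < Im (f i)})"
    for f :: "'i \<Rightarrow> complex"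
  have "inj S"
  proof (rule injI)
    fix f g assume "S f = S g"
    then have eq: "{(i, True, q) |i q. of_rat q < Re (f i)} \<union> {(i, False, q) |i q. of_rat q < Im (f i)} =
        {(i, True, q) |i q. of_rat q < Re (g i)} \<union> {(i, False, q) |i q. of_rat q < Im (g i)}"
      unfolding S_def by (simp add: inj_image_eq_iff)
    have r: "of_rat q < Re (f i) \<longleftrightarrow> of_rat q < Re (g i)" for q i
      using arg_cong[OF eq, of "\<lambda>A. (i, True, q) \<in> A"] by simp
    have m: "of_rat q < Im (f i) \<longleftrightarrow> of_rat q < Im (g i)" for q i
      using arg_cong[OF eq, of "\<lambda>A. (i, False, q) \<in> A"] by simp
    have cut: "x = y" if "\<And>q. of_rat q < x \<longleftrightarrow> of_rat q < y" for x y :: real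
    proof (rule ccontr)
      assume "x \<noteq> y"
      then consider "x < y" | "y < x" by linarith
      then show False
      proof cases
        case 1
        then obtain q where "x < of_rat q" "of_rat q < y" using of_rat_dense by blast
        then show False using that[of q] by simp
      next
        case 2
        then obtain q where "y < of_rat q" "of_rat q < x" using of_rat_dense by blast
        then show False using that[of q] by simp
      qed
    qed
    show "f = g"
      using cut[of "Re (f _)" "Re (g _)", OF r] cut[of "Im (f _)" "Im (g _)", OF m]
      by (auto simp: fun_eq_iff complex_eq_iff)
  qed
  then have "inj (\<psi> \<circ> S)" using \<psi> by (rule inj_compose[rotated])
  then show ?thesis by blast
qed

section \<open>A group without finite-dimensional representations\<close>

text \<open>The variables \<open>0, \<dots>, 14\<close> stand for \<open>1, s\<^sub>0, s\<^sub>1, t\<^sub>0, t\<^sub>1, u\<^sub>1, W, V, U, b, J\<close> of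
  \<open>finite_dimensional_obstruction\<close> and \<open>t\<^sub>0t\<^sub>1, s\<^sub>0s\<^sub>1, s\<^sub>0u\<^sub>1, t\<^sub>0u\<^sub>1\<close>.
  A square relation \<open>(xy)\<^sup>2 = yz\<close> expresses that \<open>x\<close> conjugates \<open>y\<close> to \<open>z\<close>, provided that
  \<open>y\<close> and \<open>z\<close> commute.\<close>

definition gap_constraints :: "vconstraint list" where
  "gap_constraints =
     [([1, 2, 12, 0], parity4 1), ([3, 4, 11, 0], parity4 1), ([6, 11, 7, 0], parity4 1),
      ([1, 5, 13, 0], parity4 1), ([3, 5, 14, 0], parity4 1),
      ([4, 1], full2), ([10, 1], full2), ([10, 3], full2), ([10, 9], full2), ([9, 1], full2)]"

text \<open>In this order: W s0 W = s1, V s0 V = u1, U s0 U = s1, U t0 U = u1, b t0 b = J t0, W J W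
  = -J and U J U = -J.\<close>

definition gap_squares :: "(int \<times> nat \<times> nat \<times> nat) list" where
  "gap_squares = [(1, 6, 1, 12), (1, 7, 1, 13), (1, 8, 1, 12), (1, 8, 3, 14), (1, 9, 3, 10),
     (-1, 6, 10, 0), (-1, 8, 10, 0)]"

lemma (in hilbert_space) conjugation_from_square:
  assumes inv: "invol H x" "invol H y" and z: "\<And>v. v \<in> carrier H \<Longrightarrow> y (z v) = z (y v)"
    and zc: "\<And>v. v \<in> carrier H \<Longrightarrow> z v \<in> carrier H"
    and sq: "\<And>v. v \<in> carrier H \<Longrightarrow> x (y (x (y v))) = y (z v)" and v: "v \<in> carrier H"
  shows "x (y (x v)) = z v"
  using sq[of "y v"] z[of "y v"] inv[THEN involD(3)] inv[THEN involD(4)] v zc by simp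

lemma (in hilbert_space) gap_constraints_infinite_dimensional:
  assumes fd: "finite_dimensional H" and nz: "carrier H \<noteq> {\<zero>}"
    and u: "unital H g" and mod: "op_model H 15 gap_constraints g"
    and sq: "\<forall>s\<in>set gap_squares. square_relation H g s"
  shows False
proof -
  have inv: "invol H (g i)" if "i < 15" for i using mod that by (simp add: op_model_def)
  have con: "op_constraint H g is R" if "(is, R) \<in> set gap_constraints" for "is" R
    using mod that by (auto simp: op_model_def)
  have i0: "invol H (g 0)" by (rule inv) simp
  note triple = parity_triple_iff[OF u i0]
  have T: "op_constraint H g [1, 2, 12, 0] (parity4 1)" "op_constraint H g [3, 4, 11, 0] (parity4 1)"
    "op_constraint H g [6, 11, 7, 0] (parity4 1)" "op_constraint H g [1, 5, 13, 0] (parity4 1)"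
    "op_constraint H g [3, 5, 14, 0] (parity4 1)"
    by (rule con; simp add: gap_constraints_def)+
  have C: "op_constraint H g [4, 1] full2" "op_constraint H g [10, 1] full2" "op_constraint H g [10, 3] full2"
    "op_constraint H g [10, 9] full2" "op_constraint H g [9, 1] full2"
    by (rule con; simp add: gap_constraints_def)+
  have S: "square_relation H g (1, 6, 1, 12)" "square_relation H g (1, 7, 1, 13)" "square_relation H g (1, 8, 1, 12)"
    "square_relation H g (1, 8, 3, 14)" "square_relation H g (1, 9, 3, 10)"
    "square_relation H g (-1, 6, 10, 0)" "square_relation H g (-1, 8, 10, 0)"
    using sq by (simp_all add: gap_squares_def)
  note cl = involD(4)[OF inv]
  note T' = T[unfolded triple commute_on_def]
  have V: "g 7 x = g 6 (g 3 (g 4 x))" if "x \<in> carrier H" for x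
    using T' that by simp
  have c12: "g 1 (g 2 x) = g 2 (g 1 x)" "g 12 x = g 1 (g 2 x)" if "x \<in> carrier H" for x using T' that by auto
  have c15: "g 1 (g 5 x) = g 5 (g 1 x)" "g 13 x = g 1 (g 5 x)" if "x \<in> carrier H" for x using T' that by auto
  have c35: "g 3 (g 5 x) = g 5 (g 3 x)" "g 14 x = g 3 (g 5 x)" if "x \<in> carrier H" for x using T' that by auto
  have c611: "g 6 (g 11 x) = g 11 (g 6 x)" "g 7 x = g 6 (g 11 x)" if "x \<in> carrier H" for x using T' that by auto
  have g0: "g 0 x = x" if "x \<in> carrier H" for x using u that by (simp add: unital_def)
  show False
  proof (rule finite_dimensional_obstruction[OF fd nz, of "g 1" "g 2" "g 3" "g 4" "g 5" "g 6" "g 7" "g 8" "g 9" "g 10"])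
    show "commute_on H (g 7) (g 6)"
      using c611 cl by (simp add: commute_on_def)
    show "commute_on H (g 3) (g 4)" using T(2) by (simp add: triple)
    show "g 6 (g 1 (g 6 x)) = g 2 x" if "x \<in> carrier H" for x
      by (rule conjugation_from_square[OF inv inv _ _ _ that]) (use S(1) c12 cl in auto)
    show "g 7 (g 1 (g 7 x)) = g 5 x" if "x \<in> carrier H" for x
      by (rule conjugation_from_square[OF inv inv _ _ _ that]) (use S(2) c15 cl in auto)
    show "g 8 (g 1 (g 8 x)) = g 2 x" if "x \<in> carrier H" for x
      by (rule conjugation_from_square[OF inv inv _ _ _ that]) (use S(3) c12 cl in auto)
    show "g 8 (g 3 (g 8 x)) = g 5 x" if "x \<in> carrier H" for x
      by (rule conjugation_from_square[OF inv inv _ _ _ that]) (use S(4) c35 cl in auto)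
    show "g 9 (g 3 (g 9 x)) = g 10 (g 3 x)" if x: "x \<in> carrier H" for x
      using S(5) x cl involD(3)[OF inv, of 3] by (auto dest!: bspec[of _ _ "g 3 x"])
    show "g 6 (g 10 (g 6 x)) = (-1) \<odot> g 10 x" if x: "x \<in> carrier H" for x
      using S(6) x cl g0 involD(3)[OF inv, of 10] by (auto dest!: bspec[of _ _ "g 10 x"])
    show "g 8 (g 10 (g 8 x)) = (-1) \<odot> g 10 x" if x: "x \<in> carrier H" for x
      using S(7) x cl g0 involD(3)[OF inv, of 10] by (auto dest!: bspec[of _ _ "g 10 x"])
  qed (use C V in \<open>auto simp: op_constraint_full2 intro: inv\<close>)
qed

subsection \<open>An infinite-dimensional representation\<close>

text \<open>A set of rationals invariant under the reflections at hand and under doubling and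
  halving. It contains no half-integers, at which \<open>parity_sign\<close> would jump.\<close>

definition nondyadic :: "rat set" where
  "nondyadic = {r. \<forall>k. 2 ^ k * r \<notin> \<int>}"

lemma nondyadic_closed [simp]:
  "r \<in> nondyadic \<Longrightarrow> - r \<in> nondyadic"
  "r \<in> nondyadic \<Longrightarrow> 1 - r \<in> nondyadic"
  "r \<in> nondyadic \<Longrightarrow> 2 - r \<in> nondyadic"
  "r \<in> nondyadic \<Longrightarrow> r - 1 \<in> nondyadic"
  "r \<in> nondyadic \<Longrightarrow> 2 * r \<in> nondyadic"
  "r \<in> nondyadic \<Longrightarrow> r / 2 \<in> nondyadic"
proof -
  assume r: "r \<in> nondyadic"
  have nr: "2 ^ k * r \<notin> \<int>" for k using r by (simp add: nondyadic_def)
  have neg: "- r \<in> nondyadic" if "r \<in> nondyadic" for r using that by (simp add: nondyadic_def)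
  show "- r \<in> nondyadic" by (rule neg[OF r])
  have "2 ^ k * (of_int m - r) \<notin> \<int>" for k m
  proof
    assume "2 ^ k * (of_int m - r) \<in> \<int>"
    then have "2 ^ k * of_int m - 2 ^ k * (of_int m - r) \<in> \<int>" by (intro Ints_diff) auto
    then show False using nr[of k] by (simp add: algebra_simps)
  qed
  from this[of _ 1] this[of _ 2] show one: "1 - r \<in> nondyadic" and "2 - r \<in> nondyadic"
    by (simp_all add: nondyadic_def)
  show "r - 1 \<in> nondyadic" using neg[OF one] by simp
  show "2 * r \<in> nondyadic"
    using nr[of "Suc _"] by (simp add: nondyadic_def mult_ac)
  have "2 ^ k * (r / 2) \<notin> \<int>" for k
  proof
    assume "2 ^ k * (r / 2) \<in> \<int>"
    then have "2 * (2 ^ k * (r / 2)) \<in> \<int>" by (rule Ints_mult[OF Ints_numeral])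
    moreover have "2 * (2 ^ k * (r / 2)) = 2 ^ k * r" by simp
    ultimately show False using nr[of k] by metis
  qed
  then show "r / 2 \<in> nondyadic" by (simp add: nondyadic_def)
qed

lemma third_nondyadic: "1 / 3 \<in> nondyadic"
  unfolding nondyadic_def
proof (intro CollectI allI notI)
  fix k assume "2 ^ k * (1 / 3 :: rat) \<in> \<int>"
  then obtain m where "2 ^ k * (1 / 3 :: rat) = of_int m" by (auto elim: Ints_cases)
  then have "(of_int (2 ^ k) :: rat) = of_int (3 * m)" by simp
  then have "(2::int) ^ k = 3 * m" unfolding of_int_eq_iff .
  then have "3 dvd (2::int) ^ k" by simp
  then have "3 dvd (2::int)" by (rule prime_dvd_power[rotated]) simp
  then show False by simp
qed

text \<open>The parity of the nearest integer. It is even in \<open>r\<close> and changes sign under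
  \<open>1 - r\<close>, so as a diagonal operator it commutes with the reflection s and anticommutes
  with t.\<close>

definition parity_sign :: "rat \<Rightarrow> complex" where
  "parity_sign r = (if even \<lfloor>r + 1 / 2\<rfloor> then 1 else -1)"

lemma parity_sign_square [simp]: "parity_sign r * parity_sign r = 1"
  by (simp add: parity_sign_def)

lemma parity_sign:
  assumes "r \<in> nondyadic"
  shows "parity_sign (- r) = parity_sign r" "parity_sign (1 - r) = - parity_sign r"
proof -
  define n where "n = \<lfloor>r + 1 / 2\<rfloor>"
  have "2 * r \<notin> \<int>" using assms by (auto simp: nondyadic_def dest: spec[of _ 1])
  moreover have "2 * r = of_int (2 * n - 1)" if "r + 1 / 2 = of_int n" using that by simp
  ultimately have "r + 1 / 2 \<noteq> of_int n" by (metis Ints_of_int)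
  moreover have "of_int n \<le> r + 1 / 2" "r + 1 / 2 < of_int n + 1"
    using floor_correct[of "r + 1 / 2"] by (simp_all only: n_def of_int_add of_int_1)
  ultimately have n: "of_int n < r + 1 / 2" "r + 1 / 2 < of_int n + 1" by auto
  have 1: "\<lfloor>- r + 1 / 2\<rfloor> = - n" by (rule floor_unique) (use n in simp_all)
  have 2: "\<lfloor>1 - r + 1 / 2\<rfloor> = 1 - n" by (rule floor_unique) (use n in simp_all)
  show "parity_sign (- r) = parity_sign r" unfolding parity_sign_def 1 n_def[symmetric] by simp
  show "parity_sign (1 - r) = - parity_sign r" unfolding parity_sign_def 2 n_def[symmetric] by simp
qed

type_synonym model_index = "rat \<times> bool \<times> bool"

text \<open>\<open>L\<^sup>2\<close> of two copies of the non-dyadic rationals, tensored with \<open>\<complex>\<^sup>2\<close>. The operators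
  \<open>s\<close>, \<open>t\<close> and \<open>u\<close> are the reflections \<open>-r\<close>, \<open>1 - r\<close> and \<open>2 - r\<close> of one of the copies, so
  \<open>Y = ts\<close> is the translation by \<open>1\<close>; \<open>U\<close> scales by \<open>2\<close> between the copies. Restricting to
  non-dyadic numbers avoids the fixed point \<open>1/2\<close> of \<open>t\<close>.\<close>

definition model_space :: "model_index set" where
  "model_space = nondyadic \<times> UNIV"

text \<open>Signs and permutations for the variables 0 to 14. The component \<open>c\<close> names
  the copy: s0 and t0 act on the copy \<open>False\<close>; s1, t1 and u1 on the copy
  \<open>True\<close>. W, V and U exchange the copies, and J is the sign of the copy. The component
  \<open>j\<close> is the factor C^2, left alone here and reserved for the ancilla.\<close>

definition model_perms :: "((model_index \<Rightarrow> complex) \<times> (model_index \<Rightarrow> model_index)) list" where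
  "model_perms =
     [(\<lambda>_. 1, \<lambda>i. i),
      (\<lambda>_. 1, \<lambda>(r, c, j). if c then (r, c, j) else (- r, c, j)),
      (\<lambda>_. 1, \<lambda>(r, c, j). if c then (- r, c, j) else (r, c, j)),
      (\<lambda>_. 1, \<lambda>(r, c, j). if c then (r, c, j) else (1 - r, c, j)),
      (\<lambda>_. 1, \<lambda>(r, c, j). if c then (1 - r, c, j) else (r, c, j)),
      (\<lambda>_. 1, \<lambda>(r, c, j). if c then (2 - r, c, j) else (r, c, j)),
      (\<lambda>_. 1, \<lambda>(r, c, j). (r, \<not> c, j)),
      (\<lambda>_. 1, \<lambda>(r, c, j). (1 - r, \<not> c, j)),
      (\<lambda>_. 1, \<lambda>(r, c, j). if c then (r / 2, False, j) else (2 * r, True, j)),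
      (\<lambda>(r, c, j). if c then 1 else parity_sign r, \<lambda>i. i),
      (\<lambda>(r, c, j). if c then 1 else -1, \<lambda>i. i),
      (\<lambda>_. 1, \<lambda>(r, c, j). (1 - r, c, j)),
      (\<lambda>_. 1, \<lambda>(r, c, j). (- r, c, j)),
      (\<lambda>_. 1, \<lambda>(r, c, j). if c then (2 - r, c, j) else (- r, c, j)),
      (\<lambda>_. 1, \<lambda>(r, c, j). if c then (2 - r, c, j) else (1 - r, c, j))]"

definition flip :: "model_index \<Rightarrow> model_index" where
  "flip = (\<lambda>(r, c, j). (r, c, \<not> j))"

definition phase :: "model_index \<Rightarrow> complex" where
  "phase = (\<lambda>(r, c, j). if j then -1 else 1)"

text \<open>The Pauli matrices on the first factor of \<open>\<complex>\<^sup>2 \<otimes> \<complex>\<^sup>2\<close>.\<close>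

definition pauli_space :: "model_index set" where
  "pauli_space = {0} \<times> UNIV"

context
  fixes e :: "(model_index \<Rightarrow> complex) \<Rightarrow> 'h"
  assumes e: "inj e"
begin

definition model_op :: "nat \<Rightarrow> 'h \<Rightarrow> 'h" where
  "model_op i = signed_perm e model_space (fst (model_perms ! i)) (snd (model_perms ! i))"

lemma model_op_invol: "i < 15 \<Longrightarrow> invol (ell2 e model_space) (model_op i)"
proof -
  assume "i < 15"
  then have "model_perms ! i \<in> set model_perms" by (intro nth_mem) (simp add: model_perms_def)
  moreover have "\<forall>p\<in>set model_perms. \<forall>x\<in>model_space. snd p x \<in> model_space \<and> snd p (snd p x) = x \<and>
      fst p x \<in> {1, -1} \<and> fst p (snd p x) = fst p x"
    by (simp add: model_perms_def model_space_def parity_sign_def)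
  ultimately show ?thesis
    unfolding model_op_def by (intro signed_perm_invol[OF e]) auto
qed

lemma model_op_simps:
  "model_op 0 (e f) = e (\<lambda>(r, c, j). if r \<in> nondyadic then f (r, c, j) else 0)"
  "model_op 1 (e f) = e (\<lambda>(r, c, j). if r \<in> nondyadic then f (if c then r else - r, c, j) else 0)"
  "model_op 2 (e f) = e (\<lambda>(r, c, j). if r \<in> nondyadic then f (if c then - r else r, c, j) else 0)"
  "model_op 3 (e f) = e (\<lambda>(r, c, j). if r \<in> nondyadic then f (if c then r else 1 - r, c, j) else 0)"
  "model_op 4 (e f) = e (\<lambda>(r, c, j). if r \<in> nondyadic then f (if c then 1 - r else r, c, j) else 0)"
  "model_op 5 (e f) = e (\<lambda>(r, c, j). if r \<in> nondyadic then f (if c then 2 - r else r, c, j) else 0)"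
  "model_op 6 (e f) = e (\<lambda>(r, c, j). if r \<in> nondyadic then f (r, \<not> c, j) else 0)"
  "model_op 7 (e f) = e (\<lambda>(r, c, j). if r \<in> nondyadic then f (1 - r, \<not> c, j) else 0)"
  "model_op 8 (e f) = e (\<lambda>(r, c, j). if r \<in> nondyadic then f (if c then r / 2 else 2 * r, \<not> c, j) else 0)"
  "model_op 9 (e f) = e (\<lambda>(r, c, j). if r \<in> nondyadic then (if c then 1 else parity_sign r) * f (r, c, j) else 0)"
  "model_op 10 (e f) = e (\<lambda>(r, c, j). if r \<in> nondyadic then (if c then 1 else -1) * f (r, c, j) else 0)"
  "model_op 11 (e f) = e (\<lambda>(r, c, j). if r \<in> nondyadic then f (1 - r, c, j) else 0)"
  "model_op 12 (e f) = e (\<lambda>(r, c, j). if r \<in> nondyadic then f (- r, c, j) else 0)"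
  "model_op 13 (e f) = e (\<lambda>(r, c, j). if r \<in> nondyadic then f (if c then 2 - r else - r, c, j) else 0)"
  "model_op 14 (e f) = e (\<lambda>(r, c, j). if r \<in> nondyadic then f (if c then 2 - r else 1 - r, c, j) else 0)"
  unfolding model_op_def model_perms_def signed_perm_e[OF e] e_eq_iff[OF e] fun_eq_iff
  by (auto simp: model_space_def)

lemma model_carrier:
  assumes "\<And>f. (\<And>r c j. r \<notin> nondyadic \<Longrightarrow> f (r, c, j) = 0) \<Longrightarrow> P (e f)"
  shows "\<forall>x\<in>carrier (ell2 e model_space). P x"
  using assms by (auto simp: ell2_simps[OF e] sq_summable_def model_space_def)

lemma model_relations:
  defines "H \<equiv> ell2 e model_space"
  shows "unital H model_op" "op_model H 15 gap_constraints model_op"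
    "\<forall>s\<in>set gap_squares. square_relation H model_op s"
proof -
  interpret hilbert_space H unfolding H_def by (rule hilbert_space_ell2[OF e])
  note rules = model_op_simps model_op_simps(2)[unfolded One_nat_def] e_eq_iff[OF e] fun_eq_iff parity_sign
  have inv: "invol H (model_op i)" if "i < 15" for i unfolding H_def by (rule model_op_invol[OF that])
  show u: "unital H model_op"
    unfolding unital_def H_def by (rule model_carrier) (auto simp: rules)
  note triple = parity_triple_iff[OF u inv[of 0], simplified]
  have comm: "commute_on H (model_op 1) (model_op 2)" "commute_on H (model_op 3) (model_op 4)"
    "commute_on H (model_op 6) (model_op 11)" "commute_on H (model_op 1) (model_op 5)"
    "commute_on H (model_op 3) (model_op 5)" "commute_on H (model_op 4) (model_op 1)"
    "commute_on H (model_op 10) (model_op 1)" "commute_on H (model_op 10) (model_op 3)"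
    "commute_on H (model_op 10) (model_op 9)" "commute_on H (model_op 9) (model_op 1)"
    unfolding commute_on_def H_def by (rule model_carrier; auto simp: rules)+
  have prod: "\<forall>x\<in>carrier H. model_op 12 x = model_op 1 (model_op 2 x)"
    "\<forall>x\<in>carrier H. model_op 11 x = model_op 3 (model_op 4 x)"
    "\<forall>x\<in>carrier H. model_op 7 x = model_op 6 (model_op 11 x)"
    "\<forall>x\<in>carrier H. model_op 13 x = model_op 1 (model_op 5 x)"
    "\<forall>x\<in>carrier H. model_op 14 x = model_op 3 (model_op 5 x)"
    unfolding H_def by (rule model_carrier; auto simp: rules)+
  show "op_model H 15 gap_constraints model_op"
    unfolding op_model_def gap_constraints_def
    using inv comm prod by (simp add: triple op_constraint_full2)
  show "\<forall>s\<in>set gap_squares. square_relation H model_op s"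
    unfolding gap_squares_def H_def list.set ball_simps square_relation.simps
    by (intro conjI; (rule model_carrier)?) (auto simp: rules ell2_simps[OF e])
qed

lemma flip_phase:
  assumes D: "\<And>x. x \<in> D \<Longrightarrow> flip x \<in> D"
  shows "ancilla (ell2 e D) (signed_perm e D (\<lambda>_. 1) flip) (signed_perm e D phase (\<lambda>i. i))"
    and "(\<And>x. x \<in> D \<Longrightarrow> \<pi> x \<in> D) \<Longrightarrow> (\<And>x. s (flip x) = s x) \<Longrightarrow> (\<And>x. \<pi> (flip x) = flip (\<pi> x)) \<Longrightarrow>
      commute_on (ell2 e D) (signed_perm e D s \<pi>) (signed_perm e D (\<lambda>_. 1) flip)"
    and "(\<And>x. x \<in> D \<Longrightarrow> \<pi> x \<in> D) \<Longrightarrow> (\<And>x. phase (\<pi> x) = phase x) \<Longrightarrow>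
      commute_on (ell2 e D) (signed_perm e D s \<pi>) (signed_perm e D phase (\<lambda>i. i))"
proof -
  have ff: "flip (flip x) = x" "phase (flip x) = - phase x" "phase x \<in> {1, -1}" for x
    by (auto simp: flip_def phase_def split: prod.splits)
  note rules = signed_perm_e[OF e] e_eq_iff[OF e] ell2_simps[OF e] fun_eq_iff
  have "invol (ell2 e D) (signed_perm e D (\<lambda>_. 1) flip)" "invol (ell2 e D) (signed_perm e D phase (\<lambda>i. i))"
    by (rule signed_perm_invol[OF e]; auto simp: D ff(1) phase_def)+
  then show "ancilla (ell2 e D) (signed_perm e D (\<lambda>_. 1) flip) (signed_perm e D phase (\<lambda>i. i))"
    using D by (auto simp: ancilla_def rules ff)
  show "commute_on (ell2 e D) (signed_perm e D s \<pi>) (signed_perm e D (\<lambda>_. 1) flip)"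
    if "\<And>x. x \<in> D \<Longrightarrow> \<pi> x \<in> D" "\<And>x. s (flip x) = s x" "\<And>x. \<pi> (flip x) = flip (\<pi> x)"
    using that D by (auto simp: commute_on_def rules)
  show "commute_on (ell2 e D) (signed_perm e D s \<pi>) (signed_perm e D phase (\<lambda>i. i))"
    if "\<And>x. x \<in> D \<Longrightarrow> \<pi> x \<in> D" "\<And>x. phase (\<pi> x) = phase x"
    using that by (auto simp: commute_on_def rules)
qed

lemma model_flip_phase:
  assumes "i < 15"
  shows "commute_on (ell2 e model_space) (model_op i) (signed_perm e model_space (\<lambda>_. 1) flip)"
    "commute_on (ell2 e model_space) (model_op i) (signed_perm e model_space phase (\<lambda>i. i))"
proof -
  have "model_perms ! i \<in> set model_perms" using assms by (intro nth_mem) (simp add: model_perms_def)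
  moreover have "\<forall>p\<in>set model_perms. \<forall>x. (x \<in> model_space \<longrightarrow> snd p x \<in> model_space) \<and> fst p (flip x) = fst p x \<and>
      snd p (flip x) = flip (snd p x) \<and> phase (snd p x) = phase x"
    by (simp add: model_perms_def model_space_def flip_def phase_def)
  moreover have "flip x \<in> model_space" if "x \<in> model_space" for x
    using that by (auto simp: model_space_def flip_def)
  ultimately show "commute_on (ell2 e model_space) (model_op i) (signed_perm e model_space (\<lambda>_. 1) flip)"
    "commute_on (ell2 e model_space) (model_op i) (signed_perm e model_space phase (\<lambda>i. i))"
    unfolding model_op_def by (intro flip_phase(2) flip_phase(3); blast)+
qed

text \<open>The identity and the Pauli matrices X and Z on the component \<open>c\<close>, while
  \<open>j\<close> is again kept for the ancilla.\<close>

definition pauli_op :: "nat \<Rightarrow> 'h \<Rightarrow> 'h" where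
  "pauli_op i = (if i = 0 then signed_perm e pauli_space (\<lambda>_. 1) (\<lambda>i. i)
     else if i = 1 then signed_perm e pauli_space (\<lambda>_. 1) (\<lambda>(r, c, j). (r, \<not> c, j))
     else signed_perm e pauli_space (\<lambda>(r, c, j). if c then -1 else 1) (\<lambda>i. i))"

lemma pauli:
  defines "H \<equiv> ell2 e pauli_space"
  shows "invol H (pauli_op i)" "unital H pauli_op" "square_relation H pauli_op (-1, 1, 2, 0)"
    "ancilla H (signed_perm e pauli_space (\<lambda>_. 1) flip) (signed_perm e pauli_space phase (\<lambda>i. i))"
    "commute_on H (pauli_op i) (signed_perm e pauli_space (\<lambda>_. 1) flip)"
    "commute_on H (pauli_op i) (signed_perm e pauli_space phase (\<lambda>i. i))"
proof -
  note rules = signed_perm_e[OF e] e_eq_iff[OF e] ell2_simps[OF e] fun_eq_iff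
  have flip: "flip x \<in> pauli_space" if "x \<in> pauli_space" for x
    using that by (auto simp: pauli_space_def flip_def)
  show "invol H (pauli_op i)"
    unfolding H_def pauli_op_def
    by (auto simp: pauli_space_def intro!: signed_perm_invol[OF e] split: if_splits)
  show "unital H pauli_op"
    by (auto simp: H_def unital_def pauli_op_def rules sq_summable_def)
  show "square_relation H pauli_op (-1, 1, 2, 0)"
    by (auto simp: H_def pauli_op_def rules pauli_space_def)
  show "ancilla H (signed_perm e pauli_space (\<lambda>_. 1) flip) (signed_perm e pauli_space phase (\<lambda>i. i))"
    unfolding H_def by (rule flip_phase(1)[OF flip])
  show "commute_on H (pauli_op i) (signed_perm e pauli_space (\<lambda>_. 1) flip)"
    unfolding H_def pauli_op_def
    by (cases "i = 0"; cases "i = 1"; simp; rule flip_phase(2)[OF flip]; auto simp: pauli_space_def flip_def)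
  show "commute_on H (pauli_op i) (signed_perm e pauli_space phase (\<lambda>i. i))"
    unfolding H_def pauli_op_def
    by (cases "i = 0"; cases "i = 1"; simp; rule flip_phase(3)[OF flip]; auto simp: pauli_space_def phase_def)
qed

text \<open>A Boolean model is an operator model on a line, where commuting operators cannot satisfy
  that the square of a b is -1. This excludes Boolean models of the first gap.\<close>

lemma one_dimensional_commute:
  fixes d :: model_index
  defines "H \<equiv> ell2 e {d}"
  assumes A: "linear_op H A" and B: "linear_op H B" and x: "x \<in> carrier H"
  shows "A (B x) = B (A x)"
proof -
  interpret hilbert_space H unfolding H_def by (rule hilbert_space_ell2[OF e])
  define \<delta> where "\<delta> = e (\<lambda>i. if i = d then 1 else 0)"
  have \<delta>: "\<delta> \<in> carrier H" by (simp add: H_def \<delta>_def ell2_simps[OF e] sq_summable_def)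
  have span: "\<exists>c. y = c \<odot>\<^bsub>H\<^esub> \<delta>" if y: "y \<in> carrier H" for y
  proof -
    obtain f where f: "f \<in> sq_summable {d}" "y = e f" using y by (auto simp: H_def ell2_simps[OF e])
    have "f = (\<lambda>i. f d * (if i = d then 1 else 0))" using f(1) by (auto simp: sq_summable_def fun_eq_iff)
    then have "y = f d \<odot>\<^bsub>H\<^esub> \<delta>" using f(2) by (simp add: H_def \<delta>_def ell2_simps[OF e])
    then show ?thesis ..
  qed
  obtain a b c where "A \<delta> = a \<odot>\<^bsub>H\<^esub> \<delta>" "B \<delta> = b \<odot>\<^bsub>H\<^esub> \<delta>" "x = c \<odot>\<^bsub>H\<^esub> \<delta>"
    using span linear_opD(1)[OF A \<delta>] linear_opD(1)[OF B \<delta>] x by metis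
  then show ?thesis
    using \<delta> by (simp add: linear_opD(3)[OF A] linear_opD(3)[OF B] mult_ac)
qed

end

section \<open>The classification\<close>

lemma (in hilbert_space) scalar_op_model:
  assumes wf: "wf_constraints A n cs" and mod: "bool_model n cs g"
  shows "op_model H n cs (\<lambda>i x. of_int (g i) \<odot> x)"
proof -
  define f where "f i x = of_int (g i) \<odot> x" for i x
  have inv: "invol H (f i)" if "i < n" for i
  proof -
    have "g i = 1 \<or> g i = -1" using mod that by (auto simp: bool_model_def)
    then show ?thesis
      by (auto simp: f_def invol_def linear_op_def selfadjoint_def sm_distr mult.commute
          cinner_smult_left cinner_smult_right)
  qed
  have "op_constraint H f is R" if c: "(is, R) \<in> set cs" for "is" R
    unfolding op_constraint_def
  proof (intro conjI allI impI)
    have "is": "set is \<subseteq> {..<n}" using wf c by (auto simp: wf_constraints_def)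
    then show "comm_invols H (map f is)"
      using inv by (auto simp: comm_invols_def commute_on_def f_def mult.commute)
    fix x a assume e: "joint_eigen H (map f is) a x" and nz: "x \<noteq> \<zero>"
    have "a = map g is"
    proof (rule nth_equalityI)
      show len: "length a = length (map g is)" using e by (simp add: joint_eigen_def tuples_def)
      fix i assume "i < length a"
      then have i: "i < length is" using len by simp
      then show "a ! i = map g is ! i"
        using joint_eigen_unique[of "f (is ! i)" x "a ! i" "g (is ! i)"] e nz
        by (simp add: joint_eigen_def f_def)
    qed
    then show "a \<in> snd R" using mod c by (auto simp: bool_model_def)
  qed
  with inv show ?thesis unfolding f_def by (auto simp: op_model_def)
qed

text \<open>The full relation belongs to all five classes, so adding it preserves them. An operator
  model then yields a Boolean one, and this is a scalar model on a one-dimensional space.\<close>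

lemma tractable_no_gap_third:
  fixes e :: "(model_index \<Rightarrow> complex) \<Rightarrow> 'h"
  assumes e: "inj e" and A: "zero_valid A \<or> one_valid A \<or> bijunctive A \<or> horn A \<or> dual_horn A"
  shows "\<not> gap_third TYPE('h) (A \<union> {full2})"
proof
  assume "gap_third TYPE('h) (A \<union> {full2})"
  then obtain n cs and H :: "'h hilbert" and f where wf: "wf_constraints (A \<union> {full2}) n cs"
    and H: "nonzero_hilbert_space H" "op_model H n cs f"
    and no: "\<not> (\<exists>(H :: 'h hilbert) f. nonzero_hilbert_space H \<and> finite_dimensional H \<and> op_model H n cs f)"
    unfolding gap_third_iff by blast
  have full: "cnf_definable P full2" for P
    unfolding cnf_definable_def by (rule exI[of _ "[]"]) (simp add: cnf_models_def full2_def)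
  have "zero_valid (A \<union> {full2}) \<or> one_valid (A \<union> {full2}) \<or> bijunctive (A \<union> {full2}) \<or>
      horn (A \<union> {full2}) \<or> dual_horn (A \<union> {full2})"
    using A full by (auto simp: zero_valid_def one_valid_def bijunctive_def horn_def dual_horn_def
        full2_def tuples_def)
  from tractable_bool_model[OF H(1) wf H(2) this] obtain g where g: "bool_model n cs g" ..
  define K where "K = ell2 e {undefined}"
  have "hilbert_space K" unfolding K_def by (rule hilbert_space_ell2[OF e])
  then have "op_model K n cs (\<lambda>i x. of_int (g i) \<odot>\<^bsub>K\<^esub> x)"
    by (rule hilbert_space.scalar_op_model[OF _ wf g])
  moreover have "nonzero_hilbert_space K" "finite_dimensional K"
    unfolding K_def by (rule nonzero_hilbert_space_ell2[OF e] finite_dimensional_ell2[OF e]; simp)+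
  ultimately show False using no by blast
qed

lemma hard_gap_third:
  fixes e :: "(model_index \<Rightarrow> complex) \<Rightarrow> 'h"
  assumes e: "inj e" and hard: "hard_language A"
  shows "gap_third TYPE('h) (A \<union> {full2})"
proof -
  have wf: "wf_constraints parity_language 15 gap_constraints"
    by (simp add: wf_constraints_def gap_constraints_def parity_language_def parity4_def full2_def)
  have sqs: "sg \<in> {1, -1} \<and> a < 15 \<and> b < 15 \<and> q < 15" if "(sg, a, b, q) \<in> set gap_squares" for sg a b q
    using that by (auto simp: gap_squares_def)
  define K where "K = ell2 e model_space"
  have "model_space \<noteq> {}" using third_nondyadic by (auto simp: model_space_def)
  then have K: "nonzero_hilbert_space K" unfolding K_def by (rule nonzero_hilbert_space_ell2[OF e])
  then have KH: "hilbert_space K" by (simp add: nonzero_hilbert_space_def)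
  have flip: "flip x \<in> model_space" if "x \<in> model_space" for x
    using that by (auto simp: model_space_def flip_def)
  show ?thesis
  proof (rule group_reduction[where ?'h = 'h, OF hard _ wf sqs])
    fix n cs
    assume 1: "wf_constraints (A \<union> {full2}) n cs"
      "\<And>(H :: 'h hilbert) f U Z. hilbert_space H \<Longrightarrow> op_model H 15 gap_constraints f \<Longrightarrow> unital H f \<Longrightarrow> ancilla H U Z \<Longrightarrow>
         \<forall>i<15. commute_on H (f i) U \<and> commute_on H (f i) Z \<Longrightarrow> \<forall>s\<in>set gap_squares. square_relation H f s \<Longrightarrow>
         \<exists>f'. op_model H n cs f'"
      "\<And>(H :: 'h hilbert) f. hilbert_space H \<Longrightarrow> op_model H n cs f \<Longrightarrow>
         \<exists>g. unital H g \<and> op_model H 15 gap_constraints g \<and> (\<forall>s\<in>set gap_squares. square_relation H g s)"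
    have "\<exists>f'. op_model K n cs f'"
      using model_relations[OF e] flip_phase(1)[OF e flip] model_flip_phase[OF e]
      by (intro 1(2)[OF KH]) (auto simp: K_def)
    moreover have "\<not> (\<exists>(H :: 'h hilbert) f. nonzero_hilbert_space H \<and> finite_dimensional H \<and> op_model H n cs f)"
    proof
      assume "\<exists>(H :: 'h hilbert) f. nonzero_hilbert_space H \<and> finite_dimensional H \<and> op_model H n cs f"
      then obtain H :: "'h hilbert" and f where H: "hilbert_space H" "carrier H \<noteq> {\<zero>\<^bsub>H\<^esub>}" "finite_dimensional H"
        "op_model H n cs f" by (auto simp: nonzero_hilbert_space_def)
      from 1(3)[OF H(1,4)] obtain g where "unital H g" "op_model H 15 gap_constraints g"
        "\<forall>s\<in>set gap_squares. square_relation H g s" by blast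
      then show False by (rule hilbert_space.gap_constraints_infinite_dimensional[OF H(1,3,2)])
    qed
    ultimately show ?thesis using 1(1) K unfolding gap_third_iff by blast
  qed simp
qed

lemma hard_gap_first:
  fixes e :: "(model_index \<Rightarrow> complex) \<Rightarrow> 'h"
  assumes e: "inj e" and hard: "hard_language A"
  shows "gap_first TYPE('h) A"
proof -
  define sqs where "sqs = [(-1 :: int, 1 :: nat, 2 :: nat, 0 :: nat)]"
  have wf: "wf_constraints parity_language 3 []" by (simp add: wf_constraints_def)
  have sq: "sg \<in> {1, -1} \<and> a < 3 \<and> b < 3 \<and> q < 3" if "(sg, a, b, q) \<in> set sqs" for sg a b q
    using that by (auto simp: sqs_def)
  define K where "K = ell2 e pauli_space"
  have "pauli_space \<noteq> {}" "finite pauli_space" by (auto simp: pauli_space_def)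
  then have K: "nonzero_hilbert_space K" "finite_dimensional K"
    unfolding K_def by (auto intro: nonzero_hilbert_space_ell2[OF e] finite_dimensional_ell2[OF e])
  then have KH: "hilbert_space K" by (simp add: nonzero_hilbert_space_def)
  define L where "L = ell2 e {undefined}"
  have L: "nonzero_hilbert_space L" unfolding L_def by (rule nonzero_hilbert_space_ell2[OF e]) simp
  then have LH: "hilbert_space L" by (simp add: nonzero_hilbert_space_def)
  interpret L: hilbert_space L by (rule LH)
  show ?thesis
  proof (rule group_reduction[where ?'h = 'h, OF hard _ wf sq])
    fix n cs
    assume 1: "wf_constraints (A \<union> {full2}) n cs"
      "\<And>(H :: 'h hilbert) f U Z. hilbert_space H \<Longrightarrow> op_model H 3 [] f \<Longrightarrow> unital H f \<Longrightarrow> ancilla H U Z \<Longrightarrow>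
         \<forall>i<3. commute_on H (f i) U \<and> commute_on H (f i) Z \<Longrightarrow> \<forall>s\<in>set sqs. square_relation H f s \<Longrightarrow>
         \<exists>f'. op_model H n cs f'"
      "\<And>(H :: 'h hilbert) f. hilbert_space H \<Longrightarrow> op_model H n cs f \<Longrightarrow>
         \<exists>g. unital H g \<and> op_model H 3 [] g \<and> (\<forall>s\<in>set sqs. square_relation H g s)"
    \<comment> \<open>Constraints with the full relation are dropped unless it belongs to
      \<open>A\<close>. Operator models remain models, and every Boolean model of the rest satisfies
      the dropped constraints.\<close>
    define ds where "ds = filter (\<lambda>(is, R). R \<in> A) cs"
    have "\<exists>f'. op_model K n cs f'"
    proof (rule 1(2)[OF KH])
      show "op_model K 3 [] (pauli_op e)" using pauli(1)[OF e] by (simp add: op_model_def K_def)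
      show "\<forall>s\<in>set sqs. square_relation K (pauli_op e) s"
        using pauli(3)[OF e] by (simp only: sqs_def K_def list.set ball_simps)
      show "\<forall>i<3. commute_on K (pauli_op e i) (signed_perm e pauli_space (\<lambda>_. 1) flip) \<and>
          commute_on K (pauli_op e i) (signed_perm e pauli_space phase (\<lambda>i. i))"
        using pauli(5,6)[OF e] by (simp add: K_def)
    qed (unfold K_def, rule pauli(2)[OF e], rule pauli(4)[OF e])
    then have op: "\<exists>f. op_model K n ds f" by (auto simp: op_model_def ds_def)
    have "\<nexists>f. bool_model n ds f"
    proof
      assume "\<exists>f. bool_model n ds f"
      then obtain f where f: "bool_model n ds f" ..
      have "map f is \<in> snd R" if c: "(is, R) \<in> set cs" for "is" R
      proof (cases "R \<in> A")
        case True
        then have "(is, R) \<in> set ds" using c by (simp add: ds_def)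
        then show ?thesis using f by (auto simp: bool_model_def)
      next
        case False
        then have "R = full2" "length is = fst R" "set is \<subseteq> {..<n}" using 1(1) c by (auto simp: wf_constraints_def)
        then show ?thesis using f by (auto simp: full2_def tuples_def bool_model_def)
      qed
      then have "bool_model n cs f" using f by (auto simp: bool_model_def)
      from 1(3)[OF LH L.scalar_op_model[OF 1(1) this]] obtain g where g: "op_model L 3 [] g" "unital L g"
        "square_relation L g (-1, 1, 2, 0)" by (auto simp: sqs_def)
      have inv: "invol L (g 1)" "invol L (g 2)" using g(1) by (simp_all add: op_model_def)
      obtain x where x: "x \<in> carrier L" "x \<noteq> \<zero>\<^bsub>L\<^esub>" using L L.M.zero_closed by (auto simp: nonzero_hilbert_space_def)
      have "g 1 (g 2 (g 1 (g 2 x))) = g 1 (g 1 (g 2 (g 2 x)))"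
        using one_dimensional_commute[OF e, of undefined, folded L_def, OF involD(1)[OF inv(2)] involD(1)[OF inv(1)] involD(4)[OF inv(2) x(1)]]
        by simp
      also have "\<dots> = x" using involD(3)[OF inv(1)] involD(3)[OF inv(2)] x(1) by simp
      finally have "1 \<odot>\<^bsub>L\<^esub> x = (-1) \<odot>\<^bsub>L\<^esub> x" using g(2,3) x(1) by (simp add: unital_def)
      then show False using L.sm_left_cancel[OF x(1), of 1 "-1"] x(2) by simp
    qed
    moreover have "wf_constraints A n ds" using 1(1) unfolding wf_constraints_def ds_def by fastforce
    ultimately show ?thesis using op K unfolding gap_first_iff by blast
  qed simp
qed

theorem theorem5p1:
  fixes A :: "brel set"
  assumes universe: "\<exists>e :: real \<Rightarrow> 'h. inj e"
    and relations: "\<forall>R\<in>A. bool_relation R"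
    and nonempty: "\<forall>R\<in>A. snd R \<noteq> {}"
  shows "(\<not> gap_first TYPE('h) A \<longleftrightarrow> \<not> gap_second TYPE('h) A) \<and>
         (\<not> gap_second TYPE('h) A \<longleftrightarrow> \<not> gap_third TYPE('h) (A \<union> {full2})) \<and>
         (\<not> gap_third TYPE('h) (A \<union> {full2}) \<longleftrightarrow>
            zero_valid A \<or> one_valid A \<or> bijunctive A \<or> horn A \<or> dual_horn A)"
proof -
  \<comment> \<open>A type with as many elements as the reals has room for all functions on the
    countable index set, hence for the carriers of all model spaces used.\<close>
  obtain \<epsilon> :: "real \<Rightarrow> 'h" where "inj \<epsilon>" using universe by blast
  moreover obtain \<phi> :: "(model_index \<Rightarrow> complex) \<Rightarrow> real" where "inj \<phi>"
    using inj_countable_functions_real by blast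
  ultimately have e: "inj (\<epsilon> \<circ> \<phi>)" by (rule inj_compose)
  have first_second: "gap_second TYPE('h) A" if "gap_first TYPE('h) A"
    using that unfolding gap_first_iff gap_second_iff by blast
  show ?thesis
  proof (cases "zero_valid A \<or> one_valid A \<or> bijunctive A \<or> horn A \<or> dual_horn A")
    case True
    have "\<not> gap_second TYPE('h) A"
      using tractable_bool_model[OF _ _ _ True] unfolding gap_second_iff by blast
    then show ?thesis using first_second tractable_no_gap_third[OF e True] True by blast
  next
    case False
    then have "hard_language A" using relations nonempty by (simp add: hard_language_def)
    then show ?thesis
      using first_second hard_gap_first[OF e] hard_gap_third[OF e] False by blast
  qed
qed

end
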